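(* Let $u$ be the exact solution of $u_t+au_x=0$ on $\Omega\times[0,T]$ with periodic boundary conditions and smooth initial condition $u_0$, let $u_h$ be the discontinuous Galerkin approximation of $u$ derived from the semi-discrete upwind scheme with piecewise polynomials of degree at most $k$ on the uniform mesh of size $h$, let $\epsilon>0$, and let $K_h^{(2k+1,k+1)}$ and $K_{\epsilon,h}^{(2k+1,k+1)}$ be, respectively, the scaled original filter and the scaled compact filter (all as defined in the context). Let $\Omega_0,\Omega_1$ satisfy $\Omega_0+2\,\mathrm{supp}(K_h^{(2k+1,k+1)})\subset\subset\Omega_1\subset\Omega$. Then, at the final time $T$, $$\left\|u-K_{\epsilon,h}^{(2k+1,k+1)}\star u_h\right\|_{0,\Omega_0}\le C\,h^{2k+1},$$ where $C$ is a constant independent of $h$.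
   Context: Norm: $\|v\|_{0,\Omega_0}=\left(\int_{\Omega_0}v^2\,dx\right)^{1/2}$. The symbol $\subset\subset$ denotes compact containment, and $\star$ denotes convolution on $\mathbb{R}$. Equation: $\Omega=[a_0,b_0]\subset\mathbb{R}$ is a bounded interval, $a>0$ is a constant, and $u$ solves $u_t+au_x=0$ on $\Omega\times[0,T]$ with periodic boundary conditions and initial condition $u(x,0)=u_0(x)\in\mathcal{C}^\infty(\Omega)$. DG method: $\Omega$ is partitioned uniformly, $a_0=x_{1/2}<x_{3/2}<\cdots<x_{N+1/2}=b_0$, with elements $I_j=[x_{j-1/2},x_{j+1/2}]$ of size $h=(b_0-a_0)/N$. Let $V_h=\{v_h: v_h|_{I_j}\in\mathbb{P}^k(I_j),\ j=1,\ldots,N\}$, where $\mathbb{P}^k(I_j)$ is the set of polynomials of degree at most $k$ on $I_j$. For $v\in V_h$, $v(x_{j+1/2}^{-})$ and $v(x_{j+1/2}^{+})$ denote the left and right limits. The DG approximation $u_h(\cdot,t)\in V_h$ of $u$ satisfies, for all $1\le j\le N$ and all $v_h\in V_h$, $$\int_{I_j}(u_h)_t v_h\,dx-\int_{I_j}a u_h (v_h)_x\,dx+\hat f_{j+1/2}\,v_h(x_{j+1/2}^{-})-\hat f_{j-1/2}\,v_h(x_{j-1/2}^{+})=0,$$ with the upwind flux $\hat f_{j+1/2}=a\,u_h(x_{j+1/2}^{-})$ and periodic boundary conditions. Central B-splines: $\psi^{(1)}=\chi_{[-1/2,1/2]}$ (characteristic function of $[-1/2,1/2]$) and, for $\ell\ge1$,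 $$\psi^{(\ell+1)}(x)=\frac1\ell\left(\left(\frac{\ell+1}{2}+x\right)\psi^{(\ell)}\left(x+\frac12\right)+\left(\frac{\ell+1}{2}-x\right)\psi^{(\ell)}\left(x-\frac12\right)\right).$$ Original filter: with $x_\gamma=-k+\gamma$, $$K^{(2k+1,k+1)}(x)=\sum_{\gamma=0}^{2k}d_\gamma\,\psi^{(k+1)}(x-x_\gamma),$$ where the coefficients $d_\gamma$ are determined by $K^{(2k+1,k+1)}\star p=p$ for $p=1,x,\ldots,x^{2k}$; its scaled version is $K_h^{(2k+1,k+1)}(x)=\frac1h K^{(2k+1,k+1)}\left(\frac xh\right)$. Compact filter: for the compress parameter $\epsilon$, $$K_\epsilon^{(2k+1,k+1)}(x)=\sum_{\gamma=0}^{2k}c_\gamma^{(2k+1,k+1)}\psi^{(k+1)}(x-\epsilon x_\gamma),\qquad x_\gamma=-k+\gamma,$$ where the coefficients $c_\gamma^{(2k+1,k+1)}$ (depending on $\epsilon$) are determined by requiring that the filter reproduces polynomials by convolution up to degree $2k$: $K_\epsilon^{(2k+1,k+1)}\star p=p$ for $p=1,x,\ldots,x^{2k}$. The scaled compact filter is $K_{\epsilon,h}^{(2k+1,k+1)}(x)=\frac1h K_\epsilon^{(2k+1,k+1)}\left(\frac xh\right)$. The filtering is applied to the solution at the final time $T$: $(K_{\epsilon,h}^{(2k+1,k+1)}\star u_h)(x,T)=\int_{-\infty}^{\infty}K_{\epsilon,h}^{(2k+1,k+1)}(x-\xi)u_h(\xi,T)\,d\xi$, with $u_h$ extended periodically.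
   Formalization: The initial data of the discontinuous Galerkin approximation, left unspecified (arbitrary data makes the estimate false), is taken to be the L2-projection of the initial condition onto the piecewise polynomial space, and the initial condition is assumed to have a smooth periodic extension. *)

theory Defs
  imports "HOL-Analysis.Analysis" "HOL-Library.Set_Algebras"
    "HOL-Computational_Algebra.Polynomial"
begin

text \<open>Functions on the interval \<open>\<Omega> = [a0, b0]\<close> with periodic boundary conditions are represented
  by their periodic extensions to the real line.\<close>

definition periodic :: "real \<Rightarrow> (real \<Rightarrow> 'a) \<Rightarrow> bool" where
  "periodic L f \<longleftrightarrow> (\<forall>x. f (x + L) = f x)"

definition smooth :: "(real \<Rightarrow> real) \<Rightarrow> bool" where
  "smooth f \<longleftrightarrow> (\<forall>n x. (deriv ^^ n) f differentiable (at x))"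

definition L2norm :: "real set \<Rightarrow> (real \<Rightarrow> real) \<Rightarrow> real" where
  "L2norm A v = sqrt (LINT x:A|lebesgue. (v x)\<^sup>2)"

definition compactly_contained :: "real set \<Rightarrow> real set \<Rightarrow> bool" where
  "compactly_contained A B \<longleftrightarrow> compact (closure A) \<and> closure A \<subseteq> interior B"

definition supp :: "(real \<Rightarrow> real) \<Rightarrow> real set" where
  "supp f = closure {x. f x \<noteq> 0}"

definition conv :: "(real \<Rightarrow> real) \<Rightarrow> (real \<Rightarrow> real) \<Rightarrow> real \<Rightarrow> real" where
  "conv f g x = (LBINT \<xi>. f (x - \<xi>) * g \<xi>)"


subsection \<open>The advection equation\<close>

text \<open>The time derivative is one-sided at the end points of \<open>[0, T]\<close>.  Joint (Frechet)
  differentiability is what makes the solution a classical one; without it, existence of the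
  two partial derivatives alone would not allow the chain rule along characteristics.\<close>

definition advection_solution ::
    "real \<Rightarrow> real \<Rightarrow> real \<Rightarrow> real \<Rightarrow> (real \<Rightarrow> real) \<Rightarrow> (real \<Rightarrow> real \<Rightarrow> real) \<Rightarrow> bool" where
  "advection_solution a0 b0 a T u0 u \<longleftrightarrow>
     (\<forall>t\<in>{0..T}. periodic (b0 - a0) (\<lambda>x. u x t)) \<and>
     (\<forall>x. u x 0 = u0 x) \<and>
     (\<forall>x. \<forall>t\<in>{0..T}.
        (\<lambda>(y, s). u y s) differentiable (at (x, t) within UNIV \<times> {0..T}) \<and>
        vector_derivative (\<lambda>s. u x s) (at t within {0..T}) + a * deriv (\<lambda>y. u y t) x = 0)"


subsection \<open>The discontinuous Galerkin method\<close>

definition mesh_size :: "real \<Rightarrow> real \<Rightarrow> nat \<Rightarrow> real" where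
  "mesh_size a0 b0 N = (b0 - a0) / real N"

text \<open>\<open>node a0 b0 N s\<close> is \<open>x\<^sub>s\<close>, to be used with the half-integers \<open>s = 1/2, 3/2, \<dots>, N + 1/2\<close>.\<close>

definition node :: "real \<Rightarrow> real \<Rightarrow> nat \<Rightarrow> real \<Rightarrow> real" where
  "node a0 b0 N s = a0 + (s - 1/2) * mesh_size a0 b0 N"

definition element :: "real \<Rightarrow> real \<Rightarrow> nat \<Rightarrow> nat \<Rightarrow> real set" where
  "element a0 b0 N j = {node a0 b0 N (real j - 1/2) .. node a0 b0 N (real j + 1/2)}"

text \<open>Elements of \<open>V\<^sub>h\<close> are double-valued at the nodes, so they are required to be polynomial only in
  the interior of each element; the nodal values are arbitrary and play no role below.\<close>

definition dg_space :: "real \<Rightarrow> real \<Rightarrow> nat \<Rightarrow> nat \<Rightarrow> (real \<Rightarrow> real) set" where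
  "dg_space a0 b0 N k = {v. periodic (b0 - a0) v \<and>
     (\<forall>j\<in>{1..N}. \<exists>p. degree p \<le> k \<and> (\<forall>x\<in>interior (element a0 b0 N j). v x = poly p x))}"

definition left_trace :: "(real \<Rightarrow> real) \<Rightarrow> real \<Rightarrow> real" where
  "left_trace v x = Lim (at_left x) v"

definition right_trace :: "(real \<Rightarrow> real) \<Rightarrow> real \<Rightarrow> real" where
  "right_trace v x = Lim (at_right x) v"

text \<open>By periodicity of \<open>w\<close>, the flux at \<open>x\<^sub>1\<^sub>/\<^sub>2\<close> equals the flux at the node \<open>N + 1/2\<close>.\<close>

definition upwind_flux :: "real \<Rightarrow> real \<Rightarrow> nat \<Rightarrow> real \<Rightarrow> (real \<Rightarrow> real) \<Rightarrow> real \<Rightarrow> real" where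
  "upwind_flux a0 b0 N a w s = a * left_trace w (node a0 b0 N s)"

text \<open>The semi-discrete scheme is started from the \<open>L\<^sup>2\<close>-projection of \<open>u0\<close> onto \<open>V\<^sub>h\<close>, the
  standard choice of initial data.\<close>

definition dg_solution ::
    "real \<Rightarrow> real \<Rightarrow> nat \<Rightarrow> nat \<Rightarrow> real \<Rightarrow> real \<Rightarrow> (real \<Rightarrow> real) \<Rightarrow> (real \<Rightarrow> real \<Rightarrow> real) \<Rightarrow> bool" where
  "dg_solution a0 b0 N k a T u0 uh \<longleftrightarrow>
     (\<forall>t\<in>{0..T}. (\<lambda>x. uh x t) \<in> dg_space a0 b0 N k) \<and>
     (\<forall>v\<in>dg_space a0 b0 N k. (LBINT x:{a0..b0}. (u0 x - uh x 0) * v x) = 0) \<and>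
     (\<forall>t\<in>{0..T}. \<forall>j\<in>{1..N}.
        (\<forall>x\<in>interior (element a0 b0 N j). (\<lambda>s. uh x s) differentiable (at t within {0..T})) \<and>
        (\<forall>v\<in>dg_space a0 b0 N k.
           (LBINT x:element a0 b0 N j. vector_derivative (\<lambda>s. uh x s) (at t within {0..T}) * v x)
         - (LBINT x:element a0 b0 N j. a * uh x t * deriv v x)
         + upwind_flux a0 b0 N a (\<lambda>x. uh x t) (real j + 1/2)
             * left_trace v (node a0 b0 N (real j + 1/2))
         - upwind_flux a0 b0 N a (\<lambda>x. uh x t) (real j - 1/2)
             * right_trace v (node a0 b0 N (real j - 1/2)) = 0))"


subsection \<open>B-splines and filters\<close>

text \<open>Order \<open>0\<close> is a dummy case.  With the closed-interval convention for \<open>\<psi>\<^sup>(\<^sup>1\<^sup>)\<close>, the recurrence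
  gives the usual splines up to finitely many points, which do not affect convolutions.\<close>

fun bspline :: "nat \<Rightarrow> real \<Rightarrow> real" where
  "bspline 0 x = 0"
| "bspline (Suc 0) x = indicator {-1/2..1/2} x"
| "bspline (Suc (Suc m)) x =
     1 / real (Suc m) *
       ((real (Suc (Suc m)) / 2 + x) * bspline (Suc m) (x + 1/2) +
        (real (Suc (Suc m)) / 2 - x) * bspline (Suc m) (x - 1/2))"

definition spline_comb :: "nat \<Rightarrow> (nat \<Rightarrow> real) \<Rightarrow> (nat \<Rightarrow> real) \<Rightarrow> real \<Rightarrow> real" where
  "spline_comb k z c x = (\<Sum>\<gamma>\<le>2*k. c \<gamma> * bspline (k + 1) (x - z \<gamma>))"

text \<open>The coefficients determined by polynomial reproduction for the shifts \<open>z\<close>.  The index set is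
  \<open>0..2k\<close>; the coefficients are extended by zero to make the vector unique as a function.\<close>

definition filter_coeffs :: "nat \<Rightarrow> (nat \<Rightarrow> real) \<Rightarrow> nat \<Rightarrow> real" where
  "filter_coeffs k z = (THE c. (\<forall>\<gamma>>2*k. c \<gamma> = 0) \<and>
     (\<forall>m\<le>2*k. conv (spline_comb k z c) (\<lambda>x. x ^ m) = (\<lambda>x. x ^ m)))"

definition shift :: "nat \<Rightarrow> nat \<Rightarrow> real" where
  "shift k \<gamma> = - real k + real \<gamma>"

definition original_filter :: "nat \<Rightarrow> real \<Rightarrow> real" where
  "original_filter k = spline_comb k (shift k) (filter_coeffs k (shift k))"

definition compact_filter :: "nat \<Rightarrow> real \<Rightarrow> real \<Rightarrow> real" where
  "compact_filter k \<epsilon> =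
     spline_comb k (\<lambda>\<gamma>. \<epsilon> * shift k \<gamma>) (filter_coeffs k (\<lambda>\<gamma>. \<epsilon> * shift k \<gamma>))"

definition scaled :: "real \<Rightarrow> (real \<Rightarrow> real) \<Rightarrow> real \<Rightarrow> real" where
  "scaled h K x = 1 / h * K (x / h)"

end

theory Submission
  imports Defs
begin

text \<open>
  The convolution of the error \<open>e = u - u\<^sub>h\<close> at time \<open>T\<close> with one scaled B-spline \<open>\<psi>\<close> of order
  \<open>k + 1\<close> is of order \<open>h\<^sup>2\<^sup>k\<^sup>+\<^sup>1\<close>, although \<open>e\<close> itself is in general only of order \<open>h\<^sup>k\<^sup>+\<^sup>1\<close>.  A filter
  is a fixed combination of translates of such B-splines, and it differs from the identity on smooth functions by
  \<open>O(h\<^sup>2\<^sup>k\<^sup>+\<^sup>1)\<close> because it reproduces polynomials of degree \<open>2k\<close>.  Writing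
  \<open>u - K \<star> u\<^sub>h = (u - K \<star> u) + K \<star> e\<close> gives the theorem.  Nothing in this argument relates the
  shifts of the B-splines to the mesh, so it covers every compress parameter; only the width of
  the B-splines has to be the mesh size.  Since everything is periodic, the estimate is proved on a full
  period; the support condition places \<open>\<Omega>\<^sub>0\<close> inside one.

  The bound for \<open>v = \<psi> \<star> e\<close> is a duality argument.  As \<open>v\<close> is continuous, periodic and has mean
  zero, \<open>v = \<Phi>\<^sup>(\<^sup>k\<^sup>+\<^sup>1\<^sup>)\<close> for some periodic \<open>\<Phi>\<close>.  A B-spline turns derivatives into
  differences (\<open>spline_mean_deriv_chain\<close>), so \<open>\<parallel>v\<parallel>\<^sup>2 = (\<psi> \<star> e, \<Phi>\<^sup>(\<^sup>k\<^sup>+\<^sup>1\<^sup>))\<close> is the pairing of \<open>e\<close> with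
  a divided difference of order \<open>k + 1\<close> of \<open>\<Phi>\<close>.  Moving the differences to the
  other side replaces \<open>e\<close> by its divided difference, and the scheme on a uniform mesh commutes with
  differences: this is the error of the same scheme for the differenced initial data.  It
  therefore suffices to bound \<open>(e, \<Phi>)\<close> by \<open>h\<^sup>2\<^sup>k\<^sup>+\<^sup>1 \<parallel>\<Phi>\<^sup>(\<^sup>k\<^sup>+\<^sup>1\<^sup>)\<parallel>\<close> (\<open>weak_error_estimate\<close>).

  That bound rests on one identity (\<open>transport_pairing_has_derivative\<close>).  If \<open>\<phi>\<close> is transported
  exactly and \<open>\<pi>\<phi>\<close> is its \<open>L\<^sup>2\<close>-projection onto \<open>V\<^sub>h\<close>, then
  \<open>d/dt (u\<^sub>h, \<phi>) = a \<Sum>\<^sub>j [u\<^sub>h]\<^sub>j (\<phi> - \<pi>\<phi>)(x\<^sub>j\<^sup>+)\<close>, where \<open>[u\<^sub>h]\<^sub>j\<close> is the jump of \<open>u\<^sub>h\<close> at the node \<open>x\<^sub>j\<close>.  The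
  scheme also dissipates energy, \<open>d/dt \<parallel>u\<^sub>h\<parallel>\<^sup>2 = - a \<Sum>\<^sub>j [u\<^sub>h]\<^sub>j\<^sup>2\<close>.  Applied to \<open>\<phi> = u\<close>, the
  identity bounds the accumulated squares of the jumps by \<open>h\<^sup>2\<^sup>k\<^sup>+\<^sup>1\<close>; applied to the dual function it
  pairs these jumps, of size \<open>h\<^sup>k\<^sup>+\<^sup>1\<^sup>/\<^sup>2\<close>, with projection errors that have the same size.
  Working with derivatives of suitable combinations of the two quantities avoids Gronwall's
  inequality and integrals in time.

  All this is carried out in the variable \<open>X = (x - a\<^sub>0) / h\<close>, on a mesh with cells \<open>[j, j + 1]\<close>,
  integer period \<open>N\<close> and speed \<open>\<alpha> = a / h\<close>.  Apart from the speed, powers of \<open>h\<close> then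
  enter only through the initial function, which gains a factor \<open>h\<close> with each derivative.
\<close>

section \<open>Lagrange interpolation and moments\<close>

definition lagrange_basis :: "(nat \<Rightarrow> real) \<Rightarrow> nat \<Rightarrow> nat \<Rightarrow> real poly" where
  "lagrange_basis w n i = (\<Prod>j\<in>{..n} - {i}. smult (inverse (w i - w j)) [:- w j, 1:])"

lemma degree_lagrange_basis:
  assumes "i \<le> n"
  shows "degree (lagrange_basis w n i) \<le> n"
proof -
  have "degree (lagrange_basis w n i)
      \<le> (\<Sum>j\<in>{..n} - {i}. degree (smult (inverse (w i - w j)) [:- w j, 1:]))"
    unfolding lagrange_basis_def by (rule order.trans[OF degree_prod_sum_le]) (auto simp: o_def)
  also have "\<dots> \<le> (\<Sum>j\<in>{..n} - {i}. 1)"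
    by (intro sum_mono) (auto intro: order.trans[OF degree_smult_le])
  also have "\<dots> = n"
    using assms by simp
  finally show ?thesis .
qed

lemma poly_lagrange_basis:
  assumes "inj_on w {..n}" "i \<le> n" "m \<le> n"
  shows "poly (lagrange_basis w n i) (w m) = (if m = i then 1 else 0)"
proof (cases "m = i")
  case True
  have "poly (lagrange_basis w n i) (w i) = (\<Prod>j\<in>{..n} - {i}. 1)"
    unfolding lagrange_basis_def poly_prod
  proof (intro prod.cong refl)
    fix j assume "j \<in> {..n} - {i}"
    then have "w i - w j \<noteq> 0"
      using assms by (auto dest: inj_onD)
    moreover have "poly (smult (inverse (w i - w j)) [:- w j, 1:]) (w i) = inverse (w i - w j) * (w i - w j)"
      by (simp add: algebra_simps)
    ultimately show "poly (smult (inverse (w i - w j)) [:- w j, 1:]) (w i) = 1"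
      using left_inverse[of "w i - w j"] by metis
  qed
  then show ?thesis using True by simp
next
  case False
  then show ?thesis
    using assms unfolding lagrange_basis_def poly_prod by (auto intro!: prod_zero bexI[of _ m])
qed

lemma lagrange_interpolation:
  assumes w: "inj_on w {..n}" and p: "degree p \<le> n"
  shows "p = (\<Sum>i\<le>n. smult (poly p (w i)) (lagrange_basis w n i))"
proof -
  let ?q = "p - (\<Sum>i\<le>n. smult (poly p (w i)) (lagrange_basis w n i))"
  have deg: "degree ?q \<le> n"
    by (intro degree_diff_le p degree_sum_le)
       (auto intro: order.trans[OF degree_smult_le] degree_lagrange_basis)
  have root: "poly ?q (w m) = 0" if "m \<le> n" for m
    using that by (simp add: poly_sum poly_lagrange_basis[OF w] if_distrib cong: if_cong)
  have "?q = 0"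
  proof (rule ccontr)
    assume nz: "?q \<noteq> 0"
    have "card (w ` {..n}) \<le> card {x. poly ?q x = 0}"
      by (intro card_mono poly_roots_finite nz) (use root in auto)
    also have "\<dots> \<le> n"
      using card_poly_roots_bound[OF nz] deg by linarith
    finally show False
      using card_image[OF w] by simp
  qed
  then show ?thesis by simp
qed

lemma poly_altdef_le:
  fixes p :: "real poly"
  assumes "degree p \<le> n"
  shows "poly p x = (\<Sum>i\<le>n. coeff p i * x ^ i)"
  by (subst poly_as_sum_of_monoms'[OF assms, symmetric]) (simp only: poly_sum poly_monom)

text \<open>The coefficients of the Lagrange basis polynomials form the inverse of the Vandermonde matrix.\<close>

lemma moment_problem_unique_solution:
  fixes w s :: "nat \<Rightarrow> real"
  assumes w: "inj_on w {..n}"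
  shows "\<exists>!c. (\<forall>i>n. c i = 0) \<and> (\<forall>m\<le>n. (\<Sum>i\<le>n. c i * w i ^ m) = s m)"
proof (rule ex1I)
  let ?l = "lagrange_basis w n"
  let ?c = "\<lambda>i. if i \<le> n then \<Sum>j\<le>n. coeff (?l i) j * s j else 0"
  have "(\<Sum>i\<le>n. ?c i * w i ^ m) = s m" if "m \<le> n" for m
  proof -
    have X: "monom 1 m = (\<Sum>i\<le>n. smult (w i ^ m) (?l i))"
      using lagrange_interpolation[OF w, of "monom 1 m"] that by (simp add: degree_monom_eq poly_monom)
    have "(\<Sum>i\<le>n. ?c i * w i ^ m) = (\<Sum>i\<le>n. \<Sum>j\<le>n. coeff (?l i) j * s j * w i ^ m)"
      by (simp add: sum_distrib_right)
    also have "\<dots> = (\<Sum>j\<le>n. s j * coeff (\<Sum>i\<le>n. smult (w i ^ m) (?l i)) j)"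
      by (subst sum.swap) (simp add: coeff_sum sum_distrib_left mult_ac)
    also have "\<dots> = s m"
      using that unfolding X[symmetric] by (simp add: if_distrib cong: if_cong)
    finally show ?thesis .
  qed
  then show "(\<forall>i>n. ?c i = 0) \<and> (\<forall>m\<le>n. (\<Sum>i\<le>n. ?c i * w i ^ m) = s m)"
    by auto
next
  fix c assume c: "(\<forall>i>n. c i = 0) \<and> (\<forall>m\<le>n. (\<Sum>i\<le>n. c i * w i ^ m) = s m)"
  show "c = (\<lambda>i. if i \<le> n then \<Sum>j\<le>n. coeff (lagrange_basis w n i) j * s j else 0)"
  proof
    fix i
    show "c i = (if i \<le> n then \<Sum>j\<le>n. coeff (lagrange_basis w n i) j * s j else 0)"
    proof (cases "i \<le> n")
      case True
      let ?l = "lagrange_basis w n i"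
      have "(\<Sum>j\<le>n. coeff ?l j * s j) = (\<Sum>j\<le>n. coeff ?l j * (\<Sum>m\<le>n. c m * w m ^ j))"
        using c by (intro sum.cong) auto
      also have "\<dots> = (\<Sum>m\<le>n. c m * (\<Sum>j\<le>n. coeff ?l j * w m ^ j))"
        unfolding sum_distrib_left by (subst sum.swap) (simp add: mult_ac)
      also have "\<dots> = (\<Sum>m\<le>n. c m * poly ?l (w m))"
        by (intro sum.cong refl arg_cong2[where f="(*)"] poly_altdef_le[symmetric] degree_lagrange_basis True)
      also have "\<dots> = c i"
        using True by (simp add: poly_lagrange_basis[OF w] if_distrib cong: if_cong)
      finally show ?thesis using True by simp
    qed (use c in auto)
  qed
qed

section \<open>Pairing smooth functions with B-splines\<close>

text \<open>Properties of B-splines are stated for these pairings.  The pointwise spline identities fail at some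
  knots, because the order-one spline is the indicator of a closed interval; the pairings do not see this.\<close>

definition spline_mean :: "nat \<Rightarrow> (real \<Rightarrow> real) \<Rightarrow> real" where
  "spline_mean l g = (LBINT y. bspline l y * g y)"

text \<open>The function \<open>F i\<close> is the derivative of order \<open>i\<close> of \<open>F 0\<close>.  Keeping the whole family as data
  treats derivatives, repeated antiderivatives, translates and differences alike.\<close>

definition deriv_chain :: "nat \<Rightarrow> (nat \<Rightarrow> real \<Rightarrow> real) \<Rightarrow> bool" where
  "deriv_chain n F \<longleftrightarrow> (\<forall>i<n. \<forall>x. (F i has_real_derivative F (Suc i) x) (at x))
     \<and> continuous_on UNIV (F n)"

definition fdiff :: "(real \<Rightarrow> real) \<Rightarrow> real \<Rightarrow> real" where
  "fdiff g x = g (x + 1) - g x"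

lemma bspline_measurable [measurable]: "bspline l \<in> borel_measurable borel"
proof (induction l rule: nat_induct)
  case 0
  have "bspline 0 = (\<lambda>x. 0)" by (rule ext) simp
  then show ?case by simp
next
  case (Suc l)
  show ?case
  proof (cases l)
    case 0
    have "bspline (Suc 0) = indicator {-1/2..1/2}" by (rule ext) simp
    then show ?thesis using 0 by simp
  next
    case l: (Suc m)
    note [measurable] = Suc[unfolded l]
    have "bspline (Suc (Suc m)) = (\<lambda>x. 1 / real (Suc m) *
         ((real (Suc (Suc m)) / 2 + x) * bspline (Suc m) (x + 1/2) +
          (real (Suc (Suc m)) / 2 - x) * bspline (Suc m) (x - 1/2)))"
      by (rule ext) simp
    then show ?thesis by (simp add: l)
  qed
qed

lemma bspline_eq_0: "\<bar>x\<bar> > real l / 2 \<Longrightarrow> bspline l x = 0"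
proof (induction l x rule: bspline.induct)
  case (3 m x)
  then have "bspline (Suc m) (x + 1/2) = 0" "bspline (Suc m) (x - 1/2) = 0"
    by (auto simp: abs_if field_simps split: if_splits)
  then show ?case by simp
qed (auto simp: indicator_def)

lemma abs_half_bounds:
  fixes n x :: real
  assumes "\<not> \<bar>x\<bar> > n / 2"
  shows "\<bar>n / 2 + x\<bar> \<le> n" "\<bar>n / 2 - x\<bar> \<le> n"
  using assms by (linarith, linarith)

lemma bspline_bounded: "\<exists>B. \<forall>x. \<bar>bspline l x\<bar> \<le> B"
proof (induction l)
  case 0
  then show ?case by auto
next
  case (Suc l)
  show ?case
  proof (cases l)
    case 0
    then show ?thesis by (auto simp: indicator_def intro!: exI[of _ 1])
  next
    case l: (Suc m)
    obtain B where B: "\<And>x. \<bar>bspline l x\<bar> \<le> B"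
      using Suc by auto
    then have B0: "B \<ge> 0"
      using abs_ge_zero order.trans by blast
    let ?n = "real (Suc l)"
    have "\<bar>bspline (Suc l) x\<bar> \<le> 1 / real (Suc m) * (?n * B + ?n * B)" for x
    proof (cases "\<bar>x\<bar> > ?n / 2")
      case True
      then have "bspline (Suc l) x = 0" by (rule bspline_eq_0)
      then show ?thesis using B0 by simp
    next
      case False
      have 1: "\<bar>(?n / 2 + x) * bspline l (x + 1/2)\<bar> \<le> ?n * B"
        unfolding abs_mult by (rule mult_mono[OF abs_half_bounds(1)[OF False] B]) simp_all
      have 2: "\<bar>(?n / 2 - x) * bspline l (x - 1/2)\<bar> \<le> ?n * B"
        unfolding abs_mult by (rule mult_mono[OF abs_half_bounds(2)[OF False] B]) simp_all
      have "bspline (Suc l) x = 1 / real (Suc m) *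
          ((?n / 2 + x) * bspline l (x + 1/2) + (?n / 2 - x) * bspline l (x - 1/2))"
        unfolding l bspline.simps(3) ..
      then have "\<bar>bspline (Suc l) x\<bar> = 1 / real (Suc m) *
          \<bar>(?n / 2 + x) * bspline l (x + 1/2) + (?n / 2 - x) * bspline l (x - 1/2)\<bar>"
        by (simp only: abs_mult) simp
      also have "\<dots> \<le> 1 / real (Suc m) * (?n * B + ?n * B)"
        by (rule mult_left_mono[OF order.trans[OF abs_triangle_ineq add_mono[OF 1 2]]]) simp
      finally show ?thesis .
    qed
    then show ?thesis by blast
  qed
qed

lemma bspline_mult_integrable:
  assumes [measurable]: "g \<in> borel_measurable borel"
    and bdd: "\<And>R. \<exists>B. \<forall>x. \<bar>x\<bar> \<le> R \<longrightarrow> \<bar>g x\<bar> \<le> B"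
  shows "integrable lborel (\<lambda>y. bspline l y * g y)"
proof -
  obtain B where B: "\<And>x. \<bar>bspline l x\<bar> \<le> B"
    using bspline_bounded by auto
  obtain M where M: "\<And>x. \<bar>x\<bar> \<le> real l / 2 \<Longrightarrow> \<bar>g x\<bar> \<le> M"
    using bdd by blast
  have "integrable lborel (\<lambda>y. indicator {-real l/2..real l/2} y *\<^sub>R (bspline l y * g y))"
  proof (rule integrableI_bounded_set_indicator[where B="B * M"])
    show "AE x in lborel. x \<in> {- real l / 2..real l / 2} \<longrightarrow> norm (bspline l x * g x) \<le> B * M"
      using B M by (intro AE_I2 impI) (auto simp: abs_mult intro!: mult_mono' M)
  qed auto
  also have "(\<lambda>y. indicator {-real l/2..real l/2} y *\<^sub>R (bspline l y * g y)) = (\<lambda>y. bspline l y * g y)"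
  proof
    fix y
    show "indicator {-real l/2..real l/2} y *\<^sub>R (bspline l y * g y) = bspline l y * g y"
      using bspline_eq_0[of l y] by (cases "\<bar>y\<bar> > real l / 2") (auto simp: indicator_def)
  qed
  finally show ?thesis .
qed

lemma continuous_bdd_on_bounded:
  fixes g :: "real \<Rightarrow> real"
  assumes "continuous_on UNIV g"
  shows "\<exists>B. \<forall>x. \<bar>x\<bar> \<le> R \<longrightarrow> \<bar>g x\<bar> \<le> B"
proof -
  have "compact (g ` {-R..R})"
    by (intro compact_continuous_image) (auto intro: continuous_on_subset[OF assms])
  then obtain B where "\<forall>y\<in>g ` {-R..R}. norm y \<le> B"
    using compact_imp_bounded bounded_iff by blast
  then show ?thesis by (intro exI[of _ B]) (auto simp: abs_le_iff)
qed

lemma bspline_continuous_integrable: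
  assumes "continuous_on UNIV g"
  shows "integrable lborel (\<lambda>y. bspline l y * g y)"
  using assms by (intro bspline_mult_integrable continuous_bdd_on_bounded borel_measurable_continuous_onI)

lemma spline_mean_add:
  assumes "continuous_on UNIV f" "continuous_on UNIV g"
  shows "spline_mean l (\<lambda>y. f y + g y) = spline_mean l f + spline_mean l g"
  unfolding spline_mean_def distrib_left
  by (intro Bochner_Integration.integral_add bspline_continuous_integrable assms)

lemma spline_mean_diff:
  assumes "continuous_on UNIV f" "continuous_on UNIV g"
  shows "spline_mean l (\<lambda>y. f y - g y) = spline_mean l f - spline_mean l g"
  unfolding spline_mean_def right_diff_distrib
  by (intro Bochner_Integration.integral_diff bspline_continuous_integrable assms)

lemma spline_mean_cmult: "spline_mean l (\<lambda>y. c * g y) = c * spline_mean l g"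
  unfolding spline_mean_def by (simp add: mult.left_commute)

lemma spline_mean_1:
  assumes "\<And>y. (H has_real_derivative H' y) (at y)" "continuous_on UNIV H'"
  shows "spline_mean (Suc 0) H' = H (1/2) - H (-1/2)"
proof -
  have "spline_mean (Suc 0) H' = (LBINT y. H' y * indicator {-1/2..1/2} y)"
    by (simp add: spline_mean_def mult.commute)
  also have "\<dots> = H (1/2) - H (-1/2)"
    using assms by (intro integral_FTC_Icc_real) (auto simp: continuous_on_eq_continuous_at)
  finally show ?thesis .
qed

text \<open>The defining recurrence, transposed to act on the function that is paired with the B-spline.\<close>

lemma spline_mean_Suc_Suc:
  assumes f: "continuous_on UNIV f"
  shows "spline_mean (Suc (Suc m)) f = 1 / real (Suc m) *
    spline_mean (Suc m) (\<lambda>y. (real (Suc m) / 2 + y) * f (y - 1/2) + (real (Suc m) / 2 - y) * f (y + 1/2))"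
proof -
  let ?b = "bspline (Suc m)" and ?n = "real (Suc m)"
  have fc: "continuous_on UNIV (\<lambda>y. f (y + c))" for c
    by (intro continuous_on_compose2[OF f] continuous_intros) auto
  have i1: "integrable lborel (\<lambda>y. ?b y * ((?n / 2 + y) * f (y - 1/2)))"
    using fc[of "-1/2"] by (intro bspline_continuous_integrable continuous_intros) simp_all
  have i2: "integrable lborel (\<lambda>y. ?b y * ((?n / 2 - y) * f (y + 1/2)))"
    by (intro bspline_continuous_integrable continuous_intros fc)
  have s1: "integrable lborel (\<lambda>y. ?b (y + 1/2) * ((?n / 2 + (y + 1/2)) * f (y + 1/2 - 1/2)))"
    using lborel_integrable_real_affine[OF i1, of 1 "1/2"] by (simp add: add.commute)
  have s2: "integrable lborel (\<lambda>y. ?b (y - 1/2) * ((?n / 2 - (y - 1/2)) * f (y - 1/2 + 1/2)))"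
    using lborel_integrable_real_affine[OF i2, of 1 "-1/2"] by (simp add: add.commute)
  have e1: "(LBINT y. ?b (y + 1/2) * ((?n / 2 + (y + 1/2)) * f (y + 1/2 - 1/2)))
      = (LBINT y. ?b y * ((?n / 2 + y) * f (y - 1/2)))"
    by (subst (2) lborel_integral_real_affine[of 1 _ "1/2"]) (simp_all add: add.commute)
  have e2: "(LBINT y. ?b (y - 1/2) * ((?n / 2 - (y - 1/2)) * f (y - 1/2 + 1/2)))
      = (LBINT y. ?b y * ((?n / 2 - y) * f (y + 1/2)))"
    by (subst (2) lborel_integral_real_affine[of 1 _ "-1/2"]) (simp_all add: add.commute)
  have "spline_mean (Suc (Suc m)) f = (LBINT y. 1 / ?n *
      (?b (y + 1/2) * ((?n / 2 + (y + 1/2)) * f (y + 1/2 - 1/2))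
       + ?b (y - 1/2) * ((?n / 2 - (y - 1/2)) * f (y - 1/2 + 1/2))))"
    unfolding spline_mean_def by (intro Bochner_Integration.integral_cong refl) (simp add: field_simps)
  also have "\<dots> = 1 / ?n * ((LBINT y. ?b y * ((?n / 2 + y) * f (y - 1/2)))
      + (LBINT y. ?b y * ((?n / 2 - y) * f (y + 1/2))))"
    using s1 s2 by (simp only: integral_mult_right_zero Bochner_Integration.integral_add e1 e2)
  also have "\<dots> = 1 / ?n * spline_mean (Suc m)
       (\<lambda>y. (?n / 2 + y) * f (y - 1/2) + (?n / 2 - y) * f (y + 1/2))"
    unfolding spline_mean_def distrib_left[of "?b _"] using i1 i2
    by (simp only: Bochner_Integration.integral_add)
  finally show ?thesis .
qed

text \<open>This is the weak form of the rule that the derivative of a B-spline is a difference of B-splines of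
  lower order.  It follows from the transposed recurrence alone, by induction on the order \<open>l\<close>: for
  \<open>H(y) = (l/2 - y) G(y + 1/2) + (l/2 + y) G(y - 1/2)\<close>, the recurrence pairs \<open>g\<close> as \<open>H' + D\<close> with
  \<open>D(y) = G(y + 1/2) - G(y - 1/2)\<close>, and the induction hypothesis shows that \<open>H'\<close> contributes \<open>l - 1\<close>
  times as much as \<open>D\<close>.\<close>

lemma spline_mean_deriv:
  assumes "\<And>y. (G has_real_derivative g y) (at y)" "continuous_on UNIV g"
  shows "spline_mean (Suc (Suc m)) g = spline_mean (Suc m) (\<lambda>y. G (y + 1/2) - G (y - 1/2))"
  using assms
proof (induction m arbitrary: G g)
  case (0 G g)
  define H where "H = (\<lambda>y. (1/2 - y) * G (y + 1/2) + (1/2 + y) * G (y - 1/2))"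
  define D where "D = (\<lambda>y. G (y + 1/2) - G (y - 1/2))"
  define K where "K = (\<lambda>y. (1/2 + y) * g (y - 1/2) + (1/2 - y) * g (y + 1/2))"
  note g = 0(1)
  have gc: "continuous_on UNIV (\<lambda>y. g (y + c))" for c
    by (rule continuous_on_compose2[OF 0(2)]) (auto intro!: continuous_intros)
  have Gc: "continuous_on UNIV (\<lambda>y. G (y + c))" for c
    by (intro continuous_at_imp_continuous_on ballI DERIV_isCont[OF DERIV_shift[THEN iffD1, OF g[of "x + c" for x]]])
  have Dc: "continuous_on UNIV D" and Kc: "continuous_on UNIV K"
    unfolding D_def K_def using gc[of "-1/2"] gc[of "1/2"] Gc[of "-1/2"] Gc[of "1/2"]
    by (auto intro!: continuous_intros)
  have H: "(H has_real_derivative K y - D y) (at y)" for y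
  proof -
    have 1: "((\<lambda>y. G (y + c)) has_real_derivative g (y + c)) (at y)" for c
      by (rule DERIV_shift[THEN iffD1, OF g])
    have 2: "((\<lambda>y. G (y - 1/2)) has_real_derivative g (y - 1/2)) (at y)"
      using 1[of "-1/2"] by simp
    have "(H has_real_derivative ((-1) * G (y + 1/2) + g (y + 1/2) * (1/2 - y))
        + (1 * G (y - 1/2) + g (y - 1/2) * (1/2 + y))) (at y)"
      unfolding H_def by (intro DERIV_add DERIV_mult 1 2) (auto intro!: derivative_eq_intros)
    then show ?thesis
      by (rule DERIV_cong) (simp add: K_def D_def algebra_simps)
  qed
  have "spline_mean (Suc (Suc 0)) g = spline_mean (Suc 0) K"
    by (subst spline_mean_Suc_Suc[OF 0(2)]) (simp add: K_def)
  also have "\<dots> = spline_mean (Suc 0) (\<lambda>y. K y - D y) + spline_mean (Suc 0) D"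
    by (simp add: spline_mean_diff[OF Kc Dc])
  also have "spline_mean (Suc 0) (\<lambda>y. K y - D y) = H (1/2) - H (-1/2)"
    using Kc Dc by (intro spline_mean_1 H continuous_intros)
  also have "\<dots> = 0"
    by (simp add: H_def)
  finally show ?case by (simp add: D_def)
next
  case (Suc m G g)
  define l where "l = real (Suc (Suc m))"
  define H where "H = (\<lambda>y. (l/2 - y) * G (y + 1/2) + (l/2 + y) * G (y - 1/2))"
  define D where "D = (\<lambda>y. G (y + 1/2) - G (y - 1/2))"
  define K where "K = (\<lambda>y. (l/2 + y) * g (y - 1/2) + (l/2 - y) * g (y + 1/2))"
  note g = Suc.prems(1)
  have gc: "continuous_on UNIV (\<lambda>y. g (y + c))" for c
    by (rule continuous_on_compose2[OF Suc.prems(2)]) (auto intro!: continuous_intros)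
  have Gc: "continuous_on UNIV (\<lambda>y. G (y + c))" for c
    by (intro continuous_at_imp_continuous_on ballI DERIV_isCont[OF DERIV_shift[THEN iffD1, OF g[of "x + c" for x]]])
  have Dc: "continuous_on UNIV D" and Kc: "continuous_on UNIV K"
    unfolding D_def K_def using gc[of "-1/2"] gc[of "1/2"] Gc[of "-1/2"] Gc[of "1/2"]
    by (auto intro!: continuous_intros)
  have H: "(H has_real_derivative K y - D y) (at y)" for y
  proof -
    have 1: "((\<lambda>y. G (y + c)) has_real_derivative g (y + c)) (at y)" for c
      by (rule DERIV_shift[THEN iffD1, OF g])
    have 2: "((\<lambda>y. G (y - 1/2)) has_real_derivative g (y - 1/2)) (at y)"
      using 1[of "-1/2"] by simp
    have "(H has_real_derivative ((-1) * G (y + 1/2) + g (y + 1/2) * (l/2 - y))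
        + (1 * G (y - 1/2) + g (y - 1/2) * (l/2 + y))) (at y)"
      unfolding H_def by (intro DERIV_add DERIV_mult 1 2) (auto intro!: derivative_eq_intros)
    then show ?thesis
      by (rule DERIV_cong) (simp add: K_def D_def algebra_simps)
  qed
  have l: "l \<noteq> 0" "l - 1 = real (Suc m)"
    by (simp_all add: l_def)
  have "spline_mean (Suc (Suc m)) (\<lambda>y. K y - D y) = spline_mean (Suc m) (\<lambda>y. H (y + 1/2) - H (y - 1/2))"
    using Kc Dc by (intro Suc.IH H continuous_intros)
  also have "(\<lambda>y. H (y + 1/2) - H (y - 1/2)) = (\<lambda>y. (real (Suc m) / 2 + y) * D (y - 1/2) + (real (Suc m) / 2 - y) * D (y + 1/2))"
    unfolding l(2)[symmetric] H_def D_def by (rule ext) (simp add: algebra_simps add_divide_distrib diff_divide_distrib)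
  also have "spline_mean (Suc m) \<dots> = real (Suc m) * spline_mean (Suc (Suc m)) D"
    by (simp add: spline_mean_Suc_Suc[OF Dc] del: of_nat_Suc)
  finally have "spline_mean (Suc (Suc m)) K = l * spline_mean (Suc (Suc m)) D"
    unfolding spline_mean_diff[OF Kc Dc] l(2)[symmetric] by (simp add: algebra_simps)
  then show ?case
    using l(1) by (subst spline_mean_Suc_Suc[OF Suc.prems(2)]) (simp add: K_def D_def l_def[symmetric] del: of_nat_Suc)
qed

lemma deriv_chainD: "deriv_chain n F \<Longrightarrow> i < n \<Longrightarrow> (F i has_real_derivative F (Suc i) x) (at x)"
  by (simp add: deriv_chain_def)

lemma deriv_chain_continuous:
  assumes "deriv_chain n F" "i \<le> n"
  shows "continuous_on S (F i)"
proof (cases "i = n")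
  case True
  then show ?thesis
    using assms continuous_on_subset[of UNIV "F n" S] by (simp add: deriv_chain_def)
next
  case False
  then have "i < n" using assms by simp
  then show ?thesis
    by (intro continuous_at_imp_continuous_on ballI DERIV_isCont) (rule deriv_chainD[OF assms(1)])
qed

lemma deriv_chain_le:
  assumes "deriv_chain n F" "m \<le> n"
  shows "deriv_chain m F"
  using assms deriv_chain_continuous[OF assms, of UNIV] by (auto simp: deriv_chain_def)

lemma deriv_chain_affine:
  assumes F: "deriv_chain n F"
  shows "deriv_chain n (\<lambda>i y. c ^ i * F i (x + c * y))"
  unfolding deriv_chain_def
proof (intro conjI allI impI)
  fix i y assume i: "i < n"
  have "((\<lambda>y. F i (x + c * y)) has_real_derivative F (Suc i) (x + c * y) * c) (at y)"
    by (rule DERIV_chain2[OF deriv_chainD[OF F i]]) (auto intro!: derivative_eq_intros)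
  from DERIV_cmult[OF this, of "c ^ i"]
  show "((\<lambda>y. c ^ i * F i (x + c * y)) has_real_derivative c ^ Suc i * F (Suc i) (x + c * y)) (at y)"
    by (simp add: mult_ac)
next
  show "continuous_on UNIV (\<lambda>y. c ^ n * F n (x + c * y))"
    by (intro continuous_intros continuous_on_compose2[OF deriv_chain_continuous[OF F order.refl, of UNIV]]) auto
qed

lemma deriv_chain_translate:
  assumes "deriv_chain n F"
  shows "deriv_chain n (\<lambda>i y. F i (x + y))"
  using deriv_chain_affine[OF assms, of 1 x] by simp

text \<open>Applied repeatedly, the preceding rule turns a derivative of full order into a forward difference.\<close>

lemma spline_mean_deriv_chain:
  assumes "deriv_chain (Suc l) F"
  shows "spline_mean (Suc l) (\<lambda>y. F (Suc l) (x + y)) = (fdiff ^^ Suc l) (F 0) (x - real (Suc l) / 2)"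
  using assms
proof (induction l arbitrary: x)
  case 0
  have "spline_mean (Suc 0) (\<lambda>y. F (Suc 0) (x + y)) = F 0 (x + 1/2) - F 0 (x + (-1/2))"
    using deriv_chain_translate[OF 0, of x] by (intro spline_mean_1) (simp_all add: deriv_chain_def)
  then show ?case by (simp add: fdiff_def algebra_simps)
next
  case (Suc l)
  note tr = deriv_chain_translate[OF Suc.prems]
  have ch: "deriv_chain (Suc l) F"
    using Suc.prems by (rule deriv_chain_le) simp
  have c1: "continuous_on UNIV (\<lambda>y. F (Suc l) (x + y))" for x
    by (rule deriv_chain_continuous[OF tr]) simp
  have "spline_mean (Suc (Suc l)) (\<lambda>y. F (Suc (Suc l)) (x + y))
    = spline_mean (Suc l) (\<lambda>y. F (Suc l) (x + (y + 1/2)) - F (Suc l) (x + (y - 1/2)))"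
    by (intro spline_mean_deriv deriv_chainD[OF tr] deriv_chain_continuous[OF tr]) simp_all
  also have "\<dots> = spline_mean (Suc l) (\<lambda>y. F (Suc l) ((x + 1/2) + y)) - spline_mean (Suc l) (\<lambda>y. F (Suc l) ((x - 1/2) + y))"
    by (subst spline_mean_diff[OF c1 c1, symmetric]) (simp add: algebra_simps)
  also have "\<dots> = (fdiff ^^ Suc (Suc l)) (F 0) (x - real (Suc (Suc l)) / 2)"
  proof -
    define D where "D = (fdiff ^^ Suc l) (F 0)"
    have "x + 1/2 - real (Suc l) / 2 = x - real (Suc (Suc l)) / 2 + 1"
      "x - 1/2 - real (Suc l) / 2 = x - real (Suc (Suc l)) / 2"
      by (simp_all add: field_simps)
    then show ?thesis
      unfolding Suc.IH[OF ch] funpow.simps(2)[of "Suc l"] o_apply D_def[symmetric]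
      by (simp only: fdiff_def)
  qed
  finally show ?case .
qed

lemma spline_mean_one: "spline_mean (Suc l) (\<lambda>_. 1) = 1"
proof (induction l)
  case 0
  have "spline_mean (Suc 0) (\<lambda>_. 1) = 1/2 - (-1/2)"
    by (rule spline_mean_1[of "\<lambda>y. y"]) (rule DERIV_ident, rule continuous_on_const)
  then show ?case by simp
next
  case (Suc l)
  define n where "n = real (Suc l)"
  have "spline_mean (Suc (Suc l)) (\<lambda>_. 1) = 1 / n * spline_mean (Suc l) (\<lambda>y. (n / 2 + y) * 1 + (n / 2 - y) * 1)"
    unfolding n_def by (rule spline_mean_Suc_Suc) simp
  also have "(\<lambda>y. (n / 2 + y) * 1 + (n / 2 - y) * 1) = (\<lambda>y. n * 1)"
    by (rule ext) simp
  also have "1 / n * spline_mean (Suc l) (\<lambda>y. n * 1) = 1"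
    unfolding spline_mean_cmult Suc by (simp add: n_def)
  finally show ?case .
qed

section \<open>Filter coefficients and consistency\<close>

lemma conv_spline_comb:
  assumes g: "\<And>x. integrable lborel (\<lambda>y. bspline (k + 1) y * g (x - y))"
  shows "conv (spline_comb k z c) g x = (\<Sum>\<gamma>\<le>2*k. c \<gamma> * spline_mean (k + 1) (\<lambda>y. g (x - z \<gamma> - y)))"
proof -
  have i: "integrable lborel (\<lambda>\<xi>. c \<gamma> * (bspline (k + 1) (x - \<xi> - z \<gamma>) * g \<xi>))" for \<gamma>
    using lborel_integrable_real_affine[OF g[of "x - z \<gamma>"], of "-1" "x - z \<gamma>"]
    by (simp add: algebra_simps)
  have e: "(LBINT \<xi>. bspline (k + 1) (x - \<xi> - z \<gamma>) * g \<xi>) = spline_mean (k + 1) (\<lambda>y. g (x - z \<gamma> - y))" for \<gamma>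
    unfolding spline_mean_def
    by (subst lborel_integral_real_affine[of "-1" _ "x - z \<gamma>"]) (simp_all add: algebra_simps)
  have "conv (spline_comb k z c) g x
      = (LBINT \<xi>. \<Sum>\<gamma>\<le>2*k. c \<gamma> * (bspline (k + 1) (x - \<xi> - z \<gamma>) * g \<xi>))"
    unfolding conv_def spline_comb_def by (simp add: sum_distrib_right mult.assoc)
  also have "\<dots> = (\<Sum>\<gamma>\<le>2*k. LBINT \<xi>. c \<gamma> * (bspline (k + 1) (x - \<xi> - z \<gamma>) * g \<xi>))"
    by (intro Bochner_Integration.integral_sum i)
  also have "\<dots> = (\<Sum>\<gamma>\<le>2*k. c \<gamma> * spline_mean (k + 1) (\<lambda>y. g (x - z \<gamma> - y)))"
    unfolding e[symmetric] by simp
  finally show ?thesis .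
qed

lemma conv_spline_comb_continuous:
  assumes "continuous_on UNIV g"
  shows "conv (spline_comb k z c) g x = (\<Sum>\<gamma>\<le>2*k. c \<gamma> * spline_mean (k + 1) (\<lambda>y. g (x - z \<gamma> - y)))"
  by (intro conv_spline_comb bspline_continuous_integrable continuous_on_compose2[OF assms])
     (auto intro!: continuous_intros)

lemma spline_mean_sum:
  assumes "\<And>i. i \<in> I \<Longrightarrow> continuous_on UNIV (f i)"
  shows "spline_mean l (\<lambda>y. \<Sum>i\<in>I. a i * f i y) = (\<Sum>i\<in>I. a i * spline_mean l (f i))"
proof -
  have "spline_mean l (\<lambda>y. \<Sum>i\<in>I. a i * f i y) = (LBINT y. \<Sum>i\<in>I. bspline l y * (a i * f i y))"
    by (simp add: spline_mean_def sum_distrib_left)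
  also have "\<dots> = (\<Sum>i\<in>I. LBINT y. bspline l y * (a i * f i y))"
    by (intro Bochner_Integration.integral_sum bspline_continuous_integrable continuous_intros assms)
  also have "\<dots> = (\<Sum>i\<in>I. a i * spline_mean l (f i))"
    unfolding spline_mean_def by (simp add: mult.left_commute)
  finally show ?thesis .
qed

lemma conv_spline_comb_power:
  "conv (spline_comb k z c) (\<lambda>x. x ^ m) x = (\<Sum>i\<le>m. real (m choose i) * x ^ (m - i) *
      (\<Sum>\<gamma>\<le>2*k. c \<gamma> * spline_mean (k + 1) (\<lambda>y. (- z \<gamma> - y) ^ i)))"
proof -
  have "(x - z \<gamma> - y) ^ m = (\<Sum>i\<le>m. (real (m choose i) * x ^ (m - i)) * (- z \<gamma> - y) ^ i)" for \<gamma> y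
    using binomial_ring[of "- z \<gamma> - y" x m] by (simp add: mult_ac algebra_simps)
  then have "conv (spline_comb k z c) (\<lambda>x. x ^ m) x
    = (\<Sum>\<gamma>\<le>2*k. c \<gamma> * (\<Sum>i\<le>m. real (m choose i) * x ^ (m - i) * spline_mean (k + 1) (\<lambda>y. (- z \<gamma> - y) ^ i)))"
    by (subst conv_spline_comb_continuous)
       (auto intro!: continuous_intros sum.cong spline_mean_sum)
  also have "\<dots> = (\<Sum>i\<le>m. real (m choose i) * x ^ (m - i) *
      (\<Sum>\<gamma>\<le>2*k. c \<gamma> * spline_mean (k + 1) (\<lambda>y. (- z \<gamma> - y) ^ i)))"
    unfolding sum_distrib_left by (subst sum.swap) (simp add: mult_ac)
  finally show ?thesis .
qed

text \<open>By the binomial theorem, the convolution with a monomial is a polynomial whose coefficients are the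
  moments on the right, so reproduction is a condition on finitely many numbers.\<close>

lemma reproduction_iff_moments:
  "(\<forall>m\<le>2*k. conv (spline_comb k z c) (\<lambda>x. x ^ m) = (\<lambda>x. x ^ m)) \<longleftrightarrow>
   (\<forall>i\<le>2*k. (\<Sum>\<gamma>\<le>2*k. c \<gamma> * spline_mean (k + 1) (\<lambda>y. (- z \<gamma> - y) ^ i)) = 0 ^ i)"
  (is "?L \<longleftrightarrow> (\<forall>i\<le>2*k. ?r i = 0 ^ i)")
proof
  assume L: ?L
  show "\<forall>i\<le>2*k. ?r i = 0 ^ i"
  proof (intro allI impI)
    fix m assume "m \<le> 2*k"
    then have "0 ^ m = conv (spline_comb k z c) (\<lambda>x. x ^ m) 0"
      using L by simp
    also have "\<dots> = (\<Sum>i\<le>m. if i = m then ?r i else 0)"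
      unfolding conv_spline_comb_power by (intro sum.cong refl) (auto simp: power_0_left)
    finally show "?r m = 0 ^ m" by simp
  qed
next
  assume R: "\<forall>i\<le>2*k. ?r i = 0 ^ i"
  show ?L
  proof (intro allI impI ext)
    fix m x assume "m \<le> 2*k"
    then have "conv (spline_comb k z c) (\<lambda>x. x ^ m) x = (\<Sum>i\<le>m. real (m choose i) * x ^ (m - i) * 0 ^ i)"
      unfolding conv_spline_comb_power using R by (intro sum.cong refl) auto
    also have "\<dots> = (\<Sum>i\<le>m. if i = 0 then x ^ m else 0)"
      by (intro sum.cong refl) auto
    finally show "conv (spline_comb k z c) (\<lambda>x. x ^ m) x = x ^ m" by simp
  qed
qed

text \<open>The moments of a combination of translates depend on the power sums of the shifts through a
  unitriangular system, which determines the power sums.  The equivalence serves for existence and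
  uniqueness of the filter coefficients at once.\<close>

lemma triangular_moments:
  fixes \<mu> :: "nat \<Rightarrow> real"
  assumes \<mu>: "\<mu> 0 = 1"
  shows "\<exists>\<sigma>. \<forall>s n. (\<forall>i\<le>n. (\<Sum>j\<le>i. real (i choose j) * \<mu> (i - j) * s j) = 0 ^ i) \<longleftrightarrow> (\<forall>i\<le>n. s i = \<sigma> i)"
proof -
  \<comment> \<open>The system is solved from low to high index by well-founded recursion.\<close>
  have "\<exists>\<sigma>. \<forall>i. \<sigma> i = (0 ^ i - (\<Sum>j<i. real (i choose j) * \<mu> (i - j) * \<sigma> j) :: real)"
  proof (intro exI allI)
    let ?F = "\<lambda>f i. 0 ^ i - (\<Sum>j<i. real (i choose j) * \<mu> (i - j) * f j) :: real"
    have adm: "adm_wf less_than ?F"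
      unfolding adm_wf_def by (auto intro!: sum.cong)
    show "wfrec less_than ?F i = ?F (wfrec less_than ?F) i" for i
      by (rule wfrec_fixpoint[OF wf_less_than adm, THEN fun_cong])
  qed
  then obtain \<sigma> where \<sigma>: "\<And>i. \<sigma> i = (0 ^ i - (\<Sum>j<i. real (i choose j) * \<mu> (i - j) * \<sigma> j) :: real)"
    by blast
  have split: "(\<Sum>j\<le>i. real (i choose j) * \<mu> (i - j) * s j) = s i + (\<Sum>j<i. real (i choose j) * \<mu> (i - j) * s j)"
    for s :: "nat \<Rightarrow> real" and i
    by (simp add: lessThan_Suc_atMost[symmetric] \<mu>)
  show ?thesis
  proof (intro exI[of _ \<sigma>] allI iffI impI)
    fix s n i assume *: "\<forall>i\<le>n. (\<Sum>j\<le>i. real (i choose j) * \<mu> (i - j) * s j) = 0 ^ i" and "i \<le> n"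
    from \<open>i \<le> n\<close> show "s i = \<sigma> i"
    proof (induction i rule: less_induct)
      case (less i)
      have "(\<Sum>j<i. real (i choose j) * \<mu> (i - j) * s j) = (\<Sum>j<i. real (i choose j) * \<mu> (i - j) * \<sigma> j)"
        using less by (intro sum.cong refl) auto
      moreover have "s i + (\<Sum>j<i. real (i choose j) * \<mu> (i - j) * s j) = 0 ^ i"
        using * less.prems split by metis
      ultimately show ?case using \<sigma>[of i] by simp
    qed
  next
    fix s n i assume *: "\<forall>i\<le>n. s i = \<sigma> i" and i: "i \<le> n"
    have "(\<Sum>j\<le>i. real (i choose j) * \<mu> (i - j) * s j) = (\<Sum>j\<le>i. real (i choose j) * \<mu> (i - j) * \<sigma> j)"
      using * i by (intro sum.cong refl) auto
    then show "(\<Sum>j\<le>i. real (i choose j) * \<mu> (i - j) * s j) = 0 ^ i"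
      unfolding split using \<sigma>[of i] by simp
  qed
qed

text \<open>For distinct shifts, the required power sums come from exactly one vector of coefficients, so the
  definite description in the definition of the coefficients is meaningful.\<close>

lemma filter_coeffs_moments:
  assumes z: "inj_on z {..2*k}" and i: "i \<le> 2*k"
  shows "(\<Sum>\<gamma>\<le>2*k. filter_coeffs k z \<gamma> * spline_mean (k + 1) (\<lambda>y. (- z \<gamma> - y) ^ i)) = 0 ^ i"
proof -
  define \<mu> where "\<mu> i = spline_mean (k + 1) (\<lambda>y. (- y) ^ i)" for i
  have \<mu>0: "\<mu> 0 = 1"
    by (simp add: \<mu>_def spline_mean_one)
  from triangular_moments[of \<mu>, OF \<mu>0] obtain \<sigma>
    where "\<forall>s n. (\<forall>i\<le>n. (\<Sum>j\<le>i. real (i choose j) * \<mu> (i - j) * s j) = 0 ^ i) \<longleftrightarrow> (\<forall>i\<le>n. s i = \<sigma> i)"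
    by (rule exE)
  note \<sigma> = this[THEN spec, THEN spec]
  have mom: "(\<Sum>\<gamma>\<le>2*k. c \<gamma> * spline_mean (k + 1) (\<lambda>y. (- z \<gamma> - y) ^ i))
    = (\<Sum>j\<le>i. real (i choose j) * \<mu> (i - j) * (\<Sum>\<gamma>\<le>2*k. c \<gamma> * (- z \<gamma>) ^ j))" for c i
  proof -
    have "spline_mean (k + 1) (\<lambda>y. (- z \<gamma> - y) ^ i) = (\<Sum>j\<le>i. (real (i choose j) * (- z \<gamma>) ^ j) * \<mu> (i - j))" for \<gamma>
    proof -
      have "(- z \<gamma> - y) ^ i = (\<Sum>j\<le>i. (real (i choose j) * (- z \<gamma>) ^ j) * (- y) ^ (i - j))" for y
        using binomial_ring[of "- z \<gamma>" "- y" i] by simp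
      then have "spline_mean (k + 1) (\<lambda>y. (- z \<gamma> - y) ^ i)
          = spline_mean (k + 1) (\<lambda>y. \<Sum>j\<le>i. (real (i choose j) * (- z \<gamma>) ^ j) * (- y) ^ (i - j))"
        by (simp only:)
      also have "\<dots> = (\<Sum>j\<le>i. (real (i choose j) * (- z \<gamma>) ^ j) * \<mu> (i - j))"
        unfolding \<mu>_def by (rule spline_mean_sum) (intro continuous_intros)
      finally show ?thesis .
    qed
    then have "(\<Sum>\<gamma>\<le>2*k. c \<gamma> * spline_mean (k + 1) (\<lambda>y. (- z \<gamma> - y) ^ i))
      = (\<Sum>\<gamma>\<le>2*k. \<Sum>j\<le>i. c \<gamma> * ((real (i choose j) * (- z \<gamma>) ^ j) * \<mu> (i - j)))"
      by (simp only: sum_distrib_left)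
    also have "\<dots> = (\<Sum>j\<le>i. real (i choose j) * \<mu> (i - j) * (\<Sum>\<gamma>\<le>2*k. c \<gamma> * (- z \<gamma>) ^ j))"
      by (subst sum.swap) (simp add: sum_distrib_left mult_ac)
    finally show ?thesis .
  qed
  have iff: "(\<forall>m\<le>2*k. conv (spline_comb k z c) (\<lambda>x. x ^ m) = (\<lambda>x. x ^ m)) \<longleftrightarrow>
     (\<forall>m\<le>2*k. (\<Sum>\<gamma>\<le>2*k. c \<gamma> * (- z \<gamma>) ^ m) = \<sigma> m)" for c
    unfolding reproduction_iff_moments mom by (rule \<sigma>)
  have "\<exists>!c. (\<forall>\<gamma>>2*k. c \<gamma> = 0) \<and> (\<forall>m\<le>2*k. conv (spline_comb k z c) (\<lambda>x. x ^ m) = (\<lambda>x. x ^ m))"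
    unfolding iff by (rule moment_problem_unique_solution) (use z in \<open>auto simp: inj_on_def\<close>)
  then have "\<forall>m\<le>2*k. conv (spline_comb k z (filter_coeffs k z)) (\<lambda>x. x ^ m) = (\<lambda>x. x ^ m)"
    unfolding filter_coeffs_def by (rule theI'[THEN conjunct2])
  then show ?thesis
    using i by (simp only: reproduction_iff_moments)
qed

text \<open>Moments up to degree \<open>2k\<close> annihilate the Taylor polynomial except for its value at the centre.\<close>

lemma filter_consistency:
  assumes z: "inj_on z {..2*k}"
  shows "\<exists>C\<ge>0. \<forall>F M x. deriv_chain (2*k+1) F \<longrightarrow> (\<forall>y. \<bar>F (2*k+1) y\<bar> \<le> M) \<longrightarrow>
     \<bar>conv (spline_comb k z (filter_coeffs k z)) (F 0) x - F 0 x\<bar> \<le> C * M"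
proof -
  define c where "c = filter_coeffs k z"
  define n where "n = 2*k+1"
  define I where "I \<gamma> = (LBINT y. \<bar>bspline (k + 1) y\<bar> * \<bar>- z \<gamma> - y\<bar> ^ n / fact n)" for \<gamma>
  have I0: "I \<gamma> \<ge> 0" for \<gamma>
    unfolding I_def by (intro Bochner_Integration.integral_nonneg) simp
  show ?thesis
  proof (intro exI[of _ "\<Sum>\<gamma>\<le>2*k. \<bar>c \<gamma>\<bar> * I \<gamma>"] conjI allI impI)
    show "0 \<le> (\<Sum>\<gamma>\<le>2*k. \<bar>c \<gamma>\<bar> * I \<gamma>)"
      by (intro sum_nonneg mult_nonneg_nonneg I0) simp
  next
    fix F :: "nat \<Rightarrow> real \<Rightarrow> real" and M x assume F: "deriv_chain (2*k+1) F" and M: "\<forall>y. \<bar>F (2*k+1) y\<bar> \<le> M"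
    define R where "R t = F 0 (x + t) - (\<Sum>i\<le>2*k. (F i x / fact i) * t ^ i)" for t
    have R_bound: "\<bar>R t\<bar> \<le> M * (\<bar>t\<bar> ^ n / fact n)" for t
    proof -
      have *: "\<forall>m t. m < n \<and> \<bar>t\<bar> \<le> \<bar>s\<bar> \<longrightarrow> ((\<lambda>y. F m (x + y)) has_real_derivative F (Suc m) (x + t)) (at t)" for s
        using deriv_chainD[OF deriv_chain_translate[OF F]] by (simp add: n_def)
      obtain u where u: "F 0 (x + t) = (\<Sum>m<n. F m (x + 0) / fact m * t ^ m) + F n (x + u) / fact n * t ^ n"
        using Maclaurin_bi_le[OF _ *, of "\<lambda>y. F 0 (x + y)" t] by auto
      then have "R t = F n (x + u) / fact n * t ^ n"
        by (simp add: R_def n_def lessThan_Suc_atMost)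
      then have "\<bar>R t\<bar> = \<bar>F n (x + u)\<bar> * (\<bar>t\<bar> ^ n / fact n)"
        by (simp add: abs_mult power_abs)
      also have "\<dots> \<le> M * (\<bar>t\<bar> ^ n / fact n)"
        using M by (intro mult_right_mono) (auto simp: n_def)
      finally show ?thesis .
    qed
    have R_cont: "continuous_on S R" for S
      unfolding R_def using deriv_chain_continuous[OF deriv_chain_translate[OF F, of x], of 0 S]
      by (auto intro!: continuous_intros)
    have Rz: "continuous_on UNIV (\<lambda>y. R (- z \<gamma> - y))" for \<gamma>
      by (rule continuous_on_compose2[OF R_cont[of UNIV]]) (auto intro!: continuous_intros)
    have "conv (spline_comb k z c) (F 0) x = (\<Sum>\<gamma>\<le>2*k. c \<gamma> * spline_mean (k + 1) (\<lambda>y. F 0 (x - z \<gamma> - y)))"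
      by (intro conv_spline_comb_continuous deriv_chain_continuous[OF F]) simp
    also have "\<dots> = (\<Sum>\<gamma>\<le>2*k. c \<gamma> * (spline_mean (k + 1) (\<lambda>y. R (- z \<gamma> - y)) +
        (\<Sum>i\<le>2*k. (F i x / fact i) * spline_mean (k + 1) (\<lambda>y. (- z \<gamma> - y) ^ i))))"
    proof (intro sum.cong refl arg_cong2[where f="(*)"])
      fix \<gamma>
      have Q: "spline_mean (k + 1) (\<lambda>y. \<Sum>i\<le>2*k. (F i x / fact i) * (- z \<gamma> - y) ^ i)
          = (\<Sum>i\<le>2*k. (F i x / fact i) * spline_mean (k + 1) (\<lambda>y. (- z \<gamma> - y) ^ i))"
        by (rule spline_mean_sum) (intro continuous_intros)
      have "F 0 (x - z \<gamma> - y) = R (- z \<gamma> - y) + (\<Sum>i\<le>2*k. (F i x / fact i) * (- z \<gamma> - y) ^ i)" for y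
      proof -
        have "x + (- z \<gamma> - y) = x - z \<gamma> - y" by simp
        then show ?thesis unfolding R_def by (simp only:)
      qed
      then have "spline_mean (k + 1) (\<lambda>y. F 0 (x - z \<gamma> - y))
        = spline_mean (k + 1) (\<lambda>y. R (- z \<gamma> - y) + (\<Sum>i\<le>2*k. (F i x / fact i) * (- z \<gamma> - y) ^ i))"
        by (simp only:)
      also have "\<dots> = spline_mean (k + 1) (\<lambda>y. R (- z \<gamma> - y)) +
          spline_mean (k + 1) (\<lambda>y. \<Sum>i\<le>2*k. (F i x / fact i) * (- z \<gamma> - y) ^ i)"
        by (rule spline_mean_add[OF Rz]) (intro continuous_intros)
      also note Q
      finally show "spline_mean (k + 1) (\<lambda>y. F 0 (x - z \<gamma> - y)) =
        spline_mean (k + 1) (\<lambda>y. R (- z \<gamma> - y)) +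
        (\<Sum>i\<le>2*k. (F i x / fact i) * spline_mean (k + 1) (\<lambda>y. (- z \<gamma> - y) ^ i))" .
    qed
    also have "\<dots> = (\<Sum>\<gamma>\<le>2*k. c \<gamma> * spline_mean (k + 1) (\<lambda>y. R (- z \<gamma> - y))) +
        (\<Sum>i\<le>2*k. (F i x / fact i) * (\<Sum>\<gamma>\<le>2*k. c \<gamma> * spline_mean (k + 1) (\<lambda>y. (- z \<gamma> - y) ^ i)))"
    proof -
      have "(\<Sum>\<gamma>\<le>2*k. c \<gamma> * (\<Sum>i\<le>2*k. (F i x / fact i) * G i \<gamma>))
          = (\<Sum>i\<le>2*k. (F i x / fact i) * (\<Sum>\<gamma>\<le>2*k. c \<gamma> * G i \<gamma>))" for G :: "nat \<Rightarrow> nat \<Rightarrow> real"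
        unfolding sum_distrib_left by (subst sum.swap) (simp only: mult.left_commute)
      then show ?thesis
        by (simp only: distrib_left sum.distrib)
    qed
    also have "(\<Sum>i\<le>2*k. (F i x / fact i) * (\<Sum>\<gamma>\<le>2*k. c \<gamma> * spline_mean (k + 1) (\<lambda>y. (- z \<gamma> - y) ^ i)))
      = (\<Sum>i\<le>2*k. (F i x / fact i) * 0 ^ i)"
      using filter_coeffs_moments[OF z] by (intro sum.cong refl) (simp add: c_def)
    also have "\<dots> = (\<Sum>i\<le>2*k. if i = 0 then F 0 x else 0)"
      by (intro sum.cong refl) auto
    also have "\<dots> = F 0 x" by simp
    finally have "\<bar>conv (spline_comb k z c) (F 0) x - F 0 x\<bar>
      = \<bar>\<Sum>\<gamma>\<le>2*k. c \<gamma> * spline_mean (k + 1) (\<lambda>y. R (- z \<gamma> - y))\<bar>"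
      by simp
    also have "\<dots> \<le> (\<Sum>\<gamma>\<le>2*k. \<bar>c \<gamma>\<bar> * \<bar>spline_mean (k + 1) (\<lambda>y. R (- z \<gamma> - y))\<bar>)"
      by (rule order.trans[OF sum_abs]) (simp add: abs_mult)
    also have "\<dots> \<le> (\<Sum>\<gamma>\<le>2*k. \<bar>c \<gamma>\<bar> * (M * I \<gamma>))"
    proof (intro sum_mono mult_left_mono abs_ge_zero)
      fix \<gamma>
      have i1: "integrable lborel (\<lambda>y. bspline (k + 1) y * R (- z \<gamma> - y))"
        by (intro bspline_continuous_integrable Rz)
      have "integrable lborel (\<lambda>y. bspline (k + 1) y * (\<bar>- z \<gamma> - y\<bar> ^ n / fact n))"
        by (intro bspline_continuous_integrable continuous_intros) simp
      from integrable_abs[OF this]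
      have i2: "integrable lborel (\<lambda>y. \<bar>bspline (k + 1) y\<bar> * \<bar>- z \<gamma> - y\<bar> ^ n / fact n)"
        by (simp add: abs_mult)
      have "\<bar>spline_mean (k + 1) (\<lambda>y. R (- z \<gamma> - y))\<bar> \<le> (LBINT y. \<bar>bspline (k + 1) y * R (- z \<gamma> - y)\<bar>)"
        unfolding spline_mean_def by (rule integral_abs_bound)
      also have "\<dots> \<le> (LBINT y. M * (\<bar>bspline (k + 1) y\<bar> * \<bar>- z \<gamma> - y\<bar> ^ n / fact n))"
      proof (intro integral_mono integrable_abs i1 integrable_mult_right i2)
        fix y
        have "\<bar>bspline (k + 1) y * R (- z \<gamma> - y)\<bar> \<le> \<bar>bspline (k + 1) y\<bar> * (M * (\<bar>- z \<gamma> - y\<bar> ^ n / fact n))"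
          unfolding abs_mult by (intro mult_left_mono R_bound) simp
        then show "\<bar>bspline (k + 1) y * R (- z \<gamma> - y)\<bar> \<le> M * (\<bar>bspline (k + 1) y\<bar> * \<bar>- z \<gamma> - y\<bar> ^ n / fact n)"
          by (simp add: mult_ac)
      qed
      finally show "\<bar>spline_mean (k + 1) (\<lambda>y. R (- z \<gamma> - y))\<bar> \<le> M * I \<gamma>"
        by (simp add: I_def)
    qed
    also have "\<dots> = (\<Sum>\<gamma>\<le>2*k. \<bar>c \<gamma>\<bar> * I \<gamma>) * M"
      by (simp add: sum_distrib_left sum_distrib_right mult_ac)
    finally show "\<bar>conv (spline_comb k z (filter_coeffs k z)) (F 0) x - F 0 x\<bar> \<le> (\<Sum>\<gamma>\<le>2*k. \<bar>c \<gamma>\<bar> * I \<gamma>) * M"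
      by (simp add: c_def)
  qed
qed

text \<open>A filter that reproduces constants has nonempty support, which is what localizes \<open>\<Omega>\<^sub>0\<close> below.\<close>

lemma filter_nonzero:
  assumes z: "inj_on z {..2*k}"
  shows "\<exists>x. spline_comb k z (filter_coeffs k z) x \<noteq> 0"
proof (rule ccontr)
  assume "\<not> ?thesis"
  then have "conv (spline_comb k z (filter_coeffs k z)) (\<lambda>x. x ^ 0) 0 = 0"
    by (simp add: conv_def)
  moreover have "conv (spline_comb k z (filter_coeffs k z)) (\<lambda>x. x ^ 0) 0 = 1"
    using filter_coeffs_moments[OF z, of 0] unfolding conv_spline_comb_power by simp
  ultimately show False by simp
qed

lemma inj_shift: "\<epsilon> \<noteq> 0 \<Longrightarrow> inj_on (\<lambda>\<gamma>. \<epsilon> * shift k \<gamma>) A"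
  by (auto simp: inj_on_def shift_def)

section \<open>Polynomial projection on the reference cell\<close>

definition cell_ip :: "(real \<Rightarrow> real) \<Rightarrow> (real \<Rightarrow> real) \<Rightarrow> real" where
  "cell_ip f g = integral {0..1} (\<lambda>x. f x * g x)"

lemma continuous_on_poly_real [continuous_intros]: "continuous_on S (poly (p :: real poly))"
  by (intro continuous_at_imp_continuous_on) simp

lemma cell_ip_integrable:
  fixes f g :: "real \<Rightarrow> real"
  assumes "continuous_on {0..1} f" "continuous_on {0..1} g"
  shows "(\<lambda>x. f x * g x) integrable_on {0..1::real}"
  using assms by (intro integrable_continuous_interval continuous_intros) auto

lemma cell_ip_commute: "cell_ip f g = cell_ip g f"
  by (simp add: cell_ip_def mult.commute)

lemma cell_ip_add_left:
  assumes "continuous_on {0..1} f" "continuous_on {0..1} g" "continuous_on {0..1} u"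
  shows "cell_ip (\<lambda>x. f x + g x) u = cell_ip f u + cell_ip g u"
  unfolding cell_ip_def distrib_right
  by (intro Henstock_Kurzweil_Integration.integral_add cell_ip_integrable assms)

lemma cell_ip_diff_left:
  assumes "continuous_on {0..1} f" "continuous_on {0..1} g" "continuous_on {0..1} u"
  shows "cell_ip (\<lambda>x. f x - g x) u = cell_ip f u - cell_ip g u"
  unfolding cell_ip_def left_diff_distrib
  by (intro Henstock_Kurzweil_Integration.integral_diff cell_ip_integrable assms)

lemma cell_ip_diff_right:
  assumes "continuous_on {0..1} f" "continuous_on {0..1} g" "continuous_on {0..1} u"
  shows "cell_ip u (\<lambda>x. f x - g x) = cell_ip u f - cell_ip u g"
  using cell_ip_diff_left[OF assms] by (simp add: cell_ip_commute)

lemma cell_ip_scale_left: "cell_ip (\<lambda>x. c * f x) u = c * cell_ip f u"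
  by (simp add: cell_ip_def mult.assoc)

lemma cell_ip_sum_left:
  assumes "finite I" "\<And>i. i \<in> I \<Longrightarrow> continuous_on {0..1} (f i)" "continuous_on {0..1} u"
  shows "cell_ip (\<lambda>x. \<Sum>i\<in>I. c i * f i x) u = (\<Sum>i\<in>I. c i * cell_ip (f i) u)"
proof -
  have "cell_ip (\<lambda>x. \<Sum>i\<in>I. c i * f i x) u = integral {0..1} (\<lambda>x. \<Sum>i\<in>I. (c i * f i x) * u x)"
    by (simp add: cell_ip_def sum_distrib_right)
  also have "\<dots> = (\<Sum>i\<in>I. cell_ip (\<lambda>x. c i * f i x) u)"
    unfolding cell_ip_def
    by (intro Henstock_Kurzweil_Integration.integral_sum assms cell_ip_integrable continuous_intros)
  finally show ?thesis by (simp add: cell_ip_scale_left)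
qed

lemma cell_ip_self_nonneg: "cell_ip f f \<ge> 0"
  unfolding cell_ip_def
  by (cases "(\<lambda>x. f x * f x) integrable_on {0..1}")
     (auto intro: Henstock_Kurzweil_Integration.integral_nonneg simp: not_integrable_integral)

lemma cell_ip_Cauchy_Schwarz:
  assumes f: "continuous_on {0..1} f" and g: "continuous_on {0..1} g"
  shows "(cell_ip f g)\<^sup>2 \<le> cell_ip f f * cell_ip g g"
proof -
  have quad: "cell_ip f f - 2 * l * cell_ip f g + l\<^sup>2 * cell_ip g g \<ge> 0" for l
  proof -
    have "cell_ip (\<lambda>x. f x - l * g x) (\<lambda>x. f x - l * g x) = cell_ip f f - 2 * l * cell_ip f g + l\<^sup>2 * cell_ip g g"
      using f g
      by (simp add: cell_ip_diff_left cell_ip_diff_right cell_ip_scale_left cell_ip_commute[of f "\<lambda>x. l * g x"]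
          cell_ip_commute[of g "\<lambda>x. l * g x"] cell_ip_commute[of g f] continuous_intros power2_eq_square algebra_simps)
    then show ?thesis
      using cell_ip_self_nonneg[of "\<lambda>x. f x - l * g x"] by simp
  qed
  show ?thesis
  proof (cases "cell_ip g g = 0")
    case True
    have "cell_ip f g = 0"
    proof (rule ccontr)
      assume "cell_ip f g \<noteq> 0"
      then show False
        using quad[of "(cell_ip f f + 1) / (2 * cell_ip f g)"] True by (simp add: field_simps)
    qed
    then show ?thesis using True by simp
  next
    case False
    then have "cell_ip g g > 0"
      using cell_ip_self_nonneg[of g] by simp
    then show ?thesis
      using quad[of "cell_ip f g / cell_ip g g"] by (simp add: field_simps power2_eq_square)
  qed
qed

lemma cell_ip_poly_pos:
  assumes "p \<noteq> 0"
  shows "cell_ip (poly p) (poly p) > 0"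
proof (rule ccontr)
  assume "\<not> ?thesis"
  then have "integral {0..1} (\<lambda>x. poly p x * poly p x) = 0"
    using cell_ip_self_nonneg[of "poly p"] by (simp add: cell_ip_def)
  then have "\<forall>x\<in>{0..1}. poly p x * poly p x = 0"
    by (subst (asm) integral_eq_0_iff) (auto intro!: continuous_intros)
  then have "{0..1} \<subseteq> {x. poly p x = 0}" by auto
  moreover have "infinite {0..1::real}" by (simp add: infinite_Icc)
  ultimately show False
    using poly_roots_finite[OF assms] finite_subset by blast
qed

definition orthonormal_basis :: "nat \<Rightarrow> (nat \<Rightarrow> real poly) \<Rightarrow> bool" where
  "orthonormal_basis n b \<longleftrightarrow> (\<forall>i\<le>n. degree (b i) \<le> n) \<and>
     (\<forall>i\<le>n. \<forall>j\<le>n. cell_ip (poly (b i)) (poly (b j)) = (if i = j then 1 else 0)) \<and>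
     (\<forall>p. degree p \<le> n \<longrightarrow> p = (\<Sum>i\<le>n. smult (cell_ip (poly p) (poly (b i))) (b i)))"

lemma orthonormal_basisD:
  assumes "orthonormal_basis n b"
  shows "i \<le> n \<Longrightarrow> degree (b i) \<le> n"
    and "i \<le> n \<Longrightarrow> j \<le> n \<Longrightarrow> cell_ip (poly (b i)) (poly (b j)) = (if i = j then 1 else 0)"
    and "degree p \<le> n \<Longrightarrow> p = (\<Sum>i\<le>n. smult (cell_ip (poly p) (poly (b i))) (b i))"
  using assms unfolding orthonormal_basis_def by simp_all

text \<open>Gram--Schmidt orthogonalization of the monomials.\<close>

lemma orthonormal_basis_exists: "\<exists>b. orthonormal_basis n b"
proof (induction n)
  case 0
  have "p = [:cell_ip (poly p) (\<lambda>_. 1):]" if "degree p = 0" for p :: "real poly"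
  proof -
    from that obtain c where "p = [:c:]" by (rule degree_eq_zeroE)
    then show ?thesis by (simp add: cell_ip_def)
  qed
  moreover have "cell_ip (\<lambda>_. 1) (\<lambda>_. 1) = 1"
    by (simp add: cell_ip_def)
  ultimately have "orthonormal_basis 0 (\<lambda>_. 1)"
    by (simp add: orthonormal_basis_def poly_1[abs_def])
  then show ?case by (rule exI[of _ "\<lambda>_. 1"])
next
  case (Suc n)
  then obtain b where b: "orthonormal_basis n b" ..
  note deg = orthonormal_basisD(1)[OF b] and orth = orthonormal_basisD(2)[OF b]
    and span = orthonormal_basisD(3)[OF b]
  let ?m = "monom 1 (Suc n) :: real poly"
  define s where "s = (\<Sum>i\<le>n. smult (cell_ip (poly ?m) (poly (b i))) (b i))"
  \<comment> \<open>The monomial of the next degree minus its projection.\<close>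
  define r where "r = ?m - s"
  have deg_s: "degree s \<le> n"
    unfolding s_def by (intro degree_sum_le) (auto intro: order.trans[OF degree_smult_le] deg)
  have deg_r: "degree r \<le> Suc n"
    unfolding r_def using deg_s by (intro degree_diff_le) (auto simp: degree_monom_eq)
  have top: "coeff r (Suc n) = 1"
    unfolding r_def using deg_s by (simp add: coeff_eq_0)
  then have r0: "r \<noteq> 0" by auto
  define w where "w = cell_ip (poly r) (poly r)"
  have w: "w > 0" unfolding w_def by (rule cell_ip_poly_pos[OF r0])
  have r_orth: "cell_ip (poly r) (poly (b j)) = 0" if "j \<le> n" for j
  proof -
    have "cell_ip (poly s) (poly (b j)) = cell_ip (poly ?m) (poly (b j))"
    proof -
      have "poly s = (\<lambda>x. \<Sum>i\<le>n. cell_ip (poly ?m) (poly (b i)) * poly (b i) x)"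
        by (rule ext) (simp add: s_def poly_sum)
      then have "cell_ip (poly s) (poly (b j))
        = (\<Sum>i\<le>n. cell_ip (poly ?m) (poly (b i)) * cell_ip (poly (b i)) (poly (b j)))"
        by (simp only:) (intro cell_ip_sum_left continuous_intros finite_atMost)
      also have "\<dots> = (\<Sum>i\<le>n. if i = j then cell_ip (poly ?m) (poly (b i)) else 0)"
        using that by (intro sum.cong refl) (simp add: orth)
      finally show ?thesis using that by simp
    qed
    moreover have "poly r = (\<lambda>x. poly ?m x - poly s x)"
      by (rule ext) (simp add: r_def)
    ultimately show ?thesis
      by (simp add: cell_ip_diff_left continuous_intros)
  qed
  define e where "e = smult (1 / sqrt w) r"
  have e_ip: "cell_ip (poly e) g = (1 / sqrt w) * cell_ip (poly r) g" for g
  proof -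
    have "poly e = (\<lambda>x. (1 / sqrt w) * poly r x)"
      by (rule ext) (simp add: e_def)
    then show ?thesis by (simp only: cell_ip_scale_left)
  qed
  have e_ip': "cell_ip g (poly e) = (1 / sqrt w) * cell_ip g (poly r)" for g
    using e_ip by (simp add: cell_ip_commute)
  define b' where "b' = b(Suc n := e)"
  have "degree (b' i) \<le> Suc n" if "i \<le> Suc n" for i
    using that deg[of i] deg_r degree_smult_le[of "1 / sqrt w" r] unfolding b'_def e_def
    by (cases "i = Suc n") (auto simp del: degree_smult_eq)
  moreover have "cell_ip (poly (b' i)) (poly (b' j)) = (if i = j then 1 else 0)"
    if "i \<le> Suc n" "j \<le> Suc n" for i j
  proof -
    have "sqrt w * sqrt w = w" "sqrt w \<noteq> 0"
      using w by simp_all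
    then have "1 / sqrt w * (1 / sqrt w * w) = 1"
      by (simp add: field_simps)
    then have ee: "cell_ip (poly e) (poly e) = 1"
      by (simp only: e_ip e_ip' w_def[symmetric])
    have eb: "cell_ip (poly e) (poly (b m)) = 0" "cell_ip (poly (b m)) (poly e) = 0" if "m \<le> n" for m
      using r_orth[OF that] by (simp_all only: e_ip e_ip' cell_ip_commute[of "poly (b m)" "poly r"] mult_zero_right)
    consider "i = Suc n" "j = Suc n" | "i = Suc n" "j \<le> n" | "i \<le> n" "j = Suc n" | "i \<le> n" "j \<le> n"
      using \<open>i \<le> Suc n\<close> \<open>j \<le> Suc n\<close> by linarith
    then show ?thesis
      by cases (simp_all add: b'_def ee eb orth)
  qed
  moreover have "p = (\<Sum>i\<le>Suc n. smult (cell_ip (poly p) (poly (b' i))) (b' i))"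
    if p: "degree p \<le> Suc n" for p
  proof -
    define c where "c = coeff p (Suc n)"
    define q where "q = p - smult c r"
    have pq: "poly p = (\<lambda>x. poly q x + c * poly r x)"
      by (rule ext) (simp add: q_def)
    have "degree q \<le> Suc n"
      unfolding q_def using p deg_r by (intro degree_diff_le) (auto intro: order.trans[OF degree_smult_le])
    moreover have "coeff q (Suc n) = 0"
      by (simp add: q_def c_def top)
    ultimately have "degree q \<le> n"
      by (metis degree_0 leading_coeff_0_iff le_SucE zero_le)
    note q = span[OF this]
    have qr: "cell_ip (poly q) (poly r) = 0"
    proof -
      have "poly q = (\<lambda>x. \<Sum>i\<le>n. cell_ip (poly q) (poly (b i)) * poly (b i) x)"
        by (rule ext, subst q) (simp add: poly_sum)
      then have "cell_ip (poly q) (poly r) = (\<Sum>i\<le>n. cell_ip (poly q) (poly (b i)) * cell_ip (poly (b i)) (poly r))"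
        using cell_ip_sum_left[of "{..n}" "\<lambda>i. poly (b i)" "poly r" "\<lambda>i. cell_ip (poly q) (poly (b i))"]
        by (simp add: continuous_intros)
      then show ?thesis
        by (simp add: r_orth cell_ip_commute[of _ "poly r"])
    qed
    have pb: "cell_ip (poly p) (poly (b i)) = cell_ip (poly q) (poly (b i))" if "i \<le> n" for i
      unfolding pq using that
      by (simp add: cell_ip_add_left cell_ip_scale_left r_orth continuous_intros)
    have pr: "cell_ip (poly p) (poly r) = c * w"
      unfolding pq by (simp add: cell_ip_add_left cell_ip_scale_left qr w_def continuous_intros)
    have "(\<Sum>i\<le>Suc n. smult (cell_ip (poly p) (poly (b' i))) (b' i))
      = (\<Sum>i\<le>n. smult (cell_ip (poly q) (poly (b i))) (b i)) + smult (cell_ip (poly p) (poly e)) e"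
      by (simp add: b'_def pb)
    also have "smult (cell_ip (poly p) (poly e)) e = smult c r"
      using w unfolding e_ip' pr
      by (simp add: e_def real_sqrt_mult_self[of w, unfolded abs_of_pos[OF w]] mult.commute divide_simps)
    also have "(\<Sum>i\<le>n. smult (cell_ip (poly q) (poly (b i))) (b i)) = q"
      by (rule q[symmetric])
    finally show ?thesis
      by (simp only: q_def diff_add_cancel)
  qed
  ultimately have "orthonormal_basis (Suc n) b'"
    unfolding orthonormal_basis_def by (intro conjI allI impI)
  then show ?case by (rule exI[of _ b'])
qed


lemma cell_projection_exists:
  assumes f: "continuous_on {0..1} f"
  shows "\<exists>p. degree p \<le> k \<and> (\<forall>q. degree q \<le> k \<longrightarrow> cell_ip (\<lambda>x. f x - poly p x) (poly q) = 0)"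
proof -
  obtain b where b: "orthonormal_basis k b"
    using orthonormal_basis_exists ..
  note deg = orthonormal_basisD(1)[OF b] and orth = orthonormal_basisD(2)[OF b]
    and span = orthonormal_basisD(3)[OF b]
  define p where "p = (\<Sum>i\<le>k. smult (cell_ip f (poly (b i))) (b i))"
  have p: "poly p = (\<lambda>x. \<Sum>i\<le>k. cell_ip f (poly (b i)) * poly (b i) x)"
    by (rule ext) (simp add: p_def poly_sum)
  have pb: "cell_ip (poly p) (poly (b j)) = cell_ip f (poly (b j))" if "j \<le> k" for j
  proof -
    have "cell_ip (poly p) (poly (b j)) = (\<Sum>i\<le>k. cell_ip f (poly (b i)) * cell_ip (poly (b i)) (poly (b j)))"
      unfolding p by (intro cell_ip_sum_left continuous_intros finite_atMost)
    also have "\<dots> = (\<Sum>i\<le>k. if i = j then cell_ip f (poly (b i)) else 0)"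
      using that by (intro sum.cong refl) (simp add: orth)
    finally show ?thesis using that by simp
  qed
  have "cell_ip (\<lambda>x. f x - poly p x) (poly q) = 0" if "degree q \<le> k" for q
  proof -
    have q: "poly q = (\<lambda>x. \<Sum>i\<le>k. cell_ip (poly q) (poly (b i)) * poly (b i) x)"
      by (rule ext, subst span[OF that]) (simp add: poly_sum)
    have "cell_ip (poly q) (\<lambda>x. f x - poly p x)
        = (\<Sum>i\<le>k. cell_ip (poly q) (poly (b i)) * cell_ip (poly (b i)) (\<lambda>x. f x - poly p x))"
      by (subst q, rule cell_ip_sum_left) (auto intro!: continuous_intros f)
    also have "\<dots> = 0"
    proof (intro sum.neutral ballI)
      fix i assume "i \<in> {..k}"
      then have "cell_ip (\<lambda>x. f x - poly p x) (poly (b i)) = 0"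
        using f pb[of i] by (simp add: cell_ip_diff_left continuous_intros)
      then show "cell_ip (poly q) (poly (b i)) * cell_ip (poly (b i)) (\<lambda>x. f x - poly p x) = 0"
        by (simp add: cell_ip_commute)
    qed
    finally show ?thesis by (simp add: cell_ip_commute)
  qed
  moreover have "degree p \<le> k"
    unfolding p_def by (intro degree_sum_le) (auto intro: order.trans[OF degree_smult_le] deg)
  ultimately show ?thesis by blast
qed

text \<open>Point evaluation is a bounded functional on a finite-dimensional space.\<close>

lemma poly_trace_bound:
  "\<exists>c>0. \<forall>p :: real poly. degree p \<le> k \<longrightarrow> \<bar>poly p 0\<bar> \<le> c * sqrt (cell_ip (poly p) (poly p))"
proof -
  obtain b where b: "orthonormal_basis k b"
    using orthonormal_basis_exists ..
  note deg = orthonormal_basisD(1)[OF b] and orth = orthonormal_basisD(2)[OF b]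
    and span = orthonormal_basisD(3)[OF b]
  show ?thesis
  proof (intro exI[of _ "1 + (\<Sum>i\<le>k. \<bar>poly (b i) 0\<bar>)"] conjI allI impI)
    show "0 < 1 + (\<Sum>i\<le>k. \<bar>poly (b i) 0\<bar>)"
      by (intro add_pos_nonneg sum_nonneg) auto
  next
    fix p :: "real poly" assume p: "degree p \<le> k"
    let ?s = "sqrt (cell_ip (poly p) (poly p))"
    have coef: "\<bar>cell_ip (poly p) (poly (b i))\<bar> \<le> ?s" if "i \<le> k" for i
    proof -
      have "(cell_ip (poly p) (poly (b i)))\<^sup>2 \<le> cell_ip (poly p) (poly p) * cell_ip (poly (b i)) (poly (b i))"
        by (intro cell_ip_Cauchy_Schwarz continuous_intros)
      then show ?thesis
        using that by (intro real_le_rsqrt) (simp add: orth)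
    qed
    have "\<bar>poly p 0\<bar> = \<bar>\<Sum>i\<le>k. cell_ip (poly p) (poly (b i)) * poly (b i) 0\<bar>"
      by (subst span[OF p]) (simp add: poly_sum)
    also have "\<dots> \<le> (\<Sum>i\<le>k. ?s * \<bar>poly (b i) 0\<bar>)"
      by (rule order.trans[OF sum_abs]) (auto simp: abs_mult intro!: sum_mono mult_right_mono coef)
    also have "\<dots> \<le> (1 + (\<Sum>i\<le>k. \<bar>poly (b i) 0\<bar>)) * ?s"
      unfolding sum_distrib_left[symmetric]
      using cell_ip_self_nonneg[of "poly p"] by (simp add: distrib_right distrib_left mult.commute)
    finally show "\<bar>poly p 0\<bar> \<le> (1 + (\<Sum>i\<le>k. \<bar>poly (b i) 0\<bar>)) * ?s" .
  qed
qed

text \<open>The bound has to involve the \<open>L\<^sup>2\<close> norm, and not the maximum, of the highest derivative: in the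
  duality argument this derivative is the function \<open>v\<close>, of which only the \<open>L\<^sup>2\<close> norm is controlled.\<close>

lemma Taylor_polynomial_L2:
  assumes F: "deriv_chain (Suc k) F"
  shows "\<exists>q. degree q \<le> k \<and> poly q 0 = F 0 0 \<and>
     (\<forall>x\<in>{0..1}. \<bar>F 0 x - poly q x\<bar> \<le> sqrt (cell_ip (F (Suc k)) (F (Suc k))))"
proof -
  \<comment> \<open>The Taylor polynomial at the left end point, with the remainder in integral form.\<close>
  define q where "q = (\<Sum>i\<le>k. monom (F i 0 / fact i) i)"
  note cont = deriv_chain_continuous[OF F order.refl]
  have absint: "(\<lambda>x. \<bar>F (Suc k) x\<bar>) integrable_on {a..b}" for a b
    by (intro integrable_continuous_interval continuous_intros cont)
  have deg: "degree q \<le> k"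
    unfolding q_def by (intro degree_sum_le) (auto intro: order.trans[OF degree_monom_le])
  have q0: "poly q 0 = F 0 0"
  proof -
    have "poly q 0 = (\<Sum>i\<le>k. if i = 0 then F 0 0 else 0)"
      unfolding q_def poly_sum poly_monom by (intro sum.cong refl) (auto simp: power_0_left)
    then show ?thesis by simp
  qed
  have L1: "integral {0..1} (\<lambda>x. \<bar>F (Suc k) x\<bar>) \<le> sqrt (cell_ip (F (Suc k)) (F (Suc k)))"
  proof -
    have "(cell_ip (\<lambda>x. \<bar>F (Suc k) x\<bar>) (\<lambda>_. 1))\<^sup>2
        \<le> cell_ip (\<lambda>x. \<bar>F (Suc k) x\<bar>) (\<lambda>x. \<bar>F (Suc k) x\<bar>) * cell_ip (\<lambda>_. 1) (\<lambda>_. 1)"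
      by (intro cell_ip_Cauchy_Schwarz continuous_intros cont)
    then show ?thesis
      by (intro real_le_rsqrt) (simp add: cell_ip_def)
  qed
  have "\<bar>F 0 x - poly q x\<bar> \<le> sqrt (cell_ip (F (Suc k)) (F (Suc k)))" if x: "x \<in> {0..1}" for x
  proof -
    have "((\<lambda>y. ((x - y) ^ k / fact k) *\<^sub>R F (Suc k) y) has_integral
        F 0 x - (\<Sum>i<Suc k. ((x - 0) ^ i / fact i) *\<^sub>R F i 0)) {0..x}"
      using Taylor_has_integral[of "Suc k" F "F 0" 0 x] x deriv_chainD[OF F]
      by (simp add: has_real_derivative_iff_has_vector_derivative[symmetric] has_field_derivative_at_within)
    then have I: "((\<lambda>y. ((x - y) ^ k / fact k) * F (Suc k) y) has_integral F 0 x - poly q x) {0..x}"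
      by (simp add: q_def poly_sum poly_monom lessThan_Suc_atMost mult.commute)
    have "\<bar>F 0 x - poly q x\<bar> \<le> integral {0..x} (\<lambda>y. \<bar>F (Suc k) y\<bar>)"
      unfolding integral_unique[OF I, symmetric] real_norm_def[symmetric]
    proof (rule integral_norm_bound_integral)
      show "(\<lambda>y. (x - y) ^ k / fact k * F (Suc k) y) integrable_on {0..x}"
        using I by (rule has_integral_integrable)
      fix y assume y: "y \<in> {0..x}"
      have "\<bar>x - y\<bar> ^ k \<le> fact k"
        using x y by (intro order.trans[OF power_le_one fact_ge_1]) auto
      then have "\<bar>x - y\<bar> ^ k / fact k \<le> 1"
        by (simp add: divide_le_eq_1)
      moreover have "norm ((x - y) ^ k / fact k * F (Suc k) y) = \<bar>x - y\<bar> ^ k / fact k * norm (F (Suc k) y)"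
        by (simp add: abs_mult power_abs)
      ultimately show "norm ((x - y) ^ k / fact k * F (Suc k) y) \<le> norm (F (Suc k) y)"
        by (simp only: mult_left_le_one_le norm_ge_zero divide_nonneg_nonneg zero_le_power_abs fact_ge_zero)
    qed (use absint in simp)
    also have "\<dots> \<le> integral {0..1} (\<lambda>x. \<bar>F (Suc k) x\<bar>)"
      using x by (intro integral_subset_le absint) auto
    also note L1
    finally show ?thesis .
  qed
  then show ?thesis using deg q0 by blast
qed

text \<open>The value at the left end point is singled out because the upwind flux pairs each jump with the trace of the
  test function on the right of the node.\<close>

definition projection_constant :: "nat \<Rightarrow> real \<Rightarrow> bool" where
  "projection_constant k c \<longleftrightarrow> c > 0 \<and>
     (\<forall>F p. deriv_chain (Suc k) F \<longrightarrow> degree p \<le> k \<longrightarrow>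
      (\<forall>q. degree q \<le> k \<longrightarrow> cell_ip (\<lambda>x. F 0 x - poly p x) (poly q) = 0) \<longrightarrow>
      \<bar>F 0 0 - poly p 0\<bar> \<le> c * sqrt (cell_ip (F (Suc k)) (F (Suc k))) \<and>
      cell_ip (\<lambda>x. F 0 x - poly p x) (\<lambda>x. F 0 x - poly p x) \<le> cell_ip (F (Suc k)) (F (Suc k)))"

text \<open>The projection is a best approximation and fixes the Taylor polynomial \<open>q\<close> at \<open>0\<close>, which agrees with
  the function at \<open>0\<close>.  So the trace of the error is the trace of the polynomial \<open>p - q\<close>, whose \<open>L\<^sup>2\<close> norm is
  bounded by the error of \<open>q\<close>.\<close>

lemma projection_constant_exists: "\<exists>c. projection_constant k c"
proof -
  from poly_trace_bound[of k] obtain c where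
    "c > 0 \<and> (\<forall>p :: real poly. degree p \<le> k \<longrightarrow> \<bar>poly p 0\<bar> \<le> c * sqrt (cell_ip (poly p) (poly p)))"
    by (rule exE)
  then have c: "c > 0"
    "\<And>p :: real poly. degree p \<le> k \<Longrightarrow> \<bar>poly p 0\<bar> \<le> c * sqrt (cell_ip (poly p) (poly p))"
    by simp_all
  show ?thesis
    unfolding projection_constant_def
  proof (intro exI[of _ c] conjI c(1) allI impI)
    fix F :: "nat \<Rightarrow> real \<Rightarrow> real" and p
    assume F: "deriv_chain (Suc k) F" and p: "degree p \<le> k"
      and orth: "\<forall>q. degree q \<le> k \<longrightarrow> cell_ip (\<lambda>x. F 0 x - poly p x) (poly q) = 0"
    let ?S = "cell_ip (F (Suc k)) (F (Suc k))"
    let ?e = "\<lambda>x. F 0 x - poly p x"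
    have S: "?S \<ge> 0" by (rule cell_ip_self_nonneg)
    from Taylor_polynomial_L2[OF F] obtain q
      where "degree q \<le> k \<and> poly q 0 = F 0 0 \<and> (\<forall>x\<in>{0..1}. \<bar>F 0 x - poly q x\<bar> \<le> sqrt ?S)"
      by (rule exE)
    then have q: "degree q \<le> k" "poly q 0 = F 0 0" "\<And>x. x \<in> {0..1} \<Longrightarrow> \<bar>F 0 x - poly q x\<bar> \<le> sqrt ?S"
      by (simp_all only:)
    have cF: "continuous_on {0..1} (F 0)"
      by (rule deriv_chain_continuous[OF F]) simp
    let ?d = "\<lambda>x. F 0 x - poly q x"
    have "cell_ip ?d ?d \<le> integral {0..1} (\<lambda>x::real. ?S)"
      unfolding cell_ip_def[of ?d ?d]
    proof (rule integral_le)
      fix x :: real assume "x \<in> {0..1}"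
      then have "\<bar>?d x\<bar> * \<bar>?d x\<bar> \<le> sqrt ?S * sqrt ?S"
        by (intro mult_mono q(3)) (simp_all add: S)
      then show "?d x * ?d x \<le> ?S"
        by (simp only: abs_mult_self_eq real_sqrt_mult_self abs_of_nonneg[OF S])
    next
      show "(\<lambda>x. ?d x * ?d x) integrable_on {0..1}"
        by (intro cell_ip_integrable continuous_intros cF)
    qed (rule integrable_const_ivl)
    also have "\<dots> = ?S"
      by simp
    finally have d: "cell_ip ?d ?d \<le> ?S" .
    define r where "r = p - q"
    have r: "poly r x = poly p x - poly q x" for x by (simp add: r_def)
    have "degree r \<le> k" unfolding r_def by (intro degree_diff_le p q)
    then have er: "cell_ip ?e (poly r) = 0" using orth by blast
    have "cell_ip ?d ?d = cell_ip (\<lambda>x. ?e x + poly r x) (\<lambda>x. ?e x + poly r x)"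
      by (simp add: r)
    also have "\<dots> = cell_ip ?e ?e + 2 * cell_ip ?e (poly r) + cell_ip (poly r) (poly r)"
    proof -
      have A: "cell_ip (\<lambda>x. ?e x + poly r x) u = cell_ip ?e u + cell_ip (poly r) u" if "continuous_on {0..1} u" for u
        using that by (intro cell_ip_add_left continuous_intros cF)
      have "cell_ip (\<lambda>x. ?e x + poly r x) (\<lambda>x. ?e x + poly r x)
          = cell_ip (\<lambda>x. ?e x + poly r x) ?e + cell_ip (\<lambda>x. ?e x + poly r x) (poly r)"
        by (subst A, intro continuous_intros cF) (simp only: cell_ip_commute[of _ "\<lambda>x. ?e x + poly r x"])
      also have "\<dots> = (cell_ip ?e ?e + cell_ip (poly r) ?e) + (cell_ip ?e (poly r) + cell_ip (poly r) (poly r))"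
        by (intro arg_cong2[where f="(+)"] A continuous_intros cF)
      finally show ?thesis
        by (simp only: cell_ip_commute[of "poly r" ?e])
    qed
    finally have pyth: "cell_ip ?d ?d = cell_ip ?e ?e + cell_ip (poly r) (poly r)"
      using er by simp
    show "cell_ip ?e ?e \<le> ?S"
      using pyth d cell_ip_self_nonneg[of "poly r"] by linarith
    have "cell_ip (poly r) (poly r) \<le> ?S"
      using pyth d cell_ip_self_nonneg[of ?e] by linarith
    have "\<bar>F 0 0 - poly p 0\<bar> = \<bar>poly r 0\<bar>"
      using q(2) by (simp add: r abs_minus_commute)
    also have "\<dots> \<le> c * sqrt (cell_ip (poly r) (poly r))"
      by (rule c(2)[OF \<open>degree r \<le> k\<close>])
    also have "\<dots> \<le> c * sqrt ?S"
      using \<open>cell_ip (poly r) (poly r) \<le> ?S\<close> c(1) by simp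
    finally show "\<bar>F 0 0 - poly p 0\<bar> \<le> c * sqrt ?S" .
  qed
qed

section \<open>Periodic functions on a unit mesh\<close>

lemma antiderivative_exists:
  fixes g :: "real \<Rightarrow> real"
  assumes g: "continuous_on UNIV g"
  shows "\<exists>H. \<forall>x. (H has_real_derivative g x) (at x)"
proof (intro exI allI)
  fix x :: real
  define r where "r = \<bar>x\<bar> + 1"
  have "((\<lambda>u. LBINT y=ereal 0..ereal u. g y) has_vector_derivative g x) (at x within {-r..r})"
    by (rule interval_integral_FTC2) (auto simp: r_def intro: continuous_on_subset[OF g])
  then have "((\<lambda>u. LBINT y=ereal 0..ereal u. g y) has_vector_derivative g x) (at x within {-r<..<r})"
    by (rule has_vector_derivative_within_subset) auto
  then show "((\<lambda>u. LBINT y=ereal 0..ereal u. g y) has_real_derivative g x) (at x)"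
    by (subst (asm) at_within_open) (auto simp: r_def has_real_derivative_iff_has_vector_derivative)
qed

lemma sum_periodic_shift:
  fixes f :: "int \<Rightarrow> real"
  assumes N: "N \<ge> 1" and per: "\<And>j. f (j + int N) = f j"
  shows "(\<Sum>j\<in>{0..<int N}. f (j - 1)) = (\<Sum>j\<in>{0..<int N}. f j)"
proof -
  have "(\<Sum>j\<in>{0..<int N}. f (j - 1)) = (\<Sum>j\<in>{-1..<int N - 1}. f j)"
    by (rule sum.reindex_bij_witness[of _ "\<lambda>j. j + 1" "\<lambda>j. j - 1"]) auto
  also have "{-1..<int N - 1} = insert (-1) {0..<int N - 1}"
    using N by auto
  also have "(\<Sum>j\<in>insert (-1) {0..<int N - 1}. f j) = f (int N - 1) + (\<Sum>j\<in>{0..<int N - 1}. f j)"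
    using per[of "-1"] by (subst sum.insert) (auto simp: algebra_simps)
  also have "\<dots> = (\<Sum>j\<in>insert (int N - 1) {0..<int N - 1}. f j)"
    by (subst sum.insert) auto
  also have "insert (int N - 1) {0..<int N - 1} = {0..<int N}"
    using N by auto
  finally show ?thesis .
qed

lemma periodic_of_int_add:
  assumes "periodic (real N) g"
  shows "g (real_of_int (j + int N) + x) = g (real_of_int j + x)"
  using assms[unfolded periodic_def, rule_format, of "real_of_int j + x"] by (simp add: algebra_simps)

lemma cell_integral_FTC:
  assumes "\<And>x. (H has_real_derivative g x) (at x)"
  shows "integral {0..1} (\<lambda>\<xi>. g (c + \<xi>)) = H (c + 1) - H c"
proof -
  have "((\<lambda>\<xi>. g (c + \<xi>)) has_integral H (c + 1) - H (c + 0)) {0..1}"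
  proof (rule fundamental_theorem_of_calculus)
    fix x :: real
    have "((\<lambda>\<xi>. H (c + \<xi>)) has_real_derivative g (c + x) * 1) (at x within {0..1})"
      by (rule DERIV_chain2[OF assms]) (auto intro!: derivative_eq_intros)
    then show "((\<lambda>\<xi>. H (c + \<xi>)) has_vector_derivative g (c + x)) (at x within {0..1})"
      by (simp add: has_real_derivative_iff_has_vector_derivative)
  qed simp
  then show ?thesis by (simp add: integral_unique)
qed

lemma cell_sum_FTC:
  assumes "\<And>x. (H has_real_derivative g x) (at x)"
  shows "(\<Sum>j\<in>{0..<int N}. integral {0..1} (\<lambda>\<xi>. g (real_of_int j + \<xi>))) = H (real N) - H 0"
proof -
  have "(\<Sum>j\<in>{0..<int N}. integral {0..1} (\<lambda>\<xi>. g (real_of_int j + \<xi>)))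
      = (\<Sum>j\<in>{0..<int N}. H (real_of_int j + 1) - H (real_of_int j))"
    by (simp add: cell_integral_FTC[of H g, OF assms])
  also have "\<dots> = (\<Sum>n<N. H (real (Suc n)) - H (real n))"
    by (rule sum.reindex_bij_witness[of _ int nat]) (auto simp: algebra_simps)
  also have "\<dots> = H (real N) - H 0"
    using sum_lessThan_telescope[of "\<lambda>n. H (real n)" N] by simp
  finally show ?thesis .
qed

lemma cell_sum_translation:
  fixes g :: "real \<Rightarrow> real"
  assumes g: "continuous_on UNIV g" and per: "periodic (real N) g"
  shows "(\<Sum>j\<in>{0..<int N}. integral {0..1} (\<lambda>\<xi>. g (real_of_int j + \<xi> + s)))
       = (\<Sum>j\<in>{0..<int N}. integral {0..1} (\<lambda>\<xi>. g (real_of_int j + \<xi>)))"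
proof -
  obtain H where H: "\<And>x. (H has_real_derivative g x) (at x)"
    using antiderivative_exists[OF g] by auto
  have tele: "(\<Sum>j\<in>{0..<int N}. integral {0..1} (\<lambda>\<xi>. g (real_of_int j + \<xi> + s))) = H (real N + s) - H s" for s
  proof -
    have "((\<lambda>x. H (x + s)) has_real_derivative g (x + s)) (at x)" for x
      by (rule DERIV_shift[THEN iffD1, OF H])
    from cell_sum_FTC[of "\<lambda>x. H (x + s)" "\<lambda>x. g (x + s)", OF this] show ?thesis
      by simp
  qed
  define D where "D x = H (real N + x) - H x" for x
  have D: "(D has_real_derivative g (real N + x) * 1 - g x) (at x)" for x
    unfolding D_def by (intro DERIV_diff H DERIV_chain2[OF H]) (auto intro!: derivative_eq_intros)
  have "g (real N + x) = g x" for x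
    using per by (simp add: periodic_def add.commute)
  then have "\<forall>x. (D has_real_derivative 0) (at x)"
    using D by simp
  then have "D s = D 0"
    by (rule DERIV_isconst_all)
  then show ?thesis
    using tele[of s] tele[of 0] by (simp add: D_def)
qed

lemma cell_integration_by_parts:
  assumes f: "\<And>x. (f has_real_derivative f' x) (at x)" and f': "continuous_on {0..1} f'"
    and g: "\<And>x. (g has_real_derivative g' x) (at x)" and g': "continuous_on {0..1} g'"
  shows "cell_ip f g' = f 1 * g 1 - f 0 * g 0 - cell_ip f' g"
proof -
  have cf: "continuous_on {0..1} f" and cg: "continuous_on {0..1} g"
    using f g by (auto intro!: continuous_at_imp_continuous_on DERIV_isCont)
  have "((\<lambda>x. f' x * g x + g' x * f x) has_integral (f 1 * g 1 - f 0 * g 0)) {0..1}"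
  proof (rule fundamental_theorem_of_calculus)
    fix x
    show "((\<lambda>x. f x * g x) has_vector_derivative f' x * g x + g' x * f x) (at x within {0..1})"
      unfolding has_real_derivative_iff_has_vector_derivative[symmetric]
      by (rule has_field_derivative_at_within[OF DERIV_mult[OF f g]])
  qed simp
  then have "f 1 * g 1 - f 0 * g 0 = integral {0..1} (\<lambda>x. f' x * g x + g' x * f x)"
    by (simp add: integral_unique)
  also have "\<dots> = cell_ip f' g + cell_ip g' f"
    unfolding cell_ip_def
    by (intro Henstock_Kurzweil_Integration.integral_add cell_ip_integrable cf cg f' g')
  finally show ?thesis by (simp add: cell_ip_commute)
qed

lemma cell_ip_poly_sum:
  assumes "degree p \<le> k" "continuous_on {0..1} g"
  shows "cell_ip (poly p) g = (\<Sum>i\<le>k. coeff p i * cell_ip (\<lambda>\<xi>. \<xi> ^ i) g)"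
proof -
  have "poly p = (\<lambda>x. \<Sum>i\<le>k. coeff p i * x ^ i)"
    by (rule ext) (rule poly_altdef_le[OF assms(1)])
  then show ?thesis
    by (simp only:) (intro cell_ip_sum_left finite_atMost continuous_intros assms(2))
qed

text \<open>The coefficients of the discrete solution are differentiable in time, but nothing is known about the
  continuity of their derivatives.  The product rule is therefore applied to coefficients and moments, instead
  of differentiating under the integral sign.\<close>

lemma cell_ip_poly_has_derivative:
  assumes t: "t \<in> S"
    and deg: "\<And>s. s \<in> S \<Longrightarrow> degree (P s) \<le> k" and deg': "degree P' \<le> k"
    and der: "\<And>i. ((\<lambda>s. coeff (P s) i) has_real_derivative coeff P' i) (at t within S)"
    and g: "\<And>s. s \<in> S \<Longrightarrow> continuous_on {0..1} (g s)"
    and m: "\<And>i. ((\<lambda>s. cell_ip (\<lambda>\<xi>. \<xi> ^ i) (g s)) has_real_derivative m i) (at t within S)"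
  shows "((\<lambda>s. cell_ip (poly (P s)) (g s)) has_real_derivative
     cell_ip (poly P') (g t) + (\<Sum>i\<le>k. coeff (P t) i * m i)) (at t within S)"
proof -
  have "((\<lambda>s. \<Sum>i\<le>k. coeff (P s) i * cell_ip (\<lambda>\<xi>. \<xi> ^ i) (g s)) has_real_derivative
      (\<Sum>i\<le>k. coeff P' i * cell_ip (\<lambda>\<xi>. \<xi> ^ i) (g t) + m i * coeff (P t) i)) (at t within S)"
    by (intro DERIV_sum DERIV_mult der m)
  then have "((\<lambda>s. \<Sum>i\<le>k. coeff (P s) i * cell_ip (\<lambda>\<xi>. \<xi> ^ i) (g s)) has_real_derivative
      cell_ip (poly P') (g t) + (\<Sum>i\<le>k. coeff (P t) i * m i)) (at t within S)"
    by (simp add: cell_ip_poly_sum[OF deg' g[OF t]] sum.distrib mult.commute)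
  then show ?thesis
    unfolding has_field_derivative_def
    by (rule has_derivative_transform[OF t, rotated]) (rule cell_ip_poly_sum[OF deg g])
qed

lemma cell_moment_has_derivative:
  assumes F: "deriv_chain 1 F" and u: "continuous_on {0..1} u" and S: "t \<in> S" "convex S"
  shows "((\<lambda>s. cell_ip u (\<lambda>\<xi>. F 0 (c + \<xi> - \<alpha> * s))) has_real_derivative
     - \<alpha> * cell_ip u (\<lambda>\<xi>. F 1 (c + \<xi> - \<alpha> * t))) (at t within S)"
proof -
  have c0: "continuous_on A (F 0)" and c1: "continuous_on A (F 1)" for A
    using deriv_chain_continuous[OF F] by simp_all
  have "((\<lambda>s. integral (cbox 0 1) (\<lambda>\<xi>. u \<xi> * F 0 (c + \<xi> - \<alpha> * s))) has_field_derivative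
      integral (cbox 0 1) (\<lambda>\<xi>. u \<xi> * (F 1 (c + \<xi> - \<alpha> * t) * (- \<alpha>)))) (at t within S)"
  proof (rule leibniz_rule_field_derivative)
    fix s \<xi> :: real
    have "((\<lambda>s. F 0 (c + \<xi> - \<alpha> * s)) has_real_derivative F 1 (c + \<xi> - \<alpha> * s) * (- \<alpha>)) (at s within S)"
      using deriv_chainD[OF F, of 0] by (intro DERIV_chain2[where f = "F 0"]) (auto intro!: derivative_eq_intros)
    then show "((\<lambda>s. u \<xi> * F 0 (c + \<xi> - \<alpha> * s)) has_field_derivative u \<xi> * (F 1 (c + \<xi> - \<alpha> * s) * (- \<alpha>))) (at s within S)"
      by (rule DERIV_cmult)
  next
    fix s :: real
    have "continuous_on {0..1} (\<lambda>\<xi>. u \<xi> * F 0 (c + \<xi> - \<alpha> * s))"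
      by (intro continuous_intros u continuous_on_compose2[OF c0[of UNIV]]) auto
    then show "(\<lambda>\<xi>. u \<xi> * F 0 (c + \<xi> - \<alpha> * s)) integrable_on cbox 0 1"
      by (simp add: integrable_continuous_interval)
  next
    have "continuous_on (S \<times> cbox 0 1) (\<lambda>p. u (snd p) * (F 1 (c + snd p - \<alpha> * fst p) * (- \<alpha>)))"
      by (intro continuous_intros continuous_on_compose2[OF u] continuous_on_compose2[OF c1[of UNIV]]) auto
    then show "continuous_on (S \<times> cbox 0 1) (\<lambda>(s, \<xi>). u \<xi> * (F 1 (c + \<xi> - \<alpha> * s) * (- \<alpha>)))"
      by (simp add: case_prod_unfold)
  qed (use S in auto)
  moreover have "integral (cbox 0 1) (\<lambda>\<xi>. u \<xi> * (F 1 (c + \<xi> - \<alpha> * t) * (- \<alpha>))) = - \<alpha> * cell_ip u (\<lambda>\<xi>. F 1 (c + \<xi> - \<alpha> * t))"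
    unfolding cell_ip_def integral_mult_right[symmetric] by (simp add: mult_ac)
  ultimately show ?thesis
    by (simp add: cell_ip_def)
qed

section \<open>The scheme on a unit mesh\<close>

lemma abs_sum_mult_le:
  fixes a b :: "'i \<Rightarrow> real"
  assumes "(\<Sum>i\<in>I. (b i)\<^sup>2) \<le> B\<^sup>2" "B \<ge> 0"
  shows "\<bar>\<Sum>i\<in>I. a i * b i\<bar> \<le> sqrt (\<Sum>i\<in>I. (a i)\<^sup>2) * B"
proof -
  have "\<bar>\<Sum>i\<in>I. a i * b i\<bar> \<le> sqrt ((\<Sum>i\<in>I. (a i)\<^sup>2) * (\<Sum>i\<in>I. (b i)\<^sup>2))"
    by (intro real_le_rsqrt) (simp add: Cauchy_Schwarz_ineq_sum)
  also have "\<dots> \<le> sqrt ((\<Sum>i\<in>I. (a i)\<^sup>2) * B\<^sup>2)"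
    by (intro real_sqrt_le_mono mult_left_mono assms sum_nonneg) simp
  finally show ?thesis
    using assms(2) by (simp add: real_sqrt_mult)
qed

lemma translated_continuous:
  assumes "continuous_on UNIV (g :: real \<Rightarrow> real)"
  shows "continuous_on S (\<lambda>\<xi>. g (c + \<xi> - d))"
  by (intro continuous_on_compose2[OF assms] continuous_intros) auto

definition initial_projection :: "nat \<Rightarrow> (int \<Rightarrow> real \<Rightarrow> real poly) \<Rightarrow> (real \<Rightarrow> real) \<Rightarrow> bool" where
  "initial_projection k P f \<longleftrightarrow> (\<forall>j q. degree q \<le> k \<longrightarrow>
     cell_ip (\<lambda>\<xi>. f (real_of_int j + \<xi>) - poly (P j 0) \<xi>) (poly q) = 0)"

text \<open>\<open>P j t\<close> is the solution on the cell \<open>[j, j + 1]\<close> in the local variable, and \<open>P' j t\<close> its time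
  derivative.  Indexing the cells by all integers, with period \<open>N\<close>, removes the distinction
  between inner nodes and the boundary.\<close>

locale unit_dg =
  fixes k N :: nat and \<alpha> T :: real and P P' :: "int \<Rightarrow> real \<Rightarrow> real poly"
  assumes N: "N \<ge> 1" and \<alpha>: "\<alpha> > 0" and T: "T > 0"
    and deg: "t \<in> {0..T} \<Longrightarrow> degree (P j t) \<le> k" and deg': "t \<in> {0..T} \<Longrightarrow> degree (P' j t) \<le> k"
    and per: "t \<in> {0..T} \<Longrightarrow> P (j + int N) t = P j t"
    and der: "t \<in> {0..T} \<Longrightarrow>
      ((\<lambda>s. coeff (P j s) i) has_real_derivative coeff (P' j t) i) (at t within {0..T})"
    and scheme: "t \<in> {0..T} \<Longrightarrow> degree q \<le> k \<Longrightarrow>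
      cell_ip (poly (P' j t)) (poly q) = \<alpha> * (cell_ip (poly (P j t)) (poly (pderiv q))
        - poly (P j t) 1 * poly q 1 + poly (P (j - 1) t) 1 * poly q 0)"
begin

definition jump :: "int \<Rightarrow> real \<Rightarrow> real" where
  "jump j t = poly (P j t) 0 - poly (P (j - 1) t) 1"

definition dissipation :: "real \<Rightarrow> real" where
  "dissipation t = (\<Sum>j\<in>{0..<int N}. (jump j t)\<^sup>2)"

text \<open>Let \<open>\<phi>\<close> be the transported function.  Since \<open>P' j t\<close> lies in the discrete space, \<open>\<phi>\<close> may be replaced by its projection there and the scheme applied;
  in the term with the spatial derivative of \<open>\<phi>\<close>, integration by parts puts the derivative on the polynomial,
  where the projection can be inserted again.  The integrals then cancel, and only the jumps remain.\<close>

lemma transport_pairing_has_derivative: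
  assumes F: "deriv_chain 1 F" and perF: "periodic (real N) (F 0)" and t: "t \<in> {0..T}"
    and deg_\<pi>: "\<And>j. degree (\<pi> j) \<le> k"
    and \<pi>: "\<And>j q. degree q \<le> k \<Longrightarrow> cell_ip (\<lambda>\<xi>. F 0 (real_of_int j + \<xi> - \<alpha> * t) - poly (\<pi> j) \<xi>) (poly q) = 0"
  shows "((\<lambda>s. \<Sum>j\<in>{0..<int N}. cell_ip (poly (P j s)) (\<lambda>\<xi>. F 0 (real_of_int j + \<xi> - \<alpha> * s))) has_real_derivative
    \<alpha> * (\<Sum>j\<in>{0..<int N}. jump j t * (F 0 (real_of_int j - \<alpha> * t) - poly (\<pi> j) 0))) (at t within {0..T})"
proof -
  define \<phi> where "\<phi> j \<xi> = F 0 (real_of_int j + \<xi> - \<alpha> * t)" for j \<xi>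
  define \<phi>' where "\<phi>' j \<xi> = F 1 (real_of_int j + \<xi> - \<alpha> * t)" for j \<xi>
  define p where "p j = P j t" for j
  have c: "continuous_on A (\<lambda>\<xi>. F 0 (c + \<xi> - d))" "continuous_on A (\<lambda>\<xi>. F 1 (c + \<xi> - d))" for A c d
    by (intro translated_continuous deriv_chain_continuous[OF F]; simp)+
  have \<phi>_der: "(\<phi> j has_real_derivative \<phi>' j x) (at x)" for j x
  proof -
    have "((\<lambda>\<xi>. F 0 (real_of_int j + \<xi> - \<alpha> * t)) has_real_derivative F 1 (real_of_int j + x - \<alpha> * t) * 1) (at x)"
      using deriv_chainD[OF F, of 0] by (intro DERIV_chain2[where f = "F 0"]) (auto intro!: derivative_eq_intros)
    then show ?thesis by (simp add: \<phi>_def[abs_def] \<phi>'_def)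
  qed
  have c\<phi>: "continuous_on {0..1} (\<phi> j)" "continuous_on {0..1} (\<phi>' j)" for j
    unfolding \<phi>_def[abs_def] \<phi>'_def[abs_def] by (rule c)+
  have proj: "cell_ip (poly q) (\<phi> j) = cell_ip (poly q) (poly (\<pi> j))" if "degree q \<le> k" for q j
  proof -
    have "cell_ip (\<lambda>\<xi>. \<phi> j \<xi> - poly (\<pi> j) \<xi>) (poly q) = 0"
      unfolding \<phi>_def by (rule \<pi>[OF that])
    moreover have "cell_ip (\<lambda>\<xi>. \<phi> j \<xi> - poly (\<pi> j) \<xi>) (poly q) = cell_ip (\<phi> j) (poly q) - cell_ip (poly (\<pi> j)) (poly q)"
      by (intro cell_ip_diff_left continuous_intros c\<phi>)
    ultimately show ?thesis
      by (simp add: cell_ip_commute[of "poly q"])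
  qed
  have degp: "degree (p j) \<le> k" for j
    unfolding p_def by (rule deg[OF t])
  have degd: "degree (pderiv (p j)) \<le> k" for j
    using degp[of j] by (simp add: degree_pderiv)
  define D where "D j = cell_ip (poly (P' j t)) (\<phi> j) - \<alpha> * cell_ip (poly (p j)) (\<phi>' j)" for j
  have cell: "((\<lambda>s. cell_ip (poly (P j s)) (\<lambda>\<xi>. F 0 (real_of_int j + \<xi> - \<alpha> * s))) has_real_derivative D j) (at t within {0..T})" for j
  proof -
    have "((\<lambda>s. cell_ip (poly (P j s)) (\<lambda>\<xi>. F 0 (real_of_int j + \<xi> - \<alpha> * s))) has_real_derivative
      cell_ip (poly (P' j t)) (\<lambda>\<xi>. F 0 (real_of_int j + \<xi> - \<alpha> * t)) +
      (\<Sum>i\<le>k. coeff (P j t) i * (- \<alpha> * cell_ip (\<lambda>\<xi>. \<xi> ^ i) (\<lambda>\<xi>. F 1 (real_of_int j + \<xi> - \<alpha> * t))))) (at t within {0..T})"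
      using t by (intro cell_ip_poly_has_derivative deg deg' der cell_moment_has_derivative F c
          continuous_intros convex_real_interval)
    moreover have "(\<Sum>i\<le>k. coeff (P j t) i * (- \<alpha> * cell_ip (\<lambda>\<xi>. \<xi> ^ i) (\<lambda>\<xi>. F 1 (real_of_int j + \<xi> - \<alpha> * t))))
        = - \<alpha> * cell_ip (poly (p j)) (\<phi>' j)"
      unfolding cell_ip_poly_sum[OF degp c\<phi>(2)] sum_distrib_left
      by (intro sum.cong refl) (simp add: p_def \<phi>'_def[abs_def])
    ultimately show ?thesis
      by (simp add: D_def \<phi>_def[abs_def])
  qed
  have D: "D j = \<alpha> * (poly (p (j - 1)) 1 * poly (\<pi> j) 0 - poly (p j) 0 * poly (\<pi> j) 0
      - poly (p j) 1 * \<phi> j 1 + poly (p j) 0 * \<phi> j 0)" for j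
  proof -
    have 1: "cell_ip (poly (P' j t)) (\<phi> j) = \<alpha> * (cell_ip (poly (p j)) (poly (pderiv (\<pi> j)))
        - poly (p j) 1 * poly (\<pi> j) 1 + poly (p (j - 1)) 1 * poly (\<pi> j) 0)"
      unfolding proj[OF deg'[OF t]] p_def by (rule scheme[OF t deg_\<pi>])
    have 2: "cell_ip (poly (p j)) (\<phi>' j) = poly (p j) 1 * \<phi> j 1 - poly (p j) 0 * \<phi> j 0 - cell_ip (poly (pderiv (p j))) (\<phi> j)"
      by (intro cell_integration_by_parts poly_DERIV \<phi>_der continuous_intros c\<phi>)
    have 3: "cell_ip (poly (p j)) (poly (pderiv (\<pi> j))) = poly (p j) 1 * poly (\<pi> j) 1 - poly (p j) 0 * poly (\<pi> j) 0
        - cell_ip (poly (pderiv (p j))) (poly (\<pi> j))"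
      by (intro cell_integration_by_parts poly_DERIV continuous_intros)
    show ?thesis
      unfolding D_def 1 2 3 proj[OF degd] by (simp add: algebra_simps)
  qed
  have "(\<Sum>j\<in>{0..<int N}. poly (p (j - 1)) 1 * \<phi> (j - 1) 1) = (\<Sum>j\<in>{0..<int N}. poly (p j) 1 * \<phi> j 1)"
  proof (rule sum_periodic_shift[OF N])
    fix j
    have "\<phi> (j + int N) 1 = \<phi> j 1"
      using periodic_of_int_add[OF perF, of j "1 - \<alpha> * t"] by (simp add: \<phi>_def algebra_simps)
    then show "poly (p (j + int N)) 1 * \<phi> (j + int N) 1 = poly (p j) 1 * \<phi> j 1"
      by (simp add: p_def per[OF t])
  qed
  moreover have "\<phi> (j - 1) 1 = \<phi> j 0" for j
    by (simp add: \<phi>_def)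
  ultimately have shift: "(\<Sum>j\<in>{0..<int N}. poly (p j) 1 * \<phi> j 1) = (\<Sum>j\<in>{0..<int N}. poly (p (j - 1)) 1 * \<phi> j 0)"
    by simp
  have "(\<Sum>j\<in>{0..<int N}. D j) = \<alpha> * ((\<Sum>j\<in>{0..<int N}. poly (p (j - 1)) 1 * poly (\<pi> j) 0 - poly (p j) 0 * poly (\<pi> j) 0
      + poly (p j) 0 * \<phi> j 0) - (\<Sum>j\<in>{0..<int N}. poly (p j) 1 * \<phi> j 1))"
    unfolding D sum_distrib_left[symmetric] sum_subtractf[symmetric] by (simp add: algebra_simps)
  also have "\<dots> = \<alpha> * (\<Sum>j\<in>{0..<int N}. jump j t * (\<phi> j 0 - poly (\<pi> j) 0))"
    unfolding shift sum_subtractf[symmetric] jump_def p_def[symmetric] by (simp add: algebra_simps)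
  finally have total: "(\<Sum>j\<in>{0..<int N}. D j) = \<alpha> * (\<Sum>j\<in>{0..<int N}. jump j t * (F 0 (real_of_int j - \<alpha> * t) - poly (\<pi> j) 0))"
    by (simp add: \<phi>_def)
  show ?thesis
    unfolding total[symmetric] by (intro DERIV_sum cell)
qed

text \<open>The upwind flux completes the square in the boundary terms.\<close>

lemma energy_has_derivative:
  assumes t: "t \<in> {0..T}"
  shows "((\<lambda>s. \<Sum>j\<in>{0..<int N}. cell_ip (poly (P j s)) (poly (P j s))) has_real_derivative
    - \<alpha> * dissipation t) (at t within {0..T})"
proof -
  define p where "p j = P j t" for j
  have cell: "((\<lambda>s. cell_ip (poly (P j s)) (poly (P j s))) has_real_derivative
      2 * cell_ip (poly (P' j t)) (poly (p j))) (at t within {0..T})" for j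
  proof -
    have mom: "((\<lambda>s. cell_ip (\<lambda>\<xi>. \<xi> ^ i) (poly (P j s))) has_real_derivative
        cell_ip (\<lambda>\<xi>. \<xi> ^ i) (poly (P' j t))) (at t within {0..T})" for i
    proof -
      have "((\<lambda>s. cell_ip (poly (P j s)) (\<lambda>\<xi>. \<xi> ^ i)) has_real_derivative
        cell_ip (poly (P' j t)) (\<lambda>\<xi>. \<xi> ^ i) + (\<Sum>l\<le>k. coeff (P j t) l * 0)) (at t within {0..T})"
        using t by (intro cell_ip_poly_has_derivative deg deg' der continuous_intros DERIV_const)
      then show ?thesis
        by (simp add: cell_ip_commute)
    qed
    have "((\<lambda>s. cell_ip (poly (P j s)) (poly (P j s))) has_real_derivative
      cell_ip (poly (P' j t)) (poly (P j t)) +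
      (\<Sum>i\<le>k. coeff (P j t) i * cell_ip (\<lambda>\<xi>. \<xi> ^ i) (poly (P' j t)))) (at t within {0..T})"
      using t by (intro cell_ip_poly_has_derivative deg deg' der continuous_intros mom)
    moreover have "(\<Sum>i\<le>k. coeff (P j t) i * cell_ip (\<lambda>\<xi>. \<xi> ^ i) (poly (P' j t))) = cell_ip (poly (P' j t)) (poly (P j t))"
      using cell_ip_poly_sum[OF deg[OF t], of "poly (P' j t)" j] by (simp add: cell_ip_commute continuous_intros)
    ultimately show ?thesis by (simp add: p_def)
  qed
  have D: "2 * cell_ip (poly (P' j t)) (poly (p j)) = \<alpha> * (2 * (poly (p (j - 1)) 1 * poly (p j) 0)
      - (poly (p j) 0)\<^sup>2 - (poly (p j) 1)\<^sup>2)" for j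
  proof -
    have 1: "cell_ip (poly (P' j t)) (poly (p j)) = \<alpha> * (cell_ip (poly (p j)) (poly (pderiv (p j)))
        - poly (p j) 1 * poly (p j) 1 + poly (p (j - 1)) 1 * poly (p j) 0)"
      unfolding p_def by (rule scheme[OF t deg[OF t]])
    have "cell_ip (poly (p j)) (poly (pderiv (p j))) = poly (p j) 1 * poly (p j) 1 - poly (p j) 0 * poly (p j) 0
        - cell_ip (poly (pderiv (p j))) (poly (p j))"
      by (intro cell_integration_by_parts poly_DERIV continuous_intros)
    then have 2: "cell_ip (poly (p j)) (poly (pderiv (p j))) = ((poly (p j) 1)\<^sup>2 - (poly (p j) 0)\<^sup>2) / 2"
      by (simp add: cell_ip_commute[of "poly (pderiv (p j))"] power2_eq_square)
    show ?thesis
      unfolding 1 2 by (simp add: field_simps power2_eq_square)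
  qed
  have shift: "(\<Sum>j\<in>{0..<int N}. (poly (p j) 1)\<^sup>2) = (\<Sum>j\<in>{0..<int N}. (poly (p (j - 1)) 1)\<^sup>2)"
    by (rule sum_periodic_shift[OF N, symmetric]) (simp add: p_def per[OF t])
  have "(\<Sum>j\<in>{0..<int N}. 2 * cell_ip (poly (P' j t)) (poly (p j)))
    = \<alpha> * ((\<Sum>j\<in>{0..<int N}. 2 * (poly (p (j - 1)) 1 * poly (p j) 0) - (poly (p j) 0)\<^sup>2) - (\<Sum>j\<in>{0..<int N}. (poly (p j) 1)\<^sup>2))"
    unfolding D sum_distrib_left[symmetric] sum_subtractf[symmetric] by simp
  also have "\<dots> = \<alpha> * (\<Sum>j\<in>{0..<int N}. - (jump j t)\<^sup>2)"
    unfolding shift sum_subtractf[symmetric] jump_def p_def[symmetric]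
    by (intro arg_cong2[where f="(*)"] sum.cong refl) (simp add: power2_eq_square algebra_simps)
  also have "\<dots> = - \<alpha> * dissipation t"
    by (simp add: dissipation_def sum_negf)
  finally have total: "(\<Sum>j\<in>{0..<int N}. 2 * cell_ip (poly (P' j t)) (poly (p j))) = - \<alpha> * dissipation t" .
  show ?thesis
    unfolding total[symmetric] by (intro DERIV_sum cell)
qed

text \<open>The scheme is linear and invariant under translation by one cell.\<close>

lemma backward_difference:
  "unit_dg k N \<alpha> T (\<lambda>j t. P (j - 1) t - P j t) (\<lambda>j t. P' (j - 1) t - P' j t)"
proof
  fix t j i assume t: "t \<in> {0..T}"
  show "degree (P (j - 1) t - P j t) \<le> k" "degree (P' (j - 1) t - P' j t) \<le> k"
    using t by (intro degree_diff_le deg deg'; simp)+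
  show "P (j + int N - 1) t - P (j + int N) t = P (j - 1) t - P j t"
    using per[OF t, of "j - 1"] per[OF t, of j] by (simp add: algebra_simps)
  show "((\<lambda>s. coeff (P (j - 1) s - P j s) i) has_real_derivative coeff (P' (j - 1) t - P' j t) i) (at t within {0..T})"
    unfolding coeff_diff by (intro DERIV_diff der t)
  fix q :: "real poly" assume q: "degree q \<le> k"
  have diff: "cell_ip (poly (a - b)) (poly r) = cell_ip (poly a) (poly r) - cell_ip (poly b) (poly r)" for a b r :: "real poly"
    using cell_ip_diff_left[of "poly a" "poly b" "poly r"] by (simp add: continuous_intros poly_diff[abs_def])
  show "cell_ip (poly (P' (j - 1) t - P' j t)) (poly q) = \<alpha> * (cell_ip (poly (P (j - 1) t - P j t)) (poly (pderiv q))
        - poly (P (j - 1) t - P j t) 1 * poly q 1 + poly (P (j - 1 - 1) t - P (j - 1) t) 1 * poly q 0)"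
    unfolding diff scheme[OF t q] by (simp add: algebra_simps)
qed (use N \<alpha> T in auto)

lemma mono_of_deriv_nonpos:
  assumes "\<And>t. t \<in> {0..T} \<Longrightarrow> (W has_real_derivative W' t) (at t within {0..T})"
    and "\<And>t. t \<in> {0..T} \<Longrightarrow> W' t \<le> 0"
  shows "W T \<le> W 0"
proof -
  obtain x where x: "x \<in> {0<..<T}" "W T - W 0 = W' x * (T - 0)"
    using mvt_simple[of 0 T W "\<lambda>t. (*) (W' t)"] T assms(1) by (auto simp: has_field_derivative_def)
  then have "W' x * T \<le> 0"
    using assms(2)[of x] T by (auto intro: mult_nonpos_nonneg)
  then show ?thesis using x by simp
qed

text \<open>With \<open>R\<^sup>2 = N m\<^sup>2\<close>, the squared error \<open>E\<close> satisfies \<open>E' \<le> \<alpha> (- J + 2 c R \<surd>J)\<close>, where \<open>J\<close> is the dissipation,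
  and the pairing with the dual function changes at a rate of at most \<open>\<alpha> c S \<surd>J\<close>.  Adding the multiple \<open>c S / R\<close> of
  \<open>E\<close> absorbs the second rate into the first up to a constant, by completing squares.\<close>

lemma weak_error_estimate:
  assumes F: "deriv_chain (Suc k) F" and perF: "periodic (real N) (F 0)"
    and bound: "\<And>x. \<bar>F (Suc k) x\<bar> \<le> m" and m: "m > 0"
    and init: "initial_projection k P (F 0)"
    and G: "deriv_chain (Suc k) G" and perG: "\<And>i. i \<le> Suc k \<Longrightarrow> periodic (real N) (G i)"
    and const: "projection_constant k c"
  defines "S \<equiv> sqrt (\<Sum>j\<in>{0..<int N}. cell_ip (\<lambda>\<xi>. G (Suc k) (real_of_int j + \<xi>)) (\<lambda>\<xi>. G (Suc k) (real_of_int j + \<xi>)))"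
  shows "\<bar>\<Sum>j\<in>{0..<int N}. cell_ip (\<lambda>\<xi>. F 0 (real_of_int j + \<xi> - \<alpha> * T) - poly (P j T) \<xi>) (\<lambda>\<xi>. G 0 (real_of_int j + \<xi> - \<alpha> * T))\<bar>
    \<le> (1 + c + c * (1/2 + 2 * c\<^sup>2) * \<alpha> * T) * (m * sqrt (real N)) * S"
proof -
  have c: "c > 0"
    using const by (simp add: projection_constant_def)
  have proj: "\<bar>F 0 0 - poly p 0\<bar> \<le> c * sqrt (cell_ip (F (Suc k)) (F (Suc k))) \<and>
      cell_ip (\<lambda>x. F 0 x - poly p x) (\<lambda>x. F 0 x - poly p x) \<le> cell_ip (F (Suc k)) (F (Suc k))"
    if "deriv_chain (Suc k) F" "degree p \<le> k"
      "\<And>q. degree q \<le> k \<Longrightarrow> cell_ip (\<lambda>x. F 0 x - poly p x) (poly q) = 0" for F p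
    using const[unfolded projection_constant_def, THEN conjunct2, rule_format, OF that(1,2)] that(3) by simp
  define R where "R = m * sqrt (real N)"
  have R: "R > 0" using m N by (simp add: R_def)
  have R2: "R\<^sup>2 = m\<^sup>2 * real N" by (simp add: R_def power_mult_distrib)
  have S0: "S \<ge> 0" unfolding S_def by (intro real_sqrt_ge_zero sum_nonneg cell_ip_self_nonneg)
  let ?I = "{0..<int N}"
  define fj where "fj t j \<xi> = F 0 (real_of_int j + \<xi> - \<alpha> * t)" for t j \<xi>
  define gj where "gj t j \<xi> = G 0 (real_of_int j + \<xi> - \<alpha> * t)" for t j \<xi>
  define s where "s t j = sqrt (cell_ip (\<lambda>\<xi>. G (Suc k) (real_of_int j + \<xi> - \<alpha> * t)) (\<lambda>\<xi>. G (Suc k) (real_of_int j + \<xi> - \<alpha> * t)))" for t j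
  have chF: "deriv_chain (Suc k) (\<lambda>i \<xi>. F i (real_of_int j + \<xi> - \<alpha> * t))" for t j
    using deriv_chain_translate[OF F, of "real_of_int j - \<alpha> * t"] by (simp add: algebra_simps)
  have chG: "deriv_chain (Suc k) (\<lambda>i \<xi>. G i (real_of_int j + \<xi> - \<alpha> * t))" for t j
    using deriv_chain_translate[OF G, of "real_of_int j - \<alpha> * t"] by (simp add: algebra_simps)
  have cf: "continuous_on A (fj t j)" and cg: "continuous_on A (gj t j)" for A t j
    unfolding fj_def[abs_def] gj_def[abs_def]
    using deriv_chain_continuous[OF chF[of j t], of 0 A] deriv_chain_continuous[OF chG[of j t], of 0 A] by simp_all
  have cF: "continuous_on A (F i)" and cG: "continuous_on A (G i)" if "i \<le> Suc k" for A i
    using that by (intro deriv_chain_continuous[OF F] deriv_chain_continuous[OF G]; simp)+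
  have s_sum: "(\<Sum>j\<in>?I. (s t j)\<^sup>2) = S\<^sup>2" for t
  proof -
    have "(\<Sum>j\<in>?I. integral {0..1} (\<lambda>\<xi>. G (Suc k) (real_of_int j + \<xi> + (- \<alpha> * t)) * G (Suc k) (real_of_int j + \<xi> + (- \<alpha> * t))))
      = (\<Sum>j\<in>?I. integral {0..1} (\<lambda>\<xi>. G (Suc k) (real_of_int j + \<xi>) * G (Suc k) (real_of_int j + \<xi>)))"
      using perG[of "Suc k"] by (intro cell_sum_translation continuous_intros cG) (simp_all add: periodic_def)
    then show ?thesis
      unfolding s_def S_def by (simp add: cell_ip_self_nonneg sum_nonneg) (simp add: cell_ip_def)
  qed
  have fproj: "\<exists>\<pi>. \<forall>j. degree (\<pi> j) \<le> k \<and> (\<forall>q. degree q \<le> k \<longrightarrow> cell_ip (\<lambda>\<xi>. fj t j \<xi> - poly (\<pi> j) \<xi>) (poly q) = 0)" for t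
    using cell_projection_exists[OF cf[of "{0..1}" t]] by (intro choice allI)
  have gproj: "\<exists>\<pi>. \<forall>j. degree (\<pi> j) \<le> k \<and> (\<forall>q. degree q \<le> k \<longrightarrow> cell_ip (\<lambda>\<xi>. gj t j \<xi> - poly (\<pi> j) \<xi>) (poly q) = 0)" for t
    using cell_projection_exists[OF cg[of "{0..1}" t]] by (intro choice allI)
  obtain \<pi>f where "\<And>t. \<forall>j. degree (\<pi>f t j) \<le> k \<and> (\<forall>q. degree q \<le> k \<longrightarrow> cell_ip (\<lambda>\<xi>. fj t j \<xi> - poly (\<pi>f t j) \<xi>) (poly q) = 0)"
    using fproj by metis
  then have \<pi>f: "degree (\<pi>f t j) \<le> k" "degree q \<le> k \<Longrightarrow> cell_ip (\<lambda>\<xi>. fj t j \<xi> - poly (\<pi>f t j) \<xi>) (poly q) = 0" for t j q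
    by auto
  obtain \<pi>g where "\<And>t. \<forall>j. degree (\<pi>g t j) \<le> k \<and> (\<forall>q. degree q \<le> k \<longrightarrow> cell_ip (\<lambda>\<xi>. gj t j \<xi> - poly (\<pi>g t j) \<xi>) (poly q) = 0)"
    using gproj by metis
  then have \<pi>g: "degree (\<pi>g t j) \<le> k" "degree q \<le> k \<Longrightarrow> cell_ip (\<lambda>\<xi>. gj t j \<xi> - poly (\<pi>g t j) \<xi>) (poly q) = 0" for t j q
    by auto
  have F_sq: "cell_ip (\<lambda>\<xi>. F (Suc k) (real_of_int j + \<xi> - \<alpha> * t)) (\<lambda>\<xi>. F (Suc k) (real_of_int j + \<xi> - \<alpha> * t)) \<le> m\<^sup>2" for j t
  proof -
    have cFj: "continuous_on {0..1} (\<lambda>\<xi>. F (Suc k) (real_of_int j + \<xi> - \<alpha> * t))"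
      by (rule deriv_chain_continuous[OF chF order.refl])
    have "cell_ip (\<lambda>\<xi>. F (Suc k) (real_of_int j + \<xi> - \<alpha> * t)) (\<lambda>\<xi>. F (Suc k) (real_of_int j + \<xi> - \<alpha> * t))
        \<le> integral {0..1} (\<lambda>\<xi>::real. m\<^sup>2)"
      unfolding cell_ip_def
    proof (rule integral_le)
      show "(\<lambda>\<xi>. F (Suc k) (real_of_int j + \<xi> - \<alpha> * t) * F (Suc k) (real_of_int j + \<xi> - \<alpha> * t)) integrable_on {0..1}"
        by (intro cell_ip_integrable cFj)
      fix \<xi> :: real
      have "\<bar>F (Suc k) (real_of_int j + \<xi> - \<alpha> * t)\<bar>\<^sup>2 \<le> m\<^sup>2"
        by (intro power_mono bound) simp
      then show "F (Suc k) (real_of_int j + \<xi> - \<alpha> * t) * F (Suc k) (real_of_int j + \<xi> - \<alpha> * t) \<le> m\<^sup>2"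
        by (simp add: power2_eq_square)
    qed (rule integrable_const_ivl)
    then show ?thesis by simp
  qed
  have f_trace: "\<bar>fj t j 0 - poly (\<pi>f t j) 0\<bar> \<le> c * m" for t j
  proof -
    have "\<bar>fj t j 0 - poly (\<pi>f t j) 0\<bar> \<le> c * sqrt (cell_ip (\<lambda>\<xi>. F (Suc k) (real_of_int j + \<xi> - \<alpha> * t)) (\<lambda>\<xi>. F (Suc k) (real_of_int j + \<xi> - \<alpha> * t)))"
      using proj[OF chF \<pi>f(1) \<pi>f(2)[unfolded fj_def], of j t] by (simp add: fj_def)
    also have "\<dots> \<le> c * m"
      using F_sq m c by (intro mult_left_mono real_le_lsqrt) auto
    finally show ?thesis .
  qed
  have g_trace: "\<bar>gj t j 0 - poly (\<pi>g t j) 0\<bar> \<le> c * s t j" for t j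
    using proj[OF chG \<pi>g(1) \<pi>g(2)[unfolded gj_def], of j t] by (simp add: gj_def s_def)
  have g_err: "sqrt (cell_ip (\<lambda>\<xi>. gj t j \<xi> - poly (\<pi>g t j) \<xi>) (\<lambda>\<xi>. gj t j \<xi> - poly (\<pi>g t j) \<xi>)) \<le> s t j" for t j
    using proj[OF chG \<pi>g(1) \<pi>g(2)[unfolded gj_def], of j t] by (simp add: gj_def s_def)
  define Bf where "Bf t = (\<Sum>j\<in>?I. cell_ip (poly (P j t)) (fj t j))" for t
  define Bg where "Bg t = (\<Sum>j\<in>?I. cell_ip (poly (P j t)) (gj t j))" for t
  define A where "A t = (\<Sum>j\<in>?I. cell_ip (poly (P j t)) (poly (P j t)))" for t
  define jf where "jf t = (\<Sum>j\<in>?I. jump j t * (fj t j 0 - poly (\<pi>f t j) 0))" for t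
  define jg where "jg t = (\<Sum>j\<in>?I. jump j t * (gj t j 0 - poly (\<pi>g t j) 0))" for t
  have dA: "(A has_real_derivative - \<alpha> * dissipation t) (at t within {0..T})" if "t \<in> {0..T}" for t
    unfolding A_def[abs_def] by (rule energy_has_derivative[OF that])
  have dBf: "(Bf has_real_derivative \<alpha> * jf t) (at t within {0..T})" if "t \<in> {0..T}" for t
    using transport_pairing_has_derivative[OF deriv_chain_le[OF F, of 1] perF that \<pi>f(1) \<pi>f(2)[unfolded fj_def]]
    unfolding Bf_def[abs_def] jf_def by (simp add: fj_def[abs_def])
  have dBg: "(Bg has_real_derivative \<alpha> * jg t) (at t within {0..T})" if "t \<in> {0..T}" for t
    using transport_pairing_has_derivative[OF deriv_chain_le[OF G, of 1] perG[of 0] that \<pi>g(1) \<pi>g(2)[unfolded gj_def]]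
    unfolding Bg_def[abs_def] jg_def by (simp add: gj_def[abs_def])
  have jf: "\<bar>jf t\<bar> \<le> sqrt (dissipation t) * (c * R)" for t
    unfolding jf_def dissipation_def
  proof (rule abs_sum_mult_le)
    have "(\<Sum>j\<in>?I. (fj t j 0 - poly (\<pi>f t j) 0)\<^sup>2) \<le> (\<Sum>j\<in>?I. (c * m)\<^sup>2)"
      using power_mono[OF f_trace abs_ge_zero, of t _ 2] by (intro sum_mono) simp
    then show "(\<Sum>j\<in>?I. (fj t j 0 - poly (\<pi>f t j) 0)\<^sup>2) \<le> (c * R)\<^sup>2"
      by (simp add: power_mult_distrib R2 mult_ac)
  qed (use c R in simp)
  have jg: "\<bar>jg t\<bar> \<le> sqrt (dissipation t) * (c * S)" for t
    unfolding jg_def dissipation_def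
  proof (rule abs_sum_mult_le)
    have "(\<Sum>j\<in>?I. (gj t j 0 - poly (\<pi>g t j) 0)\<^sup>2) \<le> (\<Sum>j\<in>?I. (c * s t j)\<^sup>2)"
      using power_mono[OF g_trace abs_ge_zero, of t _ 2] by (intro sum_mono) simp
    then show "(\<Sum>j\<in>?I. (gj t j 0 - poly (\<pi>g t j) 0)\<^sup>2) \<le> (c * S)\<^sup>2"
      by (simp add: power_mult_distrib sum_distrib_left[symmetric] s_sum)
  qed (use c S0 in simp)
  have transl: "(\<Sum>j\<in>?I. cell_ip (\<lambda>\<xi>. u (real_of_int j + \<xi> - \<alpha> * t)) (\<lambda>\<xi>. v (real_of_int j + \<xi> - \<alpha> * t)))
      = (\<Sum>j\<in>?I. cell_ip (\<lambda>\<xi>. u (real_of_int j + \<xi>)) (\<lambda>\<xi>. v (real_of_int j + \<xi>)))"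
    if "continuous_on UNIV u" "continuous_on UNIV v" "periodic (real N) u" "periodic (real N) v" for u v t
    using cell_sum_translation[of "\<lambda>x. u x * v x" N "- \<alpha> * t"] that
    by (simp add: cell_ip_def periodic_def continuous_on_mult)
  define Q where "Q = (\<Sum>j\<in>?I. cell_ip (fj 0 j) (fj 0 j))"
  define E where "E t = A t - 2 * Bf t + Q" for t
  have E_eq: "E t = (\<Sum>j\<in>?I. cell_ip (\<lambda>\<xi>. fj t j \<xi> - poly (P j t) \<xi>) (\<lambda>\<xi>. fj t j \<xi> - poly (P j t) \<xi>))" for t
  proof -
    have "cell_ip (\<lambda>\<xi>. fj t j \<xi> - poly (P j t) \<xi>) (\<lambda>\<xi>. fj t j \<xi> - poly (P j t) \<xi>)
      = cell_ip (poly (P j t)) (poly (P j t)) - 2 * cell_ip (poly (P j t)) (fj t j) + cell_ip (fj t j) (fj t j)" for j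
    proof -
      have "cell_ip (\<lambda>\<xi>. fj t j \<xi> - poly (P j t) \<xi>) (\<lambda>\<xi>. fj t j \<xi> - poly (P j t) \<xi>)
        = cell_ip (fj t j) (\<lambda>\<xi>. fj t j \<xi> - poly (P j t) \<xi>) - cell_ip (poly (P j t)) (\<lambda>\<xi>. fj t j \<xi> - poly (P j t) \<xi>)"
        by (intro cell_ip_diff_left continuous_intros cf)
      also have "\<dots> = (cell_ip (fj t j) (fj t j) - cell_ip (fj t j) (poly (P j t)))
          - (cell_ip (poly (P j t)) (fj t j) - cell_ip (poly (P j t)) (poly (P j t)))"
        by (intro arg_cong2[where f="(-)"] cell_ip_diff_right continuous_intros cf)
      finally show ?thesis by (simp add: cell_ip_commute[of "fj t j" "poly (P j t)"])
    qed
    moreover have "Q = (\<Sum>j\<in>?I. cell_ip (fj t j) (fj t j))"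
      using transl[of "F 0" "F 0" t] cF[of 0] perF by (simp add: Q_def fj_def[abs_def])
    ultimately show ?thesis
      by (simp add: E_def A_def Bf_def sum.distrib sum_subtractf sum_distrib_left)
  qed
  have ET: "E T \<ge> 0"
    unfolding E_eq by (intro sum_nonneg cell_ip_self_nonneg)
  have init': "cell_ip (\<lambda>\<xi>. fj 0 j \<xi> - poly (P j 0) \<xi>) (poly q) = 0" if "degree q \<le> k" for j q
    using init that by (simp add: fj_def initial_projection_def)
  have deg0: "degree (P j 0) \<le> k" for j
    using T by (intro deg) simp
  have e0: "cell_ip (\<lambda>\<xi>. fj 0 j \<xi> - poly (P j 0) \<xi>) (\<lambda>\<xi>. fj 0 j \<xi> - poly (P j 0) \<xi>) \<le> m\<^sup>2" for j
    using proj[OF chF deg0 init'[unfolded fj_def], of j] F_sq[of j 0] by (simp add: fj_def)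
  have E0: "E 0 \<le> R\<^sup>2"
  proof -
    have "E 0 \<le> (\<Sum>j\<in>?I. m\<^sup>2)"
      unfolding E_eq by (intro sum_mono e0)
    then show ?thesis by (simp add: R2 mult.commute)
  qed
  define K where "K = c * \<alpha> * S * R * (1/2 + 2 * c\<^sup>2)"
  have growth: "\<sigma> * (Bg T - Bg 0) \<le> c * S * R + K * T" if \<sigma>: "\<sigma> = 1 \<or> \<sigma> = - 1" for \<sigma> :: real
  proof -
    define W where "W t = \<sigma> * Bg t + (c * S / R) * E t - K * t" for t
    define W' where "W' t = \<sigma> * (\<alpha> * jg t) + (c * S / R) * (- \<alpha> * dissipation t - 2 * (\<alpha> * jf t) + 0) - K * 1" for t
    have "W T \<le> W 0"
    proof (rule mono_of_deriv_nonpos)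
      fix t assume t: "t \<in> {0..T}"
      show "(W has_real_derivative W' t) (at t within {0..T})"
        unfolding W_def[abs_def] W'_def E_def
        by (intro DERIV_diff DERIV_add DERIV_cmult DERIV_const DERIV_ident dA dBf dBg t)
      define x where "x = sqrt (dissipation t)"
      have x2: "x\<^sup>2 = dissipation t"
        by (simp add: x_def dissipation_def sum_nonneg)
      have "\<sigma> * jg t \<le> x * (c * S)"
        using jg[of t] \<sigma> by (auto simp: x_def abs_le_iff)
      then have 1: "\<sigma> * (\<alpha> * jg t) \<le> \<alpha> * (x * (c * S))"
        using \<alpha> by (simp add: mult.left_commute)
      have "- jf t \<le> x * (c * R)"
        using jf[of t] by (simp add: x_def abs_le_iff)
      then have "2 * \<alpha> * (- jf t) \<le> 2 * \<alpha> * (x * (c * R))"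
        using \<alpha> by (intro mult_left_mono) simp_all
      then have "- \<alpha> * dissipation t - 2 * (\<alpha> * jf t) \<le> - \<alpha> * x\<^sup>2 + \<alpha> * (2 * x * (c * R))"
        unfolding x2 by (simp add: algebra_simps)
      then have 2: "(c * S / R) * (- \<alpha> * dissipation t - 2 * (\<alpha> * jf t) + 0) \<le> (c * S / R) * (- \<alpha> * x\<^sup>2 + \<alpha> * (2 * x * (c * R)))"
        using c S0 R by (intro mult_left_mono) simp_all
      \<comment> \<open>The choice of the weight \<open>c S / R\<close> and of \<open>K\<close> makes the rate a negative sum of two squares.\<close>
      have "\<alpha> * (x * (c * S)) + (c * S / R) * (- \<alpha> * x\<^sup>2 + \<alpha> * (2 * x * (c * R))) - K * 1
          = - (\<alpha> * c * S / R) * (((x - R)\<^sup>2 + (x - 2 * c * R)\<^sup>2) / 2)"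
        using R by (simp add: K_def field_simps power2_eq_square)
      also have "\<dots> \<le> 0"
        using c S0 R \<alpha> by (simp add: mult_nonneg_nonneg)
      finally show "W' t \<le> 0"
        using 1 2 unfolding W'_def by linarith
    qed
    then have "\<sigma> * (Bg T - Bg 0) \<le> (c * S / R) * (E 0 - E T) + K * T"
      by (simp add: W_def algebra_simps diff_divide_distrib)
    also have "(c * S / R) * (E 0 - E T) \<le> (c * S / R) * R\<^sup>2"
      using c S0 R E0 ET by (intro mult_left_mono) simp_all
    also have "(c * S / R) * R\<^sup>2 = c * S * R"
      using R by (simp add: power2_eq_square)
    finally show ?thesis by simp
  qed
  have start: "\<bar>\<Sum>j\<in>?I. cell_ip (\<lambda>\<xi>. fj 0 j \<xi> - poly (P j 0) \<xi>) (gj 0 j)\<bar> \<le> R * S"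
  proof -
    have "\<bar>cell_ip (\<lambda>\<xi>. fj 0 j \<xi> - poly (P j 0) \<xi>) (gj 0 j)\<bar> \<le> m * s 0 j" for j
    proof -
      let ?e = "\<lambda>\<xi>. fj 0 j \<xi> - poly (P j 0) \<xi>" and ?d = "\<lambda>\<xi>. gj 0 j \<xi> - poly (\<pi>g 0 j) \<xi>"
      have ce: "continuous_on {0..1} ?e" and cd: "continuous_on {0..1} ?d"
        by (intro continuous_intros cf cg)+
      have "cell_ip ?e ?d = cell_ip ?e (gj 0 j)"
        using init'[OF \<pi>g(1)[of 0 j], of j] by (subst cell_ip_diff_right[OF cg _ ce]) (auto intro: continuous_intros)
      moreover have "\<bar>cell_ip ?e ?d\<bar> \<le> sqrt (cell_ip ?e ?e * cell_ip ?d ?d)"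
        by (intro real_le_rsqrt) (simp add: cell_ip_Cauchy_Schwarz[OF ce cd])
      moreover have "\<dots> \<le> m * s 0 j"
        unfolding real_sqrt_mult using m e0[of j] by (intro mult_mono g_err real_le_lsqrt) (auto simp: cell_ip_self_nonneg)
      ultimately show ?thesis by simp
    qed
    then have "\<bar>\<Sum>j\<in>?I. cell_ip (\<lambda>\<xi>. fj 0 j \<xi> - poly (P j 0) \<xi>) (gj 0 j)\<bar> \<le> (\<Sum>j\<in>?I. m * s 0 j)"
      by (intro order.trans[OF sum_abs] sum_mono)
    also have "\<dots> \<le> \<bar>\<Sum>j\<in>?I. m * s 0 j\<bar>"
      by simp
    also have "\<dots> \<le> sqrt (\<Sum>j\<in>?I. m\<^sup>2) * S"
      by (rule abs_sum_mult_le) (simp_all add: s_sum S0)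
    also have "sqrt (\<Sum>j\<in>?I. m\<^sup>2) = R"
      using m by (simp add: R_def real_sqrt_mult mult.commute)
    finally show ?thesis .
  qed
  have split: "(\<Sum>j\<in>?I. cell_ip (\<lambda>\<xi>. fj t j \<xi> - poly (P j t) \<xi>) (gj t j)) = (\<Sum>j\<in>?I. cell_ip (fj t j) (gj t j)) - Bg t" for t
    unfolding Bg_def sum_subtractf[symmetric]
    by (intro sum.cong refl cell_ip_diff_left continuous_intros cf cg)
  have "(\<Sum>j\<in>?I. cell_ip (fj T j) (gj T j)) = (\<Sum>j\<in>?I. cell_ip (fj 0 j) (gj 0 j))"
    using transl[of "F 0" "G 0" T] cF[of 0] cG[of 0] perF perG[of 0] by (simp add: fj_def[abs_def] gj_def[abs_def])
  moreover have "Bg T - Bg 0 \<le> c * S * R + K * T" "- (Bg T - Bg 0) \<le> c * S * R + K * T"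
    using growth[of 1] growth[of "-1"] by simp_all
  ultimately have "\<bar>\<Sum>j\<in>?I. cell_ip (\<lambda>\<xi>. fj T j \<xi> - poly (P j T) \<xi>) (gj T j)\<bar> \<le> R * S + (c * S * R + K * T)"
    using start unfolding split by linarith
  also have "\<dots> = (1 + c + c * (1/2 + 2 * c\<^sup>2) * \<alpha> * T) * R * S"
    by (simp add: K_def algebra_simps)
  finally show ?thesis
    by (simp add: fj_def gj_def[abs_def] R_def)
qed

end


lemma periodic_funpow_fdiff:
  assumes "periodic L g"
  shows "periodic L ((fdiff ^^ l) g)"
proof (induction l)
  case (Suc l)
  define D where "D = (fdiff ^^ l) g"
  have "D (x + L) = D x" for x
    using Suc by (simp add: periodic_def D_def)
  moreover have "x + L + 1 = x + 1 + L" for x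
    by simp
  ultimately have "fdiff D (x + L) = fdiff D x" for x
    by (simp only: fdiff_def)
  then show ?case
    by (simp add: periodic_def D_def)
qed (use assms in simp)

lemma continuous_funpow_fdiff:
  assumes "continuous_on UNIV g"
  shows "continuous_on UNIV ((fdiff ^^ l) g)"
proof (induction l)
  case (Suc l)
  have "continuous_on UNIV (\<lambda>x. (fdiff ^^ l) g (x + 1) - (fdiff ^^ l) g x)"
    by (intro continuous_on_diff continuous_on_compose2[OF Suc] Suc continuous_intros) auto
  then show ?case by (simp add: fdiff_def[abs_def])
qed (use assms in simp)

lemma deriv_chain_backward_difference:
  assumes "deriv_chain n F"
  shows "deriv_chain n (\<lambda>i x. F i (x - 1) - F i x)"
proof -
  have *: "deriv_chain n (\<lambda>i x. F i (- 1 + x))"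
    by (rule deriv_chain_translate[OF assms])
  have c: "continuous_on UNIV (\<lambda>x. F n (- 1 + x) - F n x)"
    by (intro continuous_on_diff deriv_chain_continuous[OF *] deriv_chain_continuous[OF assms]) simp_all
  show ?thesis
    using DERIV_diff[OF deriv_chainD[OF *] deriv_chainD[OF assms]] c
    by (simp add: deriv_chain_def)
qed

lemma backward_difference_bound:
  fixes g g' :: "real \<Rightarrow> real"
  assumes "\<And>x. (g has_real_derivative g' x) (at x)" "\<And>x. \<bar>g' x\<bar> \<le> m"
  shows "\<bar>g (x - 1) - g x\<bar> \<le> m"
proof -
  obtain y where "g x - g (x - 1) = (x - (x - 1)) * g' y"
    using MVT2[of "x - 1" x g g'] assms(1) by auto
  then show ?thesis using assms(2)[of y] by (simp add: abs_minus_commute)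
qed

text \<open>Summation by parts moves one difference at a time from the test function to the error, where it
  becomes a difference of the discrete solution and of the initial function.  By the mean value theorem the
  latter costs one derivative.\<close>

lemma weak_error_estimate_differences:
  assumes "unit_dg k N \<alpha> T P P'"
    and "deriv_chain (Suc k + l) F" and "\<And>i. i \<le> Suc k + l \<Longrightarrow> periodic (real N) (F i)"
    and "\<And>x. \<bar>F (Suc k + l) x\<bar> \<le> m" and "m > 0"
    and "initial_projection k P (F 0)"
    and G: "deriv_chain (Suc k) G" and perG: "\<And>i. i \<le> Suc k \<Longrightarrow> periodic (real N) (G i)"
    and const: "projection_constant k c"
  shows "\<bar>\<Sum>j\<in>{0..<int N}. cell_ip (\<lambda>\<xi>. F 0 (real_of_int j + \<xi> - \<alpha> * T) - poly (P j T) \<xi>)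
      (\<lambda>\<xi>. (fdiff ^^ l) (G 0) (real_of_int j + \<xi>))\<bar>
    \<le> (1 + c + c * (1/2 + 2 * c\<^sup>2) * \<alpha> * T) * (m * sqrt (real N)) *
      sqrt (\<Sum>j\<in>{0..<int N}. cell_ip (\<lambda>\<xi>. G (Suc k) (real_of_int j + \<xi>)) (\<lambda>\<xi>. G (Suc k) (real_of_int j + \<xi>)))"
  using assms(1-6)
proof (induction l arbitrary: P P' F)
  case 0
  interpret unit_dg k N \<alpha> T P P' by fact
  define H where "H i x = G i (\<alpha> * T + x)" for i x
  have H: "deriv_chain (Suc k) H"
    unfolding H_def[abs_def] by (rule deriv_chain_translate[OF G])
  have perH: "periodic (real N) (H i)" if "i \<le> Suc k" for i
    using perG[OF that] by (simp add: H_def[abs_def] periodic_def add.assoc[symmetric])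
  have "(\<Sum>j\<in>{0..<int N}. cell_ip (\<lambda>\<xi>. H (Suc k) (real_of_int j + \<xi>)) (\<lambda>\<xi>. H (Suc k) (real_of_int j + \<xi>)))
    = (\<Sum>j\<in>{0..<int N}. cell_ip (\<lambda>\<xi>. G (Suc k) (real_of_int j + \<xi>)) (\<lambda>\<xi>. G (Suc k) (real_of_int j + \<xi>)))"
    using cell_sum_translation[of "\<lambda>x. G (Suc k) x * G (Suc k) x" N "\<alpha> * T"]
      deriv_chain_continuous[OF G order.refl, of UNIV] perG[of "Suc k"]
    by (simp add: H_def cell_ip_def periodic_def continuous_on_mult add_ac)
  moreover have "periodic (real N) (F 0)" "deriv_chain (Suc k) F" "\<And>x. \<bar>F (Suc k) x\<bar> \<le> m"
    using "0.prems" by simp_all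
  ultimately show ?case
    using weak_error_estimate[of F m H, OF _ _ _ \<open>m > 0\<close> \<open>initial_projection k P (F 0)\<close> H perH const]
    by (simp add: H_def)
next
  case (Suc l)
  interpret unit_dg k N \<alpha> T P P' by fact
  note F = Suc.prems(2) and perF = Suc.prems(3) and bF = Suc.prems(4)
  define F' where "F' i x = F i (x - 1) - F i x" for i x
  define P2 where "P2 j t = P (j - 1) t - P j t" for j t
  define g where "g = (fdiff ^^ l) (G 0)"
  have cg: "continuous_on A (\<lambda>\<xi>. g (c + \<xi>))" for A c
    unfolding g_def
    by (intro continuous_on_compose2[OF continuous_funpow_fdiff[OF deriv_chain_continuous[OF G]]] continuous_intros) auto
  have perg: "periodic (real N) g"
    unfolding g_def by (intro periodic_funpow_fdiff perG) simp
  define e where "e j \<xi> = F 0 (real_of_int j + \<xi> - \<alpha> * T) - poly (P j T) \<xi>" for j \<xi>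
  have ce: "continuous_on A (e j)" for A j
    unfolding e_def[abs_def]
    by (intro continuous_intros translated_continuous deriv_chain_continuous[OF F]) simp
  have "cell_ip (e j) (\<lambda>\<xi>. fdiff g (real_of_int j + \<xi>))
    = cell_ip (e j) (\<lambda>\<xi>. g (real_of_int (j + 1) + \<xi>)) - cell_ip (e j) (\<lambda>\<xi>. g (real_of_int j + \<xi>))" for j
    using cell_ip_diff_right[OF cg[where c="real_of_int (j + 1)"] cg[where c="real_of_int j"] ce[where j=j]]
    by (simp add: fdiff_def add_ac)
  then have "(\<Sum>j\<in>{0..<int N}. cell_ip (e j) (\<lambda>\<xi>. fdiff g (real_of_int j + \<xi>)))
    = (\<Sum>j\<in>{0..<int N}. cell_ip (e j) (\<lambda>\<xi>. g (real_of_int (j + 1) + \<xi>)))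
      - (\<Sum>j\<in>{0..<int N}. cell_ip (e j) (\<lambda>\<xi>. g (real_of_int j + \<xi>)))"
    by (simp only: sum_subtractf)
  also have "(\<Sum>j\<in>{0..<int N}. cell_ip (e j) (\<lambda>\<xi>. g (real_of_int (j + 1) + \<xi>)))
    = (\<Sum>j\<in>{0..<int N}. cell_ip (e (j - 1)) (\<lambda>\<xi>. g (real_of_int (j - 1 + 1) + \<xi>)))"
  proof (rule sum_periodic_shift[OF N, symmetric])
    fix j
    have "T \<in> {0..T}" using T by simp
    then have "e (j + int N) = e j"
      using periodic_of_int_add[OF perF[of 0], of j] per[of T j] unfolding e_def[abs_def]
      by (simp add: add_diff_eq[symmetric])
    moreover have "g (real_of_int (j + int N + 1) + \<xi>) = g (real_of_int (j + 1) + \<xi>)" for \<xi>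
      using periodic_of_int_add[OF perg, of "j + 1" \<xi>] by (simp add: add_ac)
    ultimately show "cell_ip (e (j + int N)) (\<lambda>\<xi>. g (real_of_int (j + int N + 1) + \<xi>)) = cell_ip (e j) (\<lambda>\<xi>. g (real_of_int (j + 1) + \<xi>))"
      by simp
  qed
  also have "\<dots> - (\<Sum>j\<in>{0..<int N}. cell_ip (e j) (\<lambda>\<xi>. g (real_of_int j + \<xi>)))
    = (\<Sum>j\<in>{0..<int N}. cell_ip (\<lambda>\<xi>. e (j - 1) \<xi> - e j \<xi>) (\<lambda>\<xi>. g (real_of_int j + \<xi>)))"
    unfolding sum_subtractf[symmetric] by (intro sum.cong refl) (simp add: cell_ip_diff_left ce cg)
  also have "(\<lambda>j \<xi>. e (j - 1) \<xi> - e j \<xi>) = (\<lambda>j \<xi>. F' 0 (real_of_int j + \<xi> - \<alpha> * T) - poly (P2 j T) \<xi>)"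
    by (intro ext) (simp add: e_def F'_def P2_def algebra_simps)
  finally have parts: "(\<Sum>j\<in>{0..<int N}. cell_ip (e j) (\<lambda>\<xi>. fdiff g (real_of_int j + \<xi>)))
    = (\<Sum>j\<in>{0..<int N}. cell_ip (\<lambda>\<xi>. F' 0 (real_of_int j + \<xi> - \<alpha> * T) - poly (P2 j T) \<xi>) (\<lambda>\<xi>. g (real_of_int j + \<xi>)))" .
  have ini: "initial_projection k P2 (F' 0)"
    unfolding initial_projection_def
  proof (intro allI impI)
    fix j and q :: "real poly" assume q: "degree q \<le> k"
    define d where "d j \<xi> = F 0 (real_of_int j + \<xi>) - poly (P j 0) \<xi>" for j \<xi>
    have cd: "continuous_on {0..1} (d j)" for j
      unfolding d_def[abs_def]
      by (intro continuous_intros continuous_on_compose2[OF deriv_chain_continuous[OF F, of 0 UNIV]]) auto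
    have "cell_ip (\<lambda>\<xi>. d (j - 1) \<xi> - d j \<xi>) (poly q) = cell_ip (d (j - 1)) (poly q) - cell_ip (d j) (poly q)"
      by (intro cell_ip_diff_left cd continuous_intros)
    also have "\<dots> = 0"
      using Suc.prems(6)[unfolded initial_projection_def, rule_format, OF q, of "j - 1"]
        Suc.prems(6)[unfolded initial_projection_def, rule_format, OF q, of j]
      unfolding d_def[abs_def] by simp
    also have "(\<lambda>\<xi>. d (j - 1) \<xi> - d j \<xi>) = (\<lambda>\<xi>. F' 0 (real_of_int j + \<xi>) - poly (P2 j 0) \<xi>)"
      by (rule ext) (simp add: d_def F'_def P2_def algebra_simps)
    finally show "cell_ip (\<lambda>\<xi>. F' 0 (real_of_int j + \<xi>) - poly (P2 j 0) \<xi>) (poly q) = 0" .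
  qed
  have "\<bar>\<Sum>j\<in>{0..<int N}. cell_ip (\<lambda>\<xi>. F' 0 (real_of_int j + \<xi> - \<alpha> * T) - poly (P2 j T) \<xi>) (\<lambda>\<xi>. g (real_of_int j + \<xi>))\<bar>
    \<le> (1 + c + c * (1/2 + 2 * c\<^sup>2) * \<alpha> * T) * (m * sqrt (real N)) *
      sqrt (\<Sum>j\<in>{0..<int N}. cell_ip (\<lambda>\<xi>. G (Suc k) (real_of_int j + \<xi>)) (\<lambda>\<xi>. G (Suc k) (real_of_int j + \<xi>)))"
    unfolding g_def
  proof (rule Suc.IH)
    show "unit_dg k N \<alpha> T P2 (\<lambda>j t. P' (j - 1) t - P' j t)"
      unfolding P2_def[abs_def] by (rule backward_difference)
    show "deriv_chain (Suc k + l) F'"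
      unfolding F'_def[abs_def] by (rule deriv_chain_backward_difference[OF deriv_chain_le[OF F]]) simp
    fix i assume "i \<le> Suc k + l"
    then have "F i (x + real N) = F i x" for x
      using perF[of i] by (simp add: periodic_def)
    moreover have "x + real N - 1 = x - 1 + real N" for x
      by simp
    ultimately show "periodic (real N) (F' i)"
      unfolding F'_def[abs_def] periodic_def by (simp only: simp_thms)
  next
    fix x
    have "(F (Suc k + l) has_real_derivative F (Suc k + Suc l) y) (at y)" for y
      using deriv_chainD[OF F, of "Suc k + l" y] by simp
    then show "\<bar>F' (Suc k + l) x\<bar> \<le> m"
      unfolding F'_def by (rule backward_difference_bound[OF _ bF])
  next
    show "m > 0" by (rule Suc.prems(5))
    show "initial_projection k P2 (F' 0)" by (rule ini)
  qed
  then show ?case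
    unfolding parts[symmetric] by (simp add: e_def[abs_def] g_def)
qed

section \<open>The filtered error on a unit mesh\<close>

definition piecewise_poly :: "(int \<Rightarrow> real poly) \<Rightarrow> real \<Rightarrow> real" where
  "piecewise_poly Q x = poly (Q \<lfloor>x\<rfloor>) (x - of_int \<lfloor>x\<rfloor>)"

definition bounded_periodic :: "real \<Rightarrow> (real \<Rightarrow> real) \<Rightarrow> bool" where
  "bounded_periodic L g \<longleftrightarrow> g \<in> borel_measurable borel \<and> periodic L g \<and> (\<exists>B. \<forall>x. \<bar>g x\<bar> \<le> B)"

definition range_integral :: "(real \<Rightarrow> real) \<Rightarrow> real \<Rightarrow> real \<Rightarrow> real" where
  "range_integral g a b = (LBINT x. indicator {a..<b} x * g x)"

lemma periodic_int_multiple: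
  assumes "periodic L g"
  shows "g (x + of_int n * L) = g x"
proof -
  have nat: "g (x + real m * L) = g x" for x m
  proof (induction m)
    case (Suc m)
    have "g (x + real (Suc m) * L) = g ((x + real m * L) + L)"
      by (simp add: algebra_simps)
    then show ?case using assms Suc by (simp add: periodic_def)
  qed simp
  show ?thesis
  proof (cases "n \<ge> 0")
    case True
    then show ?thesis using nat[of x "nat n"] by simp
  next
    case False
    then show ?thesis using nat[of "x + of_int n * L" "nat (- n)"] by simp
  qed
qed

lemma periodic_continuous_bounded:
  fixes g :: "real \<Rightarrow> real"
  assumes L: "L > 0" and g: "continuous_on UNIV g" and per: "periodic L g"
  shows "\<exists>B>0. \<forall>x. \<bar>g x\<bar> \<le> B"
proof -
  obtain B where B: "\<And>x. \<bar>x\<bar> \<le> L \<Longrightarrow> \<bar>g x\<bar> \<le> B"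
    using continuous_bdd_on_bounded[OF g, of L] by auto
  have "\<bar>g x\<bar> \<le> \<bar>B\<bar> + 1" for x
  proof -
    define n where "n = \<lfloor>x / L\<rfloor>"
    have "real_of_int n \<le> x / L" "x / L < real_of_int n + 1"
      unfolding n_def by linarith+
    then have "\<bar>x - of_int n * L\<bar> \<le> L"
      using L by (auto simp: field_simps abs_le_iff)
    from B[OF this] show ?thesis
      using periodic_int_multiple[OF per, of "x - of_int n * L" n] by simp
  qed
  then show ?thesis by (intro exI[of _ "\<bar>B\<bar> + 1"]) auto
qed

lemma bounded_periodic_continuous:
  assumes "L > 0" "continuous_on UNIV g" "periodic L g"
  shows "bounded_periodic L g"
  using periodic_continuous_bounded[OF assms] assms
  by (auto simp: bounded_periodic_def intro: borel_measurable_continuous_onI)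

lemma bounded_periodic_mult:
  assumes "bounded_periodic L f" "bounded_periodic L g"
  shows "bounded_periodic L (\<lambda>x. f x * g x)"
proof -
  obtain A B where "\<And>x. \<bar>f x\<bar> \<le> A" "\<And>x. \<bar>g x\<bar> \<le> B"
    using assms unfolding bounded_periodic_def by auto
  then have "\<bar>f x * g x\<bar> \<le> A * B" for x
    unfolding abs_mult by (intro mult_mono') auto
  then show ?thesis
    using assms unfolding bounded_periodic_def periodic_def by auto
qed

lemma bounded_periodic_translate:
  assumes g: "bounded_periodic L g"
  shows "bounded_periodic L (\<lambda>x. g (x + c))"
proof -
  have [measurable]: "g \<in> borel_measurable borel"
    using g by (simp add: bounded_periodic_def)
  have "g (x + L + c) = g (x + c)" for x
    using g[unfolded bounded_periodic_def periodic_def, THEN conjunct2, THEN conjunct1, rule_format, of "x + c"]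
    by (simp add: algebra_simps)
  then show ?thesis
    using g unfolding bounded_periodic_def periodic_def by auto
qed

lemma range_integrable:
  assumes "bounded_periodic L g"
  shows "integrable lborel (\<lambda>x. indicator {a..<b} x * g x)"
proof -
  obtain B where "\<And>x. \<bar>g x\<bar> \<le> B" and "g \<in> borel_measurable borel"
    using assms unfolding bounded_periodic_def by auto
  then have "integrable lborel (\<lambda>x. indicator {a..<b} x *\<^sub>R g x)"
    by (intro integrableI_bounded_set_indicator[where B=B]) (auto, cases "a \<le> b", auto)
  then show ?thesis by simp
qed

lemma range_integral_combine:
  assumes "bounded_periodic L g" "a \<le> b" "b \<le> c"
  shows "range_integral g a c = range_integral g a b + range_integral g b c"
  unfolding range_integral_def
  by (subst Bochner_Integration.integral_add[symmetric], (rule range_integrable[OF assms(1)])+,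
      rule Bochner_Integration.integral_cong) (use assms in \<open>auto simp: indicator_def\<close>)

lemma range_integral_translate: "range_integral (\<lambda>x. g (x + c)) a b = range_integral g (a + c) (b + c)"
  unfolding range_integral_def
  by (subst (2) lborel_integral_real_affine[of 1 _ c])
     (auto simp: indicator_def add.commute intro!: Bochner_Integration.integral_cong)

text \<open>The interval is translated by a multiple of the period to start in \<open>[0, L]\<close>; the part that then sticks out
  beyond \<open>L\<close> is moved back by one period.\<close>

lemma range_integral_period:
  assumes L: "L > 0" and g: "bounded_periodic L g"
  shows "range_integral g s (s + L) = range_integral g 0 L"
proof -
  have per: "periodic L g" using g by (simp add: bounded_periodic_def)
  define n where "n = \<lfloor>s / L\<rfloor>"
  define r where "r = s - of_int n * L"
  have "real_of_int n \<le> s / L" "s / L < real_of_int n + 1"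
    unfolding n_def by linarith+
  then have r: "0 \<le> r" "r \<le> L"
    using L by (auto simp: field_simps r_def)
  have mult: "range_integral g a b = range_integral g (a + of_int n * L) (b + of_int n * L)" for a b n
    using range_integral_translate[of g "of_int n * L" a b] by (simp add: periodic_int_multiple[OF per])
  have "range_integral g s (s + L) = range_integral g r (r + L)"
    using mult[of r "r + L" n] by (simp add: r_def algebra_simps)
  also have "\<dots> = range_integral g r L + range_integral g L (r + L)"
    using r by (intro range_integral_combine[OF g]) auto
  also have "range_integral g L (r + L) = range_integral g 0 r"
    using mult[of 0 r 1] by simp
  also have "range_integral g r L + range_integral g 0 r = range_integral g 0 L"
    using range_integral_combine[OF g r] by simp
  finally show ?thesis .
qed

lemma range_integral_cells:
  assumes g: "bounded_periodic L g"
    and cells: "\<And>j. continuous_on {0..1} (G j)" "\<And>j \<xi>. 0 \<le> \<xi> \<Longrightarrow> \<xi> < 1 \<Longrightarrow> g (real_of_int j + \<xi>) = G j \<xi>"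
  shows "range_integral g 0 (real n) = (\<Sum>j\<in>{0..<int n}. integral {0..1} (G j))"
proof -
  have cell: "range_integral g (real_of_int j) (real_of_int j + 1) = integral {0..1} (G j)" for j
  proof -
    have "range_integral g (real_of_int j) (real_of_int j + 1) = range_integral (\<lambda>x. g (x + real_of_int j)) 0 1"
      by (simp add: range_integral_translate add.commute)
    also have "\<dots> = (LBINT x. indicator {0..1} x *\<^sub>R G j x)"
      unfolding range_integral_def
      by (rule integral_discrete_difference[where X="{1}"])
         (auto simp: indicator_def cells(2)[of _ j, symmetric] add.commute)
    also have "\<dots> = integral {0..1} (G j)"
      using set_borel_integral_eq_integral(2)[OF borel_integrable_atLeastAtMost'[OF cells(1)[of j]]]
      by (simp add: set_lebesgue_integral_def)
    finally show ?thesis .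
  qed
  show ?thesis
  proof (induction n)
    case 0
    show ?case by (simp add: range_integral_def)
  next
    case (Suc n)
    have "range_integral g 0 (real (Suc n)) = range_integral g 0 (real n) + range_integral g (real n) (real (Suc n))"
      by (rule range_integral_combine[OF g]) auto
    also have "range_integral g (real n) (real (Suc n)) = integral {0..1} (G (int n))"
      using cell[of "int n"] by (simp add: add.commute)
    also have "{0..<int (Suc n)} = insert (int n) {0..<int n}"
      by auto
    then have "range_integral g 0 (real n) + integral {0..1} (G (int n)) = (\<Sum>j\<in>{0..<int (Suc n)}. integral {0..1} (G j))"
      using Suc by simp
    finally show ?case .
  qed
qed

text \<open>The adjoint of the convolution with a B-spline: after exchanging the integrals, the inner one is translated
  using periodicity.\<close>

lemma spline_Fubini:
  assumes L: "L > 0" and e: "bounded_periodic L e" and w: "bounded_periodic L w"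
  shows "range_integral (\<lambda>x. spline_mean l (\<lambda>y. e (x - y)) * w x) 0 L
       = range_integral (\<lambda>x. e x * spline_mean l (\<lambda>y. w (x + y))) 0 L"
proof -
  have [measurable]: "e \<in> borel_measurable borel" "w \<in> borel_measurable borel"
    using e w by (auto simp: bounded_periodic_def)
  obtain A B C where A: "\<And>x. \<bar>e x\<bar> \<le> A" and B: "\<And>x. \<bar>w x\<bar> \<le> B" and C: "\<And>x. \<bar>bspline l x\<bar> \<le> C"
    using e w bspline_bounded[of l] by (auto simp: bounded_periodic_def)
  have A0: "A \<ge> 0" and B0: "B \<ge> 0" and C0: "C \<ge> 0"
    using order.trans[OF abs_ge_zero A] order.trans[OF abs_ge_zero B] order.trans[OF abs_ge_zero C] by auto
  have box: "integrable (lborel \<Otimes>\<^sub>M lborel) (\<lambda>(x, y). indicator {0..<L} x * (bspline l y * f x y))"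
    if [measurable]: "(\<lambda>(x, y). f x y) \<in> borel_measurable (borel \<Otimes>\<^sub>M borel)" and f: "\<And>x y. \<bar>f x y\<bar> \<le> A * B" for f
  proof (rule integrableI_bounded_set[where A="{0..<L} \<times> {-real l/2..real l/2}" and B="C * (A * B)"])
    show "(\<lambda>(x, y). indicator {0..<L} x * (bspline l y * f x y)) \<in> borel_measurable (lborel \<Otimes>\<^sub>M lborel)"
      by measurable
    show "emeasure (lborel \<Otimes>\<^sub>M lborel) ({0..<L} \<times> {-real l/2..real l/2}) < \<infinity>"
      using L by (subst lborel.emeasure_pair_measure_Times) (auto simp: ennreal_mult_less_top)
    show "AE p in lborel \<Otimes>\<^sub>M lborel. p \<in> {0..<L} \<times> {-real l/2..real l/2} \<longrightarrow>
        norm (case p of (x, y) \<Rightarrow> indicator {0..<L} x * (bspline l y * f x y)) \<le> C * (A * B)"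
      using mult_mono'[OF C f] by (intro AE_I2) (auto simp: abs_mult indicator_def)
    show "AE p in lborel \<Otimes>\<^sub>M lborel. p \<notin> {0..<L} \<times> {-real l/2..real l/2} \<longrightarrow>
        (case p of (x, y) \<Rightarrow> indicator {0..<L} x * (bspline l y * f x y)) = 0"
    proof (intro AE_I2 impI)
      fix p :: "real \<times> real" assume p: "p \<notin> {0..<L} \<times> {-real l/2..real l/2}"
      obtain x y where xy: "p = (x, y)" by (cases p)
      then have "x \<notin> {0..<L} \<or> \<bar>y\<bar> > real l / 2"
        using p by auto
      then show "(case p of (x, y) \<Rightarrow> indicator {0..<L} x * (bspline l y * f x y)) = 0"
        using bspline_eq_0[of l y] by (auto simp: xy)
    qed
  qed auto
  have swap: "(LBINT x. LBINT y. indicator {0..<L} x * (bspline l y * f x y)) = (LBINT y. bspline l y * range_integral (\<lambda>x. f x y) 0 L)"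
    if "(\<lambda>(x, y). f x y) \<in> borel_measurable (borel \<Otimes>\<^sub>M borel)" and "\<And>x y. \<bar>f x y\<bar> \<le> A * B" for f
    unfolding lborel_pair.Fubini_integral[OF box[OF that], symmetric] range_integral_def
    by (simp add: mult.left_commute[of "indicator _ _" "bspline l _"])
  have f1: "\<bar>e (x - y) * w x\<bar> \<le> A * B" and f2: "\<bar>e x * w (x + y)\<bar> \<le> A * B" for x y
    unfolding abs_mult using A B by (auto intro!: mult_mono')
  have shift: "range_integral (\<lambda>x. e (x - y) * w x) 0 L = range_integral (\<lambda>x. e x * w (x + y)) 0 L" for y
  proof -
    have bp: "bounded_periodic L (\<lambda>x. e x * w (x + y))"
      by (intro bounded_periodic_mult e bounded_periodic_translate w)
    have "range_integral (\<lambda>x. e (x - y) * w x) 0 L = range_integral (\<lambda>x. e x * w (x + y)) (- y) (- y + L)"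
      using range_integral_translate[of "\<lambda>x. e x * w (x + y)" "- y" 0 L] by (simp add: add.commute)
    then show ?thesis
      by (simp only: range_integral_period[OF L bp])
  qed
  have "range_integral (\<lambda>x. spline_mean l (\<lambda>y. e (x - y)) * w x) 0 L
      = (LBINT x. LBINT y. indicator {0..<L} x * (bspline l y * (e (x - y) * w x)))"
    unfolding range_integral_def spline_mean_def
    by (simp add: mult_ac flip: integral_mult_right_zero)
  also have "\<dots> = (LBINT y. bspline l y * range_integral (\<lambda>x. e x * w (x + y)) 0 L)"
    by (subst swap[OF _ f1]) (simp_all add: shift)
  also have "\<dots> = (LBINT x. LBINT y. indicator {0..<L} x * (bspline l y * (e x * w (x + y))))"
    by (subst swap[OF _ f2]) simp_all
  also have "\<dots> = range_integral (\<lambda>x. e x * spline_mean l (\<lambda>y. w (x + y))) 0 L"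
    unfolding range_integral_def spline_mean_def
    by (simp add: mult_ac flip: integral_mult_right_zero)
  finally show ?thesis .
qed

text \<open>For each \<open>x\<close> the integrand is continuous in \<open>x\<close> for almost every \<open>y\<close>, and dominated convergence applies.\<close>

lemma spline_mean_continuous:
  assumes [measurable]: "e \<in> borel_measurable borel" and B: "\<And>x. \<bar>e x\<bar> \<le> B"
    and cont: "\<And>x. x \<notin> \<int> \<Longrightarrow> isCont e x"
  shows "continuous_on UNIV (\<lambda>x. spline_mean l (\<lambda>y. e (x - y)))"
proof (intro continuous_at_imp_continuous_on ballI)
  fix x :: real
  show "isCont (\<lambda>x. spline_mean l (\<lambda>y. e (x - y))) x"
    unfolding continuous_at_sequentially o_def spline_mean_def
  proof (intro allI impI)
    fix X :: "nat \<Rightarrow> real" assume X: "X \<longlonglongrightarrow> x"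
    have null: "AE y in lborel. y \<notin> (\<lambda>n. x - of_int n) ` UNIV"
      by (intro AE_not_in countable_imp_null_set_lborel) simp
    show "(\<lambda>n. LBINT y. bspline l y * e (X n - y)) \<longlonglongrightarrow> (LBINT y. bspline l y * e (x - y))"
    proof (rule integral_dominated_convergence[where w="\<lambda>y. \<bar>bspline l y * B\<bar>"])
      show "integrable lborel (\<lambda>y. \<bar>bspline l y * B\<bar>)"
        by (intro integrable_abs bspline_continuous_integrable continuous_intros)
      show "AE y in lborel. (\<lambda>n. bspline l y * e (X n - y)) \<longlonglongrightarrow> bspline l y * e (x - y)"
        using null
      proof eventually_elim
        case (elim y)
        have "x - y \<notin> \<int>"
        proof
          assume "x - y \<in> \<int>"
          then obtain n where "x - y = of_int n" by (auto elim: Ints_cases)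
          then have "y = x - of_int n" by simp
          with elim show False by blast
        qed
        then have "(\<lambda>n. e (X n - y)) \<longlonglongrightarrow> e (x - y)"
          by (intro isCont_tendsto_compose[OF cont] tendsto_intros X)
        then show ?case by (intro tendsto_intros)
      qed
      show "AE y in lborel. norm (bspline l y * e (X n - y)) \<le> \<bar>bspline l y * B\<bar>" for n
        using B by (intro AE_I2) (auto simp: abs_mult intro!: mult_left_mono order.trans[OF B])
    qed measurable
  qed
qed


lemma abs_poly_unit_interval_le:
  assumes "0 \<le> \<xi>" "\<xi> \<le> 1"
  shows "\<bar>poly p \<xi>\<bar> \<le> (\<Sum>i\<le>degree p. \<bar>coeff p i :: real\<bar>)"
proof -
  have "\<bar>poly p \<xi>\<bar> \<le> (\<Sum>i\<le>degree p. \<bar>coeff p i\<bar> * \<xi> ^ i)"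
    unfolding poly_altdef by (rule order.trans[OF sum_abs]) (use assms in \<open>simp add: abs_mult\<close>)
  also have "\<dots> \<le> (\<Sum>i\<le>degree p. \<bar>coeff p i\<bar> * 1)"
    using assms by (intro sum_mono mult_left_mono power_le_one) auto
  finally show ?thesis by simp
qed

lemma piecewise_poly_cell:
  assumes "0 \<le> \<xi>" "\<xi> < 1"
  shows "piecewise_poly Q (real_of_int j + \<xi>) = poly (Q j) \<xi>"
proof -
  have "\<lfloor>real_of_int j + \<xi>\<rfloor> = j"
    using assms by (simp add: floor_eq_iff)
  then show ?thesis by (simp add: piecewise_poly_def)
qed

lemma bounded_periodic_piecewise_poly:
  assumes N: "N \<ge> 1" and per: "\<And>j. Q (j + int N) = Q j"
  shows "bounded_periodic (real N) (piecewise_poly Q)"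
proof -
  have meas: "piecewise_poly Q \<in> borel_measurable borel"
  proof -
    have "(\<lambda>x. poly (Q i) (x - real_of_int i)) \<in> borel_measurable borel" for i
      by (intro borel_measurable_continuous_onI continuous_intros)
    then have "(\<lambda>x. poly (Q \<lfloor>x\<rfloor>) (x - real_of_int \<lfloor>x\<rfloor>)) \<in> borel_measurable borel"
      by (rule measurable_compose_countable) measurable
    then show ?thesis by (simp add: piecewise_poly_def[abs_def])
  qed
  have period: "periodic (real N) (piecewise_poly Q)"
    unfolding periodic_def piecewise_poly_def
  proof
    fix x
    have "\<lfloor>x + real N\<rfloor> = \<lfloor>x\<rfloor> + int N"
      by (metis floor_add_int of_int_of_nat_eq)
    then show "poly (Q \<lfloor>x + real N\<rfloor>) (x + real N - of_int \<lfloor>x + real N\<rfloor>) = poly (Q \<lfloor>x\<rfloor>) (x - of_int \<lfloor>x\<rfloor>)"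
      by (simp add: per)
  qed
  define b where "b j = (\<Sum>i\<le>degree (Q j). \<bar>coeff (Q j) i\<bar>)" for j
  have "\<bar>piecewise_poly Q x\<bar> \<le> (\<Sum>j\<in>{0..<int N}. b j)" for x
  proof -
    define n where "n = \<lfloor>x / real N\<rfloor>"
    define y where "y = x - of_int n * real N"
    have "real_of_int n \<le> x / real N" "x / real N < real_of_int n + 1"
      unfolding n_def by linarith+
    then have y: "0 \<le> y" "y < real N"
      using N by (auto simp: field_simps y_def)
    have fl: "\<lfloor>y\<rfloor> \<in> {0..<int N}"
      using y by (simp add: floor_less_iff)
    have "piecewise_poly Q x = piecewise_poly Q y"
      using periodic_int_multiple[OF period, of y n] by (simp add: y_def)
    also have "\<bar>\<dots>\<bar> \<le> b \<lfloor>y\<rfloor>"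
      unfolding piecewise_poly_def b_def
      by (rule abs_poly_unit_interval_le) linarith+
    also have "\<dots> \<le> (\<Sum>j\<in>{0..<int N}. b j)"
      by (rule member_le_sum[OF fl]) (simp_all add: b_def sum_nonneg)
    finally show ?thesis .
  qed
  then show ?thesis
    using meas period by (auto simp: bounded_periodic_def)
qed

lemma piecewise_poly_isCont:
  assumes "x \<notin> \<int>"
  shows "isCont (piecewise_poly Q) x"
proof -
  let ?j = "\<lfloor>x\<rfloor>"
  have x: "x \<in> {of_int ?j<..<of_int ?j + 1}"
  proof -
    have "x \<noteq> of_int ?j"
      using assms Ints_of_int by metis
    then have "of_int ?j < x" "x < of_int ?j + 1"
      by linarith+
    then show ?thesis by simp
  qed
  have "\<forall>\<^sub>F y in nhds x. y \<in> {of_int ?j<..<of_int ?j + 1}"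
    by (rule eventually_nhds_in_open[OF open_greaterThanLessThan x])
  then have ev: "\<forall>\<^sub>F y in nhds x. piecewise_poly Q y = poly (Q ?j) (y - of_int ?j)"
  proof eventually_elim
    case (elim y)
    then have "\<lfloor>y\<rfloor> = ?j" by (simp add: floor_eq_iff)
    then show ?case by (simp add: piecewise_poly_def)
  qed
  have "isCont (\<lambda>y. poly (Q ?j) (y - of_int ?j)) x"
    by (intro continuous_intros)
  then show ?thesis
    using isCont_cong[OF ev] by simp
qed

text \<open>A periodic function of mean zero has a periodic antiderivative, and the free constant is used to make its
  mean zero again.\<close>

lemma periodic_antiderivative_chain:
  assumes N: "N \<ge> 1" and "continuous_on UNIV v" and "periodic (real N) v"
    and "(\<Sum>j\<in>{0..<int N}. integral {0..1} (\<lambda>\<xi>. v (real_of_int j + \<xi>))) = 0"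
  shows "\<exists>G. deriv_chain n G \<and> G n = v \<and> (\<forall>i\<le>n. periodic (real N) (G i))"
  using assms(2-4)
proof (induction n arbitrary: v)
  case 0
  then show ?case by (intro exI[of _ "\<lambda>_. v"]) (simp add: deriv_chain_def)
next
  case (Suc n)
  obtain H where H: "\<And>x. (H has_real_derivative v x) (at x)"
    using antiderivative_exists[OF Suc.prems(1)] by auto
  have cH: "continuous_on UNIV H"
    using H by (auto intro!: continuous_at_imp_continuous_on DERIV_isCont)
  define c where "c = (\<Sum>j\<in>{0..<int N}. integral {0..1} (\<lambda>\<xi>. H (real_of_int j + \<xi>))) / real N"
  define K where "K x = H x - c" for x
  have K: "(K has_real_derivative v x) (at x)" for x
    unfolding K_def[abs_def] using DERIV_diff[OF H[of x] DERIV_const[of c]] by simp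
  have cK: "continuous_on UNIV K"
    unfolding K_def[abs_def] by (intro continuous_intros cH)
  have perK: "periodic (real N) K"
  proof -
    define D where "D x = K (x + real N) - K x" for x
    have "(D has_real_derivative v (x + real N) * 1 - v x) (at x)" for x
      unfolding D_def by (intro DERIV_diff K DERIV_chain2[OF K]) (auto intro!: derivative_eq_intros)
    then have "\<forall>x. (D has_real_derivative 0) (at x)"
      using Suc.prems(2) by (simp add: periodic_def)
    then have "D x = D 0" for x
      by (rule DERIV_isconst_all)
    moreover have "D 0 = 0"
      using cell_sum_FTC[of K v N, OF K] Suc.prems(3) by (simp add: D_def)
    ultimately show ?thesis by (simp add: D_def periodic_def)
  qed
  have "integral {0..1} (\<lambda>\<xi>. K (real_of_int j + \<xi>)) = integral {0..1} (\<lambda>\<xi>. H (real_of_int j + \<xi>)) - c" for j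
  proof -
    have "(\<lambda>\<xi>. H (real_of_int j + \<xi>)) integrable_on {0..1}"
      by (intro integrable_continuous_interval continuous_on_compose2[OF cH] continuous_intros) auto
    then show ?thesis
      unfolding K_def by (subst Henstock_Kurzweil_Integration.integral_diff) auto
  qed
  then have "(\<Sum>j\<in>{0..<int N}. integral {0..1} (\<lambda>\<xi>. K (real_of_int j + \<xi>))) = 0"
    using N by (simp add: sum_subtractf c_def)
  from Suc.IH[OF cK perK this] obtain G
    where G: "deriv_chain n G" "G n = K" "\<forall>i\<le>n. periodic (real N) (G i)"
    by (elim exE conjE)
  define G' where "G' i = (if i \<le> n then G i else v)" for i
  have "deriv_chain (Suc n) G'"
    unfolding deriv_chain_def
  proof (intro conjI allI impI)
    fix i x assume "i < Suc n"
    then consider "i < n" | "i = n" by linarith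
    then show "(G' i has_real_derivative G' (Suc i) x) (at x)"
      by cases (simp_all add: G'_def deriv_chainD[OF G(1)] G(2) K)
  qed (simp add: G'_def Suc.prems(1))
  moreover have "G' (Suc n) = v" by (simp add: G'_def)
  moreover have "\<forall>i\<le>Suc n. periodic (real N) (G' i)"
    using G(3) Suc.prems(2) by (simp add: G'_def)
  ultimately show ?case by blast
qed

text \<open>The duality argument for the filtered error \<open>v\<close>.  The mean of \<open>v\<close> vanishes because the weak estimate,
  applied to the constant test function \<open>1\<close>, bounds the mean of the error by zero.\<close>

lemma filtered_error_estimate:
  assumes dg: "unit_dg k N \<alpha> T P P'"
    and F: "deriv_chain (2 * k + 2) F" and perF: "\<And>i. i \<le> 2 * k + 2 \<Longrightarrow> periodic (real N) (F i)"
    and bF: "\<And>x. \<bar>F (2 * k + 2) x\<bar> \<le> m" and m: "m > 0"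
    and init: "initial_projection k P (F 0)" and const: "projection_constant k c"
  defines "v \<equiv> \<lambda>x. spline_mean (k + 1) (\<lambda>y. F 0 (x - y - \<alpha> * T) - piecewise_poly (\<lambda>j. P j T) (x - y))"
  shows "continuous_on UNIV v" and "periodic (real N) v"
    and "range_integral (\<lambda>x. (v x)\<^sup>2) 0 (real N) \<le> ((1 + c + c * (1/2 + 2 * c\<^sup>2) * \<alpha> * T) * (m * sqrt (real N)))\<^sup>2"
proof -
  interpret unit_dg k N \<alpha> T P P' by (rule dg)
  have TT: "T \<in> {0..T}" using T by simp
  have NL: "real N > 0" using N by simp
  define e where "e x = F 0 (x - \<alpha> * T) - piecewise_poly (\<lambda>j. P j T) x" for x
  have v: "v x = spline_mean (k + 1) (\<lambda>y. e (x - y))" for x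
    by (simp add: v_def e_def)
  have cF0: "continuous_on UNIV (F 0)"
    by (rule deriv_chain_continuous[OF F]) simp
  have cF: "continuous_on S (\<lambda>x. F 0 (x - \<alpha> * T))" for S
    by (intro continuous_on_compose2[OF cF0] continuous_intros) auto
  have "periodic (real N) (\<lambda>x. F 0 (x - \<alpha> * T))"
    using perF[of 0] by (simp add: periodic_def diff_add_eq[symmetric])
  then have b1: "bounded_periodic (real N) (\<lambda>x. F 0 (x - \<alpha> * T))"
    by (intro bounded_periodic_continuous NL cF)
  have b2: "bounded_periodic (real N) (piecewise_poly (\<lambda>j. P j T))"
    by (rule bounded_periodic_piecewise_poly[OF N]) (rule per[OF TT])
  have e: "bounded_periodic (real N) e"
  proof -
    obtain A B where "\<And>x. \<bar>F 0 (x - \<alpha> * T)\<bar> \<le> A" "\<And>x. \<bar>piecewise_poly (\<lambda>j. P j T) x\<bar> \<le> B"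
      using b1 b2 unfolding bounded_periodic_def by auto
    then have "\<bar>e x\<bar> \<le> A + B" for x
      unfolding e_def by (intro order.trans[OF abs_triangle_ineq4] add_mono)
    then show ?thesis
      using b1 b2 unfolding bounded_periodic_def periodic_def e_def[abs_def] by auto
  qed
  show cv: "continuous_on UNIV v"
  proof -
    obtain B where "\<And>x. \<bar>e x\<bar> \<le> B" "e \<in> borel_measurable borel"
      using e unfolding bounded_periodic_def by auto
    moreover have "isCont e x" if "x \<notin> \<int>" for x
      unfolding e_def[abs_def] using cF[of UNIV]
      by (intro continuous_diff piecewise_poly_isCont[OF that]) (simp add: continuous_on_eq_continuous_at)
    ultimately show ?thesis
      unfolding v[abs_def] by (intro spline_mean_continuous[where B=B])
  qed
  show perv: "periodic (real N) v"
    unfolding periodic_def v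
  proof
    fix x
    have "e (x + real N - y) = e (x - y)" for y
      using e[unfolded bounded_periodic_def periodic_def, THEN conjunct2, THEN conjunct1, rule_format, of "x - y"]
      by (simp add: algebra_simps)
    then show "spline_mean (k + 1) (\<lambda>y. e (x + real N - y)) = spline_mean (k + 1) (\<lambda>y. e (x - y))"
      by simp
  qed
  have bv: "bounded_periodic (real N) v"
    by (intro bounded_periodic_continuous NL cv perv)
  have e_cell: "e (real_of_int j + \<xi>) = F 0 (real_of_int j + \<xi> - \<alpha> * T) - poly (P j T) \<xi>" if "0 \<le> \<xi>" "\<xi> < 1" for j \<xi>
    using that by (simp add: e_def piecewise_poly_cell)
  have ce: "continuous_on {0..1} (\<lambda>\<xi>. F 0 (real_of_int j + \<xi> - \<alpha> * T) - poly (P j T) \<xi>)" for j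
    by (intro continuous_intros translated_continuous cF0)
  have e_pair: "range_integral (\<lambda>x. e x * w x) 0 (real N) = (\<Sum>j\<in>{0..<int N}.
      cell_ip (\<lambda>\<xi>. F 0 (real_of_int j + \<xi> - \<alpha> * T) - poly (P j T) \<xi>) (\<lambda>\<xi>. w (real_of_int j + \<xi>)))"
    if w: "continuous_on UNIV w" "periodic (real N) w" for w
    unfolding cell_ip_def
  proof (rule range_integral_cells)
    show "bounded_periodic (real N) (\<lambda>x. e x * w x)"
      by (intro bounded_periodic_mult e bounded_periodic_continuous NL w)
    show "continuous_on {0..1} (\<lambda>\<xi>. (F 0 (real_of_int j + \<xi> - \<alpha> * T) - poly (P j T) \<xi>) * w (real_of_int j + \<xi>))" for j
      by (intro continuous_on_mult ce continuous_on_compose2[OF w(1)] continuous_intros) auto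
  qed (simp add: e_cell)
  have c_sum: "range_integral g 0 (real N) = (\<Sum>j\<in>{0..<int N}. integral {0..1} (\<lambda>\<xi>. g (real_of_int j + \<xi>)))"
    if g: "continuous_on UNIV g" "periodic (real N) g" for g
    by (rule range_integral_cells[OF bounded_periodic_continuous[OF NL g]])
       (auto intro!: continuous_on_compose2[OF g(1)] continuous_intros)
  have mean_v: "(\<Sum>j\<in>{0..<int N}. integral {0..1} (\<lambda>\<xi>. v (real_of_int j + \<xi>))) = 0"
  proof -
    \<comment> \<open>The constant test function with its derivatives.\<close>
    define G where "G i x = (if i = 0 then 1 else 0 :: real)" for i :: nat and x :: real
    have G: "deriv_chain (Suc k) G"
      by (auto simp: deriv_chain_def G_def[abs_def])
    have perG: "periodic (real N) (G i)" for i
      by (simp add: periodic_def G_def)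
    obtain M where M: "M > 0" "\<forall>x. \<bar>F (Suc k) x\<bar> \<le> M"
      using periodic_continuous_bounded[OF NL deriv_chain_continuous[OF F, of "Suc k"] perF[of "Suc k"]] by auto
    have "\<bar>\<Sum>j\<in>{0..<int N}. cell_ip (\<lambda>\<xi>. F 0 (real_of_int j + \<xi> - \<alpha> * T) - poly (P j T) \<xi>)
      (\<lambda>\<xi>. (fdiff ^^ 0) (G 0) (real_of_int j + \<xi>))\<bar>
      \<le> (1 + c + c * (1/2 + 2 * c\<^sup>2) * \<alpha> * T) * (M * sqrt (real N)) *
        sqrt (\<Sum>j\<in>{0..<int N}. cell_ip (\<lambda>\<xi>. G (Suc k) (real_of_int j + \<xi>)) (\<lambda>\<xi>. G (Suc k) (real_of_int j + \<xi>)))"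
      by (rule weak_error_estimate_differences[where P=P and P'=P' and F=F and G=G and l=0 and m=M])
         (use M perF dg init G perG const deriv_chain_le[OF F] in simp_all)
    then have "range_integral (\<lambda>x. e x * 1) 0 (real N) = 0"
      by (subst e_pair) (auto simp: periodic_def G_def cell_ip_def)
    moreover have "range_integral (\<lambda>x. v x * 1) 0 (real N) = range_integral (\<lambda>x. e x * spline_mean (k + 1) (\<lambda>y. 1)) 0 (real N)"
      unfolding v by (rule spline_Fubini[OF NL e]) (intro bounded_periodic_continuous NL, simp_all add: periodic_def)
    ultimately show ?thesis
      using c_sum[OF cv perv] by (simp add: spline_mean_one)
  qed
  obtain G where G: "deriv_chain (k + 1) G" "G (k + 1) = v" "\<forall>i\<le>k + 1. periodic (real N) (G i)"
    using periodic_antiderivative_chain[OF N cv perv mean_v, of "k + 1"] by (elim exE conjE)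
  \<comment> \<open>The difference operator is a forward one, while the B-spline is centred.\<close>
  define K where "K i x = G i (- (real (k + 1) / 2) + x)" for i x
  have K: "deriv_chain (k + 1) K"
    unfolding K_def[abs_def] by (rule deriv_chain_translate[OF G(1)])
  have perK: "periodic (real N) (K i)" if "i \<le> k + 1" for i
    using G(3) that unfolding K_def[abs_def] periodic_def by (simp add: add.assoc[symmetric])
  have diffs: "spline_mean (k + 1) (\<lambda>y. v (x + y)) = (fdiff ^^ (k + 1)) (K 0) x" for x
    using spline_mean_deriv_chain[of k K "x + real (k + 1) / 2"] K by (simp add: K_def G(2)[simplified] add_ac)
  define S2 where "S2 = range_integral (\<lambda>x. (v x)\<^sup>2) 0 (real N)"
  have S2: "S2 = (\<Sum>j\<in>{0..<int N}. cell_ip (\<lambda>\<xi>. v (real_of_int j + \<xi>)) (\<lambda>\<xi>. v (real_of_int j + \<xi>)))"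
    unfolding S2_def using perv
    by (subst c_sum) (auto simp: periodic_def cell_ip_def power2_eq_square intro!: continuous_intros cv)
  have S2_nonneg: "S2 \<ge> 0"
    unfolding S2 by (intro sum_nonneg cell_ip_self_nonneg)
  have KS: "(\<Sum>j\<in>{0..<int N}. cell_ip (\<lambda>\<xi>. K (Suc k) (real_of_int j + \<xi>)) (\<lambda>\<xi>. K (Suc k) (real_of_int j + \<xi>))) = S2"
    unfolding S2 using cell_sum_translation[of "\<lambda>x. v x * v x" N "- (real (k + 1) / 2)"] cv perv
    by (simp add: K_def G(2)[simplified] cell_ip_def periodic_def continuous_on_mult add_ac)
  have "S2 = range_integral (\<lambda>x. v x * v x) 0 (real N)"
    by (simp add: S2_def power2_eq_square)
  also have "\<dots> = range_integral (\<lambda>x. e x * spline_mean (k + 1) (\<lambda>y. v (x + y))) 0 (real N)"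
    by (subst (1) v) (rule spline_Fubini[OF NL e bv])
  also have "\<dots> = range_integral (\<lambda>x. e x * (fdiff ^^ (k + 1)) (K 0) x) 0 (real N)"
    unfolding diffs ..
  also have "\<dots> \<le> (1 + c + c * (1/2 + 2 * c\<^sup>2) * \<alpha> * T) * (m * sqrt (real N)) * sqrt S2"
  proof -
    have "range_integral (\<lambda>x. e x * (fdiff ^^ (k + 1)) (K 0) x) 0 (real N)
      = (\<Sum>j\<in>{0..<int N}. cell_ip (\<lambda>\<xi>. F 0 (real_of_int j + \<xi> - \<alpha> * T) - poly (P j T) \<xi>)
          (\<lambda>\<xi>. (fdiff ^^ (k + 1)) (K 0) (real_of_int j + \<xi>)))"
      by (intro e_pair continuous_funpow_fdiff periodic_funpow_fdiff perK deriv_chain_continuous[OF K]) simp_all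
    also have "\<dots> \<le> \<bar>\<dots>\<bar>" by simp
    also have "\<dots> \<le> (1 + c + c * (1/2 + 2 * c\<^sup>2) * \<alpha> * T) * (m * sqrt (real N)) * sqrt S2"
      unfolding KS[symmetric]
      by (rule weak_error_estimate_differences[where P=P and P'=P' and F=F and G=K and l="k + 1" and m=m])
         (use K F perF bF m perK dg init const in \<open>simp_all add: mult_2\<close>)
    finally show ?thesis .
  qed
  finally have main: "sqrt S2 * sqrt S2 \<le> (1 + c + c * (1/2 + 2 * c\<^sup>2) * \<alpha> * T) * (m * sqrt (real N)) * sqrt S2"
    using S2_nonneg by simp
  have c: "c > 0" using const by (simp add: projection_constant_def)
  have "sqrt S2 \<le> (1 + c + c * (1/2 + 2 * c\<^sup>2) * \<alpha> * T) * (m * sqrt (real N))"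
  proof (cases "S2 = 0")
    case True
    then show ?thesis using c m \<alpha> T by simp
  next
    case False
    then have "sqrt S2 > 0" using S2_nonneg by simp
    then show ?thesis using main by (rule mult_right_le_imp_le[rotated])
  qed
  then have "(sqrt S2)\<^sup>2 \<le> ((1 + c + c * (1/2 + 2 * c\<^sup>2) * \<alpha> * T) * (m * sqrt (real N)))\<^sup>2"
    using S2_nonneg by (intro power_mono) simp_all
  then show "range_integral (\<lambda>x. (v x)\<^sup>2) 0 (real N) \<le> ((1 + c + c * (1/2 + 2 * c\<^sup>2) * \<alpha> * T) * (m * sqrt (real N)))\<^sup>2"
    using S2_nonneg by (simp add: S2_def)
qed

section \<open>Transport to a unit mesh\<close>

lemma cell_change_of_variables:
  fixes h :: real
  assumes h: "h > 0" and f: "\<And>\<xi>. 0 < \<xi> \<Longrightarrow> \<xi> < 1 \<Longrightarrow> f (a0 + h * (m + \<xi>)) = g \<xi>"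
    and g: "continuous_on {0..1} g"
  shows "(LBINT x:{a0 + h * m..a0 + h * (m + 1)}. f x) = h * integral {0..1} g"
proof -
  have "(LBINT x:{a0 + h * m..a0 + h * (m + 1)}. f x)
      = h * (LBINT \<xi>. indicator {a0 + h * m..a0 + h * (m + 1)} (a0 + h * m + h * \<xi>) *\<^sub>R f (a0 + h * m + h * \<xi>))"
    unfolding set_lebesgue_integral_def
    using h by (subst lborel_integral_real_affine[of h _ "a0 + h * m"]) simp_all
  also have "(LBINT \<xi>. indicator {a0 + h * m..a0 + h * (m + 1)} (a0 + h * m + h * \<xi>) *\<^sub>R f (a0 + h * m + h * \<xi>))
      = (LBINT \<xi>. indicator {0..1} \<xi> *\<^sub>R g \<xi>)"
  proof (rule integral_discrete_difference[where X="{0, 1}"])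
    fix \<xi> :: real assume "\<xi> \<notin> {0, 1}"
    have "a0 + h * m + h * \<xi> \<in> {a0 + h * m..a0 + h * (m + 1)} \<longleftrightarrow> \<xi> \<in> {0..1}"
      using h by (auto simp: algebra_simps zero_le_mult_iff mult_le_cancel_left1)
    then show "indicator {a0 + h * m..a0 + h * (m + 1)} (a0 + h * m + h * \<xi>) *\<^sub>R f (a0 + h * m + h * \<xi>)
        = indicator {0..1} \<xi> *\<^sub>R g \<xi>"
      using f[of \<xi>] \<open>\<xi> \<notin> {0, 1}\<close> by (auto simp: indicator_def distrib_left add.assoc)
  qed auto
  also have "\<dots> = integral {0..1} g"
    using set_borel_integral_eq_integral(2)[OF borel_integrable_atLeastAtMost'[OF g]]
    by (simp add: set_lebesgue_integral_def)
  finally show ?thesis .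
qed

lemma cell_traces:
  fixes h :: real
  assumes h: "h > 0" and f: "\<And>\<xi>. 0 < \<xi> \<Longrightarrow> \<xi> < 1 \<Longrightarrow> f (a0 + h * (m + \<xi>)) = poly p \<xi>"
  shows "left_trace f (a0 + h * (m + 1)) = poly p 1" and "right_trace f (a0 + h * m) = poly p 0"
proof -
  define q where "q x = poly p ((x - a0) / h - m)" for x
  have fq: "f x = q x" if "a0 + h * m < x" "x < a0 + h * (m + 1)" for x
  proof -
    have "0 < (x - a0) / h - m" "(x - a0) / h - m < 1"
      using that h by (auto simp: field_simps)
    moreover have "a0 + h * (m + ((x - a0) / h - m)) = x"
      using h by simp
    ultimately show ?thesis
      using f[of "(x - a0) / h - m"] by (simp add: q_def)
  qed
  have less: "a0 + h * m < a0 + h * (m + 1)"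
    using h by (simp add: distrib_left)
  have cq: "isCont q x" for x
    unfolding q_def[abs_def] using h by (intro continuous_intros) auto
  have "(f \<longlongrightarrow> q (a0 + h * (m + 1))) (at_left (a0 + h * (m + 1)))"
  proof (rule Lim_transform_eventually)
    show "(q \<longlongrightarrow> q (a0 + h * (m + 1))) (at_left (a0 + h * (m + 1)))"
      using cq isCont_def filterlim_at_split by blast
    show "\<forall>\<^sub>F x in at_left (a0 + h * (m + 1)). q x = f x"
      using fq by (intro eventually_at_leftI[OF _ less]) auto
  qed
  then show "left_trace f (a0 + h * (m + 1)) = poly p 1"
    unfolding left_trace_def using h by (subst tendsto_Lim) (auto simp: q_def)
  have "(f \<longlongrightarrow> q (a0 + h * m)) (at_right (a0 + h * m))"
  proof (rule Lim_transform_eventually)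
    show "(q \<longlongrightarrow> q (a0 + h * m)) (at_right (a0 + h * m))"
      using cq isCont_def filterlim_at_split by blast
    show "\<forall>\<^sub>F x in at_right (a0 + h * m). q x = f x"
      using fq by (intro eventually_at_rightI[OF _ less]) auto
  qed
  then show "right_trace f (a0 + h * m) = poly p 0"
    unfolding right_trace_def using h by (subst tendsto_Lim) (auto simp: q_def)
qed

lemma cell_deriv:
  fixes h :: real
  assumes h: "h > 0" and f: "\<And>\<xi>. 0 < \<xi> \<Longrightarrow> \<xi> < 1 \<Longrightarrow> f (a0 + h * (m + \<xi>)) = poly p \<xi>"
    and \<xi>: "0 < \<xi>" "\<xi> < 1"
  shows "deriv f (a0 + h * (m + \<xi>)) = poly (pderiv p) \<xi> / h"
proof -
  let ?x = "a0 + h * (m + \<xi>)"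
  define q where "q x = poly p ((x - a0) / h - m)" for x
  have "?x \<in> {a0 + h * m<..<a0 + h * (m + 1)}"
    using h \<xi> by simp
  then have "\<forall>\<^sub>F x in nhds ?x. x \<in> {a0 + h * m<..<a0 + h * (m + 1)}"
    by (rule eventually_nhds_in_open[OF open_greaterThanLessThan])
  then have ev: "\<forall>\<^sub>F x in nhds ?x. f x = q x"
  proof eventually_elim
    case (elim x)
    then have "0 < (x - a0) / h - m" "(x - a0) / h - m < 1"
      using h by (auto simp: field_simps)
    moreover have "a0 + h * (m + ((x - a0) / h - m)) = x"
      using h by simp
    ultimately show ?case
      using f[of "(x - a0) / h - m"] by (simp add: q_def)
  qed
  have "((\<lambda>x. (x - a0) / h - m) has_real_derivative 1 / h) (at ?x)"
    using h by (auto intro!: derivative_eq_intros)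
  then have "(q has_real_derivative poly (pderiv p) ((?x - a0) / h - m) * (1 / h)) (at ?x)"
    unfolding q_def by (rule DERIV_chain2[OF poly_DERIV])
  then have "deriv q ?x = poly (pderiv p) \<xi> / h"
    using h by (intro DERIV_imp_deriv) simp
  then show ?thesis
    using deriv_cong_ev[OF ev refl] by simp
qed

lemma degree_affine_pcompose: "degree (pcompose p [:c, d :: real:]) \<le> degree p"
proof -
  have "degree (pcompose p [:c, d:]) \<le> degree p * degree [:c, d:]"
    by (rule degree_pcompose_le)
  also have "\<dots> \<le> degree p * 1"
    by (intro mult_left_mono) auto
  finally show ?thesis by simp
qed

locale dg_on_mesh =
  fixes a0 b0 a T :: real and N k :: nat and u0 :: "real \<Rightarrow> real" and uh :: "real \<Rightarrow> real \<Rightarrow> real" and h :: real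
  assumes ab: "a0 < b0" and a: "a > 0" and T: "T > 0" and N: "N \<ge> 1"
    and h_def: "h = mesh_size a0 b0 N"
    and u0: "continuous_on UNIV u0" "periodic (b0 - a0) u0"
    and dg: "dg_solution a0 b0 N k a T u0 uh"
begin

lemma h: "h > 0" and hN: "h * real N = b0 - a0"
  using ab N by (simp_all add: h_def mesh_size_def)

lemma node: "node a0 b0 N s = a0 + h * (s - 1/2)"
  by (simp add: node_def h_def mult.commute)

lemma element: "element a0 b0 N (Suc n) = {a0 + h * real n..a0 + h * (real n + 1)}"
  by (simp add: element_def node algebra_simps)

lemma interior_element:
  assumes "0 < \<xi>" "\<xi> < 1"
  shows "a0 + h * (real n + \<xi>) \<in> interior (element a0 b0 N (Suc n))"
  using assms h by (simp add: element)

lemma periodic_cells: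
  assumes "periodic (b0 - a0) f"
  shows "f (a0 + h * (real_of_int j + \<xi>)) = f (a0 + h * (real_of_int (j mod int N) + \<xi>))"
proof -
  have "real_of_int j = real_of_int (j mod int N) + real_of_int (j div int N) * real N"
    by (metis mod_mult_div_eq mult.commute of_int_add of_int_mult of_int_of_nat_eq)
  then have "a0 + h * (real_of_int j + \<xi>) = a0 + h * (real_of_int (j mod int N) + \<xi>) + of_int (j div int N) * (b0 - a0)"
    unfolding hN[symmetric] by (simp only: algebra_simps)
  then show ?thesis
    by (simp only: periodic_int_multiple[OF assms])
qed

lemma mod_index:
  obtains n where "n < N" "j mod int N = int n"
proof
  show "nat (j mod int N) < N" "j mod int N = int (nat (j mod int N))"
    using N by (simp_all add: nat_less_iff)
qed

lemma piecewise_poly_in_dg_space: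
  assumes deg: "\<And>j. degree (Q j) \<le> k" and per: "\<And>j. Q (j + int N) = Q j"
  shows "(\<lambda>x. piecewise_poly Q ((x - a0) / h)) \<in> dg_space a0 b0 N k"
  unfolding dg_space_def
proof (intro CollectI conjI ballI)
  have "(x + (b0 - a0) - a0) / h = (x - a0) / h + real N" for x
    using h hN by (simp add: field_simps)
  moreover have "bounded_periodic (real N) (piecewise_poly Q)"
    by (rule bounded_periodic_piecewise_poly[OF N]) (rule per)
  ultimately show "periodic (b0 - a0) (\<lambda>x. piecewise_poly Q ((x - a0) / h))"
    unfolding bounded_periodic_def periodic_def by (simp only: simp_thms)
next
  fix j assume "j \<in> {1..N}"
  then obtain n where n: "j = Suc n" by (cases j) auto
  define r where "r = pcompose (Q (int n)) [:- a0 / h - real n, 1 / h:]"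
  have "degree r \<le> k"
    unfolding r_def by (rule order.trans[OF degree_affine_pcompose deg])
  moreover have "piecewise_poly Q ((x - a0) / h) = poly r x" if "x \<in> interior (element a0 b0 N j)" for x
  proof -
    have x: "a0 + h * real n < x" "x < a0 + h * (real n + 1)"
      using that by (simp_all add: n element)
    then have "0 \<le> (x - a0) / h - real n" "(x - a0) / h - real n < 1"
      using h by (auto simp: field_simps)
    from piecewise_poly_cell[OF this, of Q "int n"]
    have "piecewise_poly Q ((x - a0) / h) = poly (Q (int n)) ((x - a0) / h - real n)"
      by simp
    also have "(x - a0) / h - real n = - a0 / h - real n + x * (1 / h)"
      by (simp add: diff_divide_distrib)
    finally show ?thesis
      by (simp add: r_def poly_pcompose)
  qed
  ultimately show "\<exists>p. degree p \<le> k \<and> (\<forall>x\<in>interior (element a0 b0 N j). piecewise_poly Q ((x - a0) / h) = poly p x)"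
    by blast
qed

text \<open>Any \<open>k + 1\<close> distinct points in the interior of the reference cell would do.\<close>

definition sample :: "nat \<Rightarrow> real" where
  "sample i = real (i + 1) / real (k + 2)"

lemma sample: "inj_on sample {..k}" "i \<le> k \<Longrightarrow> 0 < sample i" "i \<le> k \<Longrightarrow> sample i < 1"
  by (auto simp: inj_on_def sample_def field_simps)

text \<open>The discrete solution on a cell is recovered by interpolation, as this exhibits its coefficients as fixed
  combinations of point values, whose differentiability in time is part of the scheme.  Reducing the cell
  index modulo \<open>N\<close> keeps the points inside the elements \<open>1, \<dots>, N\<close>.\<close>

definition local_poly :: "int \<Rightarrow> real \<Rightarrow> real poly" where
  "local_poly j t = (\<Sum>i\<le>k. smult (uh (a0 + h * (real_of_int (j mod int N) + sample i)) t) (lagrange_basis sample k i))"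

definition local_poly_dt :: "int \<Rightarrow> real \<Rightarrow> real poly" where
  "local_poly_dt j t = (\<Sum>i\<le>k. smult (vector_derivative (\<lambda>s. uh (a0 + h * (real_of_int (j mod int N) + sample i)) s) (at t within {0..T}))
      (lagrange_basis sample k i))"

lemma degree_local_poly: "degree (local_poly j t) \<le> k" "degree (local_poly_dt j t) \<le> k"
  unfolding local_poly_def local_poly_dt_def
  by (auto intro!: degree_sum_le order.trans[OF degree_smult_le] degree_lagrange_basis)

lemma local_poly_mod: "local_poly (j mod int N) t = local_poly j t" "local_poly_dt (j mod int N) t = local_poly_dt j t"
  by (simp_all add: local_poly_def local_poly_dt_def)

lemma uh_local_poly:
  assumes t: "t \<in> {0..T}" and \<xi>: "0 < \<xi>" "\<xi> < 1"
  shows "uh (a0 + h * (real_of_int j + \<xi>)) t = poly (local_poly j t) \<xi>"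
proof -
  have space: "(\<lambda>x. uh x t) \<in> dg_space a0 b0 N k"
    using dg t by (simp add: dg_solution_def)
  obtain n where n: "n < N" "j mod int N = int n"
    by (rule mod_index)
  then have "Suc n \<in> {1..N}" by simp
  then obtain p where p: "degree p \<le> k" "\<forall>x\<in>interior (element a0 b0 N (Suc n)). uh x t = poly p x"
    using space unfolding dg_space_def by blast
  define r where "r = pcompose p [:a0 + h * real n, h:]"
  have r: "uh (a0 + h * (real n + \<xi>)) t = poly r \<xi>" if "0 < \<xi>" "\<xi> < 1" for \<xi>
    using p(2) interior_element[OF that, of n] by (simp add: r_def poly_pcompose algebra_simps)
  have "degree r \<le> k"
    unfolding r_def by (rule order.trans[OF degree_affine_pcompose p(1)])
  from lagrange_interpolation[OF sample(1) this]
  have "r = (\<Sum>i\<le>k. smult (uh (a0 + h * (real n + sample i)) t) (lagrange_basis sample k i))"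
    by (simp add: r[OF sample(2,3)])
  then have "local_poly j t = r"
    by (simp add: local_poly_def n(2))
  moreover have "uh (a0 + h * (real_of_int j + \<xi>)) t = uh (a0 + h * (real n + \<xi>)) t"
    using periodic_cells[of "\<lambda>x. uh x t" j \<xi>] space by (simp add: dg_space_def n(2))
  ultimately show ?thesis
    using r[OF \<xi>] by simp
qed

lemma uh_sample_has_derivative:
  assumes t: "t \<in> {0..T}" and i: "i \<le> k"
  shows "((\<lambda>s. uh (a0 + h * (real_of_int (j mod int N) + sample i)) s) has_vector_derivative
     vector_derivative (\<lambda>s. uh (a0 + h * (real_of_int (j mod int N) + sample i)) s) (at t within {0..T})) (at t within {0..T})"
proof -
  obtain n where n: "n < N" "j mod int N = int n"
    by (rule mod_index)
  then have "Suc n \<in> {1..N}" by simp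
  then have "\<forall>x\<in>interior (element a0 b0 N (Suc n)). (\<lambda>s. uh x s) differentiable (at t within {0..T})"
    using dg t unfolding dg_solution_def by blast
  then show ?thesis
    using interior_element[OF sample(2,3)[OF i], of n] n(2)
    by (simp add: vector_derivative_works[symmetric])
qed

lemma coeff_local_poly_has_derivative:
  assumes t: "t \<in> {0..T}"
  shows "((\<lambda>s. coeff (local_poly j s) i) has_real_derivative coeff (local_poly_dt j t) i) (at t within {0..T})"
  unfolding local_poly_def local_poly_dt_def coeff_sum coeff_smult
  by (intro DERIV_sum DERIV_cmult_right) (use uh_sample_has_derivative[OF t] in \<open>simp add: has_real_derivative_iff_has_vector_derivative\<close>)

lemma uh_time_derivative:
  assumes t: "t \<in> {0..T}" and \<xi>: "0 < \<xi>" "\<xi> < 1"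
  shows "vector_derivative (\<lambda>s. uh (a0 + h * (real_of_int j + \<xi>)) s) (at t within {0..T}) = poly (local_poly_dt j t) \<xi>"
proof -
  have "((\<lambda>s. \<Sum>i\<le>k. coeff (local_poly j s) i * \<xi> ^ i) has_real_derivative
      (\<Sum>i\<le>k. coeff (local_poly_dt j t) i * \<xi> ^ i)) (at t within {0..T})"
    by (intro DERIV_sum DERIV_cmult_right coeff_local_poly_has_derivative t)
  then have "((\<lambda>s. poly (local_poly j s) \<xi>) has_vector_derivative poly (local_poly_dt j t) \<xi>) (at t within {0..T})"
    by (simp add: has_real_derivative_iff_has_vector_derivative poly_altdef_le[OF degree_local_poly(1)]
        poly_altdef_le[OF degree_local_poly(2)])
  then have "((\<lambda>s. uh (a0 + h * (real_of_int j + \<xi>)) s) has_vector_derivative poly (local_poly_dt j t) \<xi>) (at t within {0..T})"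
    by (rule has_vector_derivative_transform[OF t, rotated]) (rule uh_local_poly[OF _ \<xi>])
  then show ?thesis
    using vector_derivative_within_cbox[of 0 T t] t T by simp
qed

text \<open>The test function repeats \<open>q\<close> on every cell, as the scheme for one element only sees that element.\<close>

lemma local_scheme:
  assumes t: "t \<in> {0..T}" and q: "degree q \<le> k"
  shows "cell_ip (poly (local_poly_dt j t)) (poly q) = (a / h) * (cell_ip (poly (local_poly j t)) (poly (pderiv q))
    - poly (local_poly j t) 1 * poly q 1 + poly (local_poly (j - 1) t) 1 * poly q 0)"
proof -
  obtain n where n: "n < N" "j mod int N = int n"
    by (rule mod_index)
  define v where "v x = piecewise_poly (\<lambda>_. q) ((x - a0) / h)" for x
  have v_space: "v \<in> dg_space a0 b0 N k"
    unfolding v_def[abs_def] by (rule piecewise_poly_in_dg_space) (simp_all add: q)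
  have v: "v (a0 + h * (m + \<xi>)) = poly q \<xi>" if "0 < \<xi>" "\<xi> < 1" "m \<in> \<int>" for m \<xi>
    using that h piecewise_poly_cell[of \<xi> "\<lambda>_. q"] by (auto simp: v_def elim!: Ints_cases)
  let ?P = "poly (local_poly j t)" and ?P' = "poly (local_poly_dt j t)"
  have uh: "uh (a0 + h * (real n + \<xi>)) t = ?P \<xi>" if "0 < \<xi>" "\<xi> < 1" for \<xi>
    using uh_local_poly[OF t that, of "int n"] local_poly_mod(1)[of j t] n(2) by simp
  have uht: "vector_derivative (\<lambda>s. uh (a0 + h * (real n + \<xi>)) s) (at t within {0..T}) = ?P' \<xi>" if "0 < \<xi>" "\<xi> < 1" for \<xi>
    using uh_time_derivative[OF t that, of "int n"] local_poly_mod(2)[of j t] n(2) by simp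
  have uhl: "uh (a0 + h * (real n - 1 + \<xi>)) t = poly (local_poly (j - 1) t) \<xi>" if "0 < \<xi>" "\<xi> < 1" for \<xi>
  proof -
    have "(int n - 1) mod int N = (j - 1) mod int N"
      unfolding n(2)[symmetric] by (simp add: mod_diff_left_eq)
    then have "local_poly (int n - 1) t = local_poly (j - 1) t"
      using local_poly_mod(1)[of "int n - 1" t] local_poly_mod(1)[of "j - 1" t] by simp
    then show ?thesis
      using uh_local_poly[OF t that, of "int n - 1"] by simp
  qed
  have I1: "(LBINT x:element a0 b0 N (Suc n). vector_derivative (\<lambda>s. uh x s) (at t within {0..T}) * v x)
      = h * cell_ip ?P' (poly q)"
    unfolding element cell_ip_def
    by (rule cell_change_of_variables[OF h]) (auto simp: uht v intro!: continuous_intros)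
  have "(LBINT x:element a0 b0 N (Suc n). a * uh x t * deriv v x)
      = h * integral {0..1} (\<lambda>\<xi>. a * ?P \<xi> * (poly (pderiv q) \<xi> / h))"
    unfolding element
    using h by (intro cell_change_of_variables[OF h])
      (auto simp: uh cell_deriv[OF h v] intro!: continuous_intros)
  also have "(\<lambda>\<xi>. a * ?P \<xi> * (poly (pderiv q) \<xi> / h)) = (\<lambda>\<xi>. (a / h) * (?P \<xi> * poly (pderiv q) \<xi>))"
    by (rule ext) simp
  finally have I2: "(LBINT x:element a0 b0 N (Suc n). a * uh x t * deriv v x) = a * cell_ip ?P (poly (pderiv q))"
    using h by (simp add: cell_ip_def)
  have node1: "node a0 b0 N (real (Suc n) + 1/2) = a0 + h * (real n + 1)"
    and node0: "node a0 b0 N (real (Suc n) - 1/2) = a0 + h * real n"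
    by (simp_all add: node algebra_simps)
  have node0': "a0 + h * real n = a0 + h * (real n - 1 + 1)" by simp
  have f1: "upwind_flux a0 b0 N a (\<lambda>x. uh x t) (real (Suc n) + 1/2) = a * ?P 1"
    unfolding upwind_flux_def node1 using cell_traces(1)[OF h uh] by simp
  have f0: "upwind_flux a0 b0 N a (\<lambda>x. uh x t) (real (Suc n) - 1/2) = a * poly (local_poly (j - 1) t) 1"
    unfolding upwind_flux_def node0 node0' using cell_traces(1)[OF h uhl] by simp
  have v1: "left_trace v (node a0 b0 N (real (Suc n) + 1/2)) = poly q 1"
    unfolding node1 by (rule cell_traces(1)[OF h v]) simp_all
  have v0: "right_trace v (node a0 b0 N (real (Suc n) - 1/2)) = poly q 0"
    unfolding node0 by (rule cell_traces(2)[OF h v]) simp_all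
  have "Suc n \<in> {1..N}" using n(1) by simp
  then have "(LBINT x:element a0 b0 N (Suc n). vector_derivative (\<lambda>s. uh x s) (at t within {0..T}) * v x)
         - (LBINT x:element a0 b0 N (Suc n). a * uh x t * deriv v x)
         + upwind_flux a0 b0 N a (\<lambda>x. uh x t) (real (Suc n) + 1/2) * left_trace v (node a0 b0 N (real (Suc n) + 1/2))
         - upwind_flux a0 b0 N a (\<lambda>x. uh x t) (real (Suc n) - 1/2) * right_trace v (node a0 b0 N (real (Suc n) - 1/2)) = 0"
    using dg t v_space unfolding dg_solution_def by blast
  then have "h * cell_ip ?P' (poly q) - a * cell_ip ?P (poly (pderiv q)) + a * ?P 1 * poly q 1
      - a * poly (local_poly (j - 1) t) 1 * poly q 0 = 0"
    unfolding I1 I2 f1 f0 v1 v0 .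
  then show ?thesis
    using h by (simp add: field_simps)
qed

text \<open>Here the test function has to vanish outside one cell, as the initial condition is a statement about the
  whole interval.\<close>

lemma local_initial_projection: "initial_projection k local_poly (\<lambda>X. u0 (a0 + h * X))"
  unfolding initial_projection_def
proof (intro allI impI)
  fix j and q :: "real poly" assume q: "degree q \<le> k"
  have T0: "0 \<in> {0..T}" using T by simp
  obtain n where n: "n < N" "j mod int N = int n"
    by (rule mod_index)
  define Q where "Q i = (if i mod int N = int n then q else 0)" for i
  define v where "v x = piecewise_poly Q ((x - a0) / h)" for x
  have v_space: "v \<in> dg_space a0 b0 N k"
    unfolding v_def[abs_def] by (rule piecewise_poly_in_dg_space) (simp_all add: q Q_def)
  have v_cell: "v (a0 + h * (real m + \<xi>)) = (if m = n then poly q \<xi> else 0)" if "0 < \<xi>" "\<xi> < 1" "m < N" for m \<xi>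
    using that h piecewise_poly_cell[of \<xi> Q "int m"] by (simp add: v_def Q_def)
  define f where "f x = (u0 x - uh x 0) * v x" for x
  have f_zero: "f (a0 + h * (real m + \<xi>)) = 0" if "0 < \<xi>" "\<xi> < 1" "m < N" "m \<noteq> n" for m \<xi>
    using v_cell[OF that(1-3)] that(4) by (simp add: f_def)
  have "0 = (LBINT x:{a0..b0}. f x)"
    using dg v_space unfolding dg_solution_def f_def by simp
  also have "\<dots> = (LBINT x:{a0 + h * real n..a0 + h * (real n + 1)}. f x)"
    unfolding set_lebesgue_integral_def
  \<comment> \<open>The nodes, where the values of the functions are arbitrary.\<close>
  proof (rule integral_discrete_difference[where X="(\<lambda>i. a0 + h * real i) ` UNIV"])
    fix x assume x: "x \<notin> (\<lambda>i. a0 + h * real i) ` UNIV"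
    have sub: "{a0 + h * real n..a0 + h * (real n + 1)} \<subseteq> {a0..b0}"
    proof -
      have "h * (real n + 1) \<le> h * real N"
        using n(1) h by (intro mult_left_mono) auto
      then show ?thesis using h hN by auto
    qed
    show "indicator {a0..b0} x *\<^sub>R f x = indicator {a0 + h * real n..a0 + h * (real n + 1)} x *\<^sub>R f x"
    proof (cases "x \<in> {a0..b0}")
      case True
      define X where "X = (x - a0) / h"
      have xX: "x = a0 + h * X" using h by (simp add: X_def)
      have X0: "0 \<le> X" "X \<le> real N"
        using True h hN by (auto simp: X_def field_simps)
      define m where "m = nat \<lfloor>X\<rfloor>"
      have fl: "real m \<le> X" "X < real m + 1"
        using X0 unfolding m_def by (simp_all add: of_nat_nat)
      have "X \<noteq> real i" for i
        using x xX by auto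
      then have m: "0 < X - real m" "X - real m < 1" "m < N"
        using fl X0(2) order_le_less[of X "real N"] by (auto simp: order_le_less)
      show ?thesis
      proof (cases "m = n")
        case True
        have "x \<in> {a0 + h * real n..a0 + h * (real n + 1)}"
          using fl h True by (simp add: xX)
        then show ?thesis using \<open>x \<in> {a0..b0}\<close> by simp
      next
        case False
        have "f x = 0"
          using f_zero[OF m False] by (simp add: xX)
        then show ?thesis by simp
      qed
    qed (use sub in auto)
  qed auto
  also have "\<dots> = h * integral {0..1} (\<lambda>\<xi>. (u0 (a0 + h * (real n + \<xi>)) - poly (local_poly j 0) \<xi>) * poly q \<xi>)"
  proof (rule cell_change_of_variables[OF h])
    fix \<xi> :: real assume \<xi>: "0 < \<xi>" "\<xi> < 1"
    have "uh (a0 + h * (real n + \<xi>)) 0 = poly (local_poly j 0) \<xi>"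
      using uh_local_poly[OF T0 \<xi>, of "int n"] local_poly_mod(1)[of j 0] n(2) by simp
    then show "f (a0 + h * (real n + \<xi>)) = (u0 (a0 + h * (real n + \<xi>)) - poly (local_poly j 0) \<xi>) * poly q \<xi>"
      by (simp add: f_def v_cell[OF \<xi> n(1)])
  qed (intro continuous_intros continuous_on_compose2[OF u0(1)], auto)
  finally have "integral {0..1} (\<lambda>\<xi>. (u0 (a0 + h * (real n + \<xi>)) - poly (local_poly j 0) \<xi>) * poly q \<xi>) = 0"
    using h by simp
  moreover have "u0 (a0 + h * (real_of_int j + \<xi>)) = u0 (a0 + h * (real n + \<xi>))" for \<xi>
    using periodic_cells[OF u0(2), of j \<xi>] n(2) by simp
  ultimately show "cell_ip (\<lambda>\<xi>. u0 (a0 + h * (real_of_int j + \<xi>)) - poly (local_poly j 0) \<xi>) (poly q) = 0"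
    by (simp add: cell_ip_def)
qed

lemma unit_mesh_scheme: "unit_dg k N (a / h) T local_poly local_poly_dt"
proof
  show "local_poly (j + int N) t = local_poly j t" for j t
    by (simp add: local_poly_def)
  show "1 \<le> N" "0 < a / h" "0 < T"
    using N a h T by simp_all
qed (rule degree_local_poly coeff_local_poly_has_derivative local_scheme; assumption)+

end

section \<open>The exact solution and the error estimate\<close>

text \<open>The derivative of \<open>u\<close> along the characteristic \<open>s \<mapsto> x - a T + a s\<close> is the left-hand side of the equation.  Joint
  differentiability provides the chain rule.\<close>

lemma advection_solution_translates:
  assumes u: "advection_solution a0 b0 a T u0 u" and T: "T > 0"
  shows "u x T = u0 (x - a * T)"
proof -
  define y where "y s = x - a * T + a * s" for s
  have diff: "((\<lambda>s. u (y s) s) has_vector_derivative 0) (at t within {0..T})" if t: "t \<in> {0..T}" for t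
  proof -
    let ?f = "\<lambda>p. u (fst p) (snd p)" and ?S = "UNIV \<times> {0..T}"
    have "(\<lambda>(y, s). u y s) differentiable (at (y t, t) within ?S)"
      and pde: "vector_derivative (\<lambda>s. u (y t) s) (at t within {0..T}) + a * deriv (\<lambda>x. u x t) (y t) = 0"
      using u t unfolding advection_solution_def by auto
    then obtain D where D: "(?f has_derivative D) (at (y t, t) within ?S)"
      unfolding differentiable_def by (auto simp: case_prod_unfold)
    then have lin: "linear D"
      by (rule has_derivative_linear)
    have curve: "((\<lambda>s. ?f (g s)) has_derivative (\<lambda>r. D (g' r))) (at s within A)"
      if "(g has_derivative g') (at s within A)" "g s = (y t, t)" "g ` A \<subseteq> ?S" for g :: "real \<Rightarrow> real \<times> real" and g' s A
      using has_derivative_in_compose[OF that(1), of ?f D] has_derivative_subset[OF D that(3)] that(2) by simp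
    have lin1: "D (r * p, r * q) = r * D (p, q)" for r p q
      using linear_scale[OF lin, of r "(p, q)"] by simp
    have "((\<lambda>s. (y t, s)) has_derivative (\<lambda>r. (0, r))) (at t within {0..T})"
      by (intro has_derivative_Pair has_derivative_const has_derivative_ident)
    from curve[OF this refl] have "((\<lambda>s. u (y t) s) has_derivative (\<lambda>r. D (0, r))) (at t within {0..T})"
      unfolding fst_conv snd_conv by blast
    moreover have "(\<lambda>r. D (0, r)) = (\<lambda>r. r *\<^sub>R D (0, 1))"
    proof
      show "D (0, r) = r *\<^sub>R D (0, 1)" for r
        using lin1[of r 0 1] by simp
    qed
    ultimately have "((\<lambda>s. u (y t) s) has_vector_derivative D (0, 1)) (at t within cbox 0 T)"
      unfolding has_vector_derivative_def cbox_interval by metis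
    then have "vector_derivative (\<lambda>s. u (y t) s) (at t within cbox 0 T) = D (0, 1)"
      by (rule vector_derivative_within_cbox[rotated 2]) (use t T in auto)
    then have 1: "vector_derivative (\<lambda>s. u (y t) s) (at t within {0..T}) = D (0, 1)"
      by (simp only: cbox_interval)
    have "((\<lambda>x. (x, t)) has_derivative (\<lambda>r. (r, 0))) (at (y t) within UNIV)"
      by (intro has_derivative_Pair has_derivative_const has_derivative_ident)
    from curve[OF this refl] have "((\<lambda>x. u x t) has_derivative (\<lambda>r. D (r, 0))) (at (y t))"
      unfolding fst_conv snd_conv using t by blast
    moreover have "(\<lambda>r. D (r, 0)) = (\<lambda>r. D (1, 0) * r)"
    proof
      show "D (r, 0) = D (1, 0) * r" for r
        using lin1[of r 1 0] by simp
    qed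
    ultimately have "((\<lambda>x. u x t) has_real_derivative D (1, 0)) (at (y t))"
      unfolding has_field_derivative_def by metis
    then have 2: "deriv (\<lambda>x. u x t) (y t) = D (1, 0)"
      by (rule DERIV_imp_deriv)
    have "(y has_derivative (\<lambda>r. a * r)) (at t within {0..T})"
      unfolding y_def[abs_def] by (auto intro!: derivative_eq_intros)
    then have "((\<lambda>s. (y s, s)) has_derivative (\<lambda>r. (a * r, r))) (at t within {0..T})"
      by (intro has_derivative_Pair has_derivative_ident)
    from curve[OF this refl] have "((\<lambda>s. u (y s) s) has_derivative (\<lambda>r. D (a * r, r))) (at t within {0..T})"
      unfolding fst_conv snd_conv by blast
    moreover have "D (a * r, r) = 0" for r
    proof -
      have "D (a * r, r) = D (a * r, 0) + D (0, r)"
        using linear_add[OF lin, of "(a * r, 0)" "(0, r)"] by simp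
      also have "\<dots> = r * (D (0, 1) + a * D (1, 0))"
        using lin1[of "a * r" 1 0] lin1[of r 0 1] by (simp add: algebra_simps)
      also have "\<dots> = 0"
        using pde 1 2 by simp
      finally show ?thesis .
    qed
    ultimately show ?thesis
      unfolding has_vector_derivative_def by simp
  qed
  obtain c where "\<And>s. s \<in> {0..T} \<Longrightarrow> u (y s) s = c"
    by (rule has_vector_derivative_zero_constant[of "{0..T}" "\<lambda>s. u (y s) s"]) (use diff in auto)
  then have "u (y T) T = u (y 0) 0"
    using T by simp
  then show ?thesis
    using u by (simp add: y_def advection_solution_def)
qed

lemma smooth_deriv_chain:
  assumes "smooth f"
  shows "deriv_chain n (\<lambda>i. (deriv ^^ i) f)"
  using assms unfolding deriv_chain_def smooth_def
  by (auto simp: DERIV_deriv_iff_real_differentiable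
      intro!: continuous_at_imp_continuous_on differentiable_imp_continuous_within)

lemma periodic_derivs:
  assumes "smooth f" "periodic L f"
  shows "periodic L ((deriv ^^ i) f)"
proof (induction i)
  case (Suc i)
  let ?g = "(deriv ^^ i) f"
  have g: "(?g has_real_derivative (deriv ^^ Suc i) f x) (at x)" for x
    by (rule deriv_chainD[OF smooth_deriv_chain[OF assms(1)]]) (rule lessI)
  have "((\<lambda>x. ?g (x + L)) has_real_derivative (deriv ^^ Suc i) f (x + L)) (at x)" for x
    by (rule DERIV_shift[THEN iffD1, OF g])
  moreover have "(\<lambda>x. ?g (x + L)) = ?g"
    using Suc by (auto simp: periodic_def)
  ultimately show ?case
    using g DERIV_unique unfolding periodic_def by metis
qed (use assms in simp)

lemma conv_scaled_affine:
  assumes h: "h > 0"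
  shows "conv (scaled h K) f (a0 + h * X) = conv K (\<lambda>Y. f (a0 + h * Y)) X"
proof -
  have "conv (scaled h K) f (a0 + h * X) = h * (LBINT Y. 1 / h * K ((a0 + h * X - (a0 + h * Y)) / h) * f (a0 + h * Y))"
    unfolding conv_def scaled_def using h by (subst lborel_integral_real_affine[of h _ a0]) simp_all
  also have "\<dots> = (LBINT Y. K (X - Y) * f (a0 + h * Y))"
  proof -
    have "h * (1 / h * K ((a0 + h * X - (a0 + h * Y)) / h) * f (a0 + h * Y)) = K (X - Y) * f (a0 + h * Y)" for Y
      using h by (simp add: right_diff_distrib[symmetric])
    then show ?thesis
      unfolding integral_mult_right_zero[symmetric] by (intro Bochner_Integration.integral_cong refl)
  qed
  finally show ?thesis by (simp add: conv_def)
qed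

lemma conv_cong_off_Ints:
  assumes "\<And>Y. Y \<notin> \<int> \<Longrightarrow> f Y = g Y"
  shows "conv K f X = conv K g X"
  unfolding conv_def
  by (rule integral_discrete_difference[where X="\<int>"]) (use assms in \<open>auto simp: countable_int Ints_def\<close>)

lemma spline_mean_integrable_bounded_periodic:
  assumes "bounded_periodic L g"
  shows "integrable lborel (\<lambda>y. bspline l y * g (x - y))"
proof (rule bspline_mult_integrable)
  show "(\<lambda>y. g (x - y)) \<in> borel_measurable borel"
    using assms by (auto simp: bounded_periodic_def)
  show "\<exists>B. \<forall>y. \<bar>y\<bar> \<le> R \<longrightarrow> \<bar>g (x - y)\<bar> \<le> B" for R
    using assms by (auto simp: bounded_periodic_def)
qed

context dg_on_mesh
begin

lemma uh_piecewise_poly: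
  assumes "t \<in> {0..T}" "X \<notin> \<int>"
  shows "uh (a0 + h * X) t = piecewise_poly (\<lambda>j. local_poly j t) X"
proof -
  have "X \<noteq> of_int \<lfloor>X\<rfloor>"
    using assms(2) Ints_of_int by metis
  then have "0 < X - of_int \<lfloor>X\<rfloor>" "X - of_int \<lfloor>X\<rfloor> < 1"
    by linarith+
  from uh_local_poly[OF assms(1) this, of "\<lfloor>X\<rfloor>"] show ?thesis
    by (simp add: piecewise_poly_def)
qed

text \<open>The splitting \<open>u - K \<star> u\<^sub>h = (u - K \<star> u) + K \<star> (u - u\<^sub>h)\<close> in the variable \<open>X\<close>.\<close>

lemma filtered_error_pointwise:
  assumes z: "inj_on z {..2*k}" and cons: "C \<ge> 0"
    "\<And>F M x. deriv_chain (2*k+1) F \<Longrightarrow> (\<And>y. \<bar>F (2*k+1) y\<bar> \<le> M) \<Longrightarrow>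
       \<bar>conv (spline_comb k z (filter_coeffs k z)) (F 0) x - F 0 x\<bar> \<le> C * M"
    and F: "deriv_chain (2*k+1) F" and F0: "\<And>X. F 0 X = u0 (a0 + h * X)" and bF: "\<And>x. \<bar>F (2*k+1) x\<bar> \<le> M"
  defines "v \<equiv> \<lambda>x. spline_mean (k + 1) (\<lambda>y. F 0 (x - y - a / h * T) - piecewise_poly (\<lambda>j. local_poly j T) (x - y))"
  shows "\<bar>u0 (a0 + h * X - a * T) - conv (scaled h (spline_comb k z (filter_coeffs k z))) (\<lambda>\<xi>. uh \<xi> T) (a0 + h * X)\<bar>
    \<le> C * M + (\<Sum>\<gamma>\<le>2*k. \<bar>filter_coeffs k z \<gamma>\<bar> * \<bar>v (X - z \<gamma>)\<bar>)"
proof -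
  let ?c = "filter_coeffs k z"
  let ?K = "spline_comb k z ?c"
  have TT: "T \<in> {0..T}" using T by simp
  define U where "U X = F 0 (X - a / h * T)" for X
  define W where "W = piecewise_poly (\<lambda>j. local_poly j T)"
  have U: "U X = u0 (a0 + h * X - a * T)" for X
    using h by (simp add: U_def F0 algebra_simps)
  have cU: "continuous_on UNIV U"
    unfolding U_def[abs_def]
    by (intro continuous_on_compose2[OF deriv_chain_continuous[OF F, of 0 UNIV]] continuous_intros) auto
  have W: "bounded_periodic (real N) W"
    unfolding W_def by (rule bounded_periodic_piecewise_poly[OF N]) (simp add: local_poly_def)
  have iW: "integrable lborel (\<lambda>y. bspline (k + 1) y * W (x - y))" for x
    by (rule spline_mean_integrable_bounded_periodic[OF W])
  have iU: "integrable lborel (\<lambda>y. bspline (k + 1) y * U (x - y))" for x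
    by (intro bspline_continuous_integrable continuous_on_compose2[OF cU] continuous_intros) auto
  have v: "v x = spline_mean (k + 1) (\<lambda>y. U (x - y)) - spline_mean (k + 1) (\<lambda>y. W (x - y))" for x
    unfolding v_def U_def[symmetric] W_def[symmetric] spline_mean_def right_diff_distrib
    by (rule Bochner_Integration.integral_diff[OF iU iW])
  have "conv (scaled h ?K) (\<lambda>\<xi>. uh \<xi> T) (a0 + h * X) = conv ?K W X"
    unfolding conv_scaled_affine[OF h] W_def by (rule conv_cong_off_Ints) (rule uh_piecewise_poly[OF TT])
  also have "\<dots> = (\<Sum>\<gamma>\<le>2*k. ?c \<gamma> * spline_mean (k + 1) (\<lambda>y. W (X - z \<gamma> - y)))"
    by (rule conv_spline_comb[OF iW])
  also have "\<dots> = conv ?K U X - (\<Sum>\<gamma>\<le>2*k. ?c \<gamma> * v (X - z \<gamma>))"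
    unfolding conv_spline_comb[OF iU] v sum_subtractf[symmetric] by (simp add: algebra_simps)
  finally have "u0 (a0 + h * X - a * T) - conv (scaled h ?K) (\<lambda>\<xi>. uh \<xi> T) (a0 + h * X)
      = (\<Sum>\<gamma>\<le>2*k. ?c \<gamma> * v (X - z \<gamma>)) - (conv ?K U X - U X)"
    by (simp add: U)
  also have "\<bar>\<dots>\<bar> \<le> \<bar>\<Sum>\<gamma>\<le>2*k. ?c \<gamma> * v (X - z \<gamma>)\<bar> + \<bar>conv ?K U X - U X\<bar>"
    by (rule abs_triangle_ineq4)
  also have "\<dots> \<le> (\<Sum>\<gamma>\<le>2*k. \<bar>?c \<gamma>\<bar> * \<bar>v (X - z \<gamma>)\<bar>) + C * M"
  proof (rule add_mono)
    show "\<bar>\<Sum>\<gamma>\<le>2*k. ?c \<gamma> * v (X - z \<gamma>)\<bar> \<le> (\<Sum>\<gamma>\<le>2*k. \<bar>?c \<gamma>\<bar> * \<bar>v (X - z \<gamma>)\<bar>)"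
      by (rule order.trans[OF sum_abs]) (simp add: abs_mult)
    have "deriv_chain (2*k+1) (\<lambda>i x. F i (- (a / h * T) + x))"
      by (rule deriv_chain_translate[OF F])
    from cons(2)[OF this bF] show "\<bar>conv ?K U X - U X\<bar> \<le> C * M"
      by (simp add: U_def[abs_def])
  qed
  finally show ?thesis by simp
qed

end


lemma range_integral_translates:
  assumes L: "L > 0" and g: "bounded_periodic L g"
  shows "range_integral (\<lambda>x. A + B * (\<Sum>\<gamma>\<le>n. g (x - z \<gamma>))) s (s + L)
    = A * L + B * (real (n + 1) * range_integral g 0 L)"
proof -
  have g': "bounded_periodic L (\<lambda>x. g (x - z \<gamma>))" for \<gamma>
    using bounded_periodic_translate[OF g, of "- z \<gamma>"] by simp
  have c: "bounded_periodic L (\<lambda>x. A)"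
    by (intro bounded_periodic_continuous L) (simp_all add: periodic_def)
  note int = range_integrable[OF g'] range_integrable[OF c]
  have each: "(LBINT x. indicator {s..<s + L} x * g (x - z \<gamma>)) = range_integral g 0 L" for \<gamma>
    using range_integral_translate[of g "- z \<gamma>" s "s + L"] range_integral_period[OF L g, of "s - z \<gamma>"]
    by (simp add: range_integral_def algebra_simps)
  have "range_integral (\<lambda>x. A + B * (\<Sum>\<gamma>\<le>n. g (x - z \<gamma>))) s (s + L)
    = (LBINT x. indicator {s..<s + L} x * A + (\<Sum>\<gamma>\<le>n. B * (indicator {s..<s + L} x * g (x - z \<gamma>))))"
    unfolding range_integral_def
    by (intro Bochner_Integration.integral_cong refl) (simp add: distrib_left sum_distrib_left mult_ac)
  also have "\<dots> = (LBINT x. indicator {s..<s + L} x * A) + (LBINT x. \<Sum>\<gamma>\<le>n. B * (indicator {s..<s + L} x * g (x - z \<gamma>)))"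
    by (intro Bochner_Integration.integral_add Bochner_Integration.integrable_sum integrable_mult_right int)
  also have "(LBINT x. \<Sum>\<gamma>\<le>n. B * (indicator {s..<s + L} x * g (x - z \<gamma>)))
    = (\<Sum>\<gamma>\<le>n. LBINT x. B * (indicator {s..<s + L} x * g (x - z \<gamma>)))"
    by (intro Bochner_Integration.integral_sum integrable_mult_right int)
  also have "\<dots> = B * (real (n + 1) * range_integral g 0 L)"
    by (simp add: each)
  also have "(LBINT x. indicator {s..<s + L} x * A) = A * L"
    using L by simp
  finally show ?thesis .
qed

text \<open>The continuous majorant \<open>G\<close> avoids any discussion of the integrability of \<open>r\<close>.\<close>

lemma L2norm_le_affine_period:
  fixes h :: real
  assumes h: "h > 0" and L: "L = h * real N" "L > 0"
    and sub: "A \<subseteq> {s..<s + L}" and G: "continuous_on UNIV G"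
    and r: "\<And>X. (r (a0 + h * X))\<^sup>2 \<le> G X"
  shows "L2norm A r \<le> sqrt (h * range_integral G ((s - a0) / h) ((s - a0) / h + real N))"
proof -
  define g where "g x = G ((x - a0) / h)" for x
  have cg: "continuous_on UNIV g"
    unfolding g_def using h by (intro continuous_on_compose2[OF G] continuous_intros) auto
  have rg: "(r x)\<^sup>2 \<le> g x" for x
    using r[of "(x - a0) / h"] h by (simp add: g_def)
  have "set_integrable lborel {s..s + L} g"
    by (intro borel_integrable_atLeastAtMost' continuous_on_subset[OF cg]) auto
  then have "set_integrable lborel {s..<s + L} g"
    by (rule set_integrable_subset) auto
  then have int: "integrable lborel (\<lambda>x. indicator {s..<s + L} x * g x)"
    by (simp add: set_integrable_def)
  have meas: "(\<lambda>x. indicator {s..<s + L} x * g x) \<in> borel_measurable lborel"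
    using int by (rule borel_measurable_integrable)
  have "(LINT x:A|lebesgue. (r x)\<^sup>2) \<le> (LINT x|lebesgue. indicator {s..<s + L} x * g x)"
    unfolding set_lebesgue_integral_def
  proof (rule Bochner_Integration.integral_mono')
    show "integrable lebesgue (\<lambda>x. indicator {s..<s + L} x * g x)"
      using int meas by (simp add: integrable_completion)
    fix x
    show "0 \<le> indicator {s..<s + L} x * g x"
      using order.trans[OF zero_le_power2 rg] by (simp add: indicator_def)
    show "indicator A x *\<^sub>R (r x)\<^sup>2 \<le> indicator {s..<s + L} x * g x"
      using rg[of x] order.trans[OF zero_le_power2 rg, of x] sub by (auto simp: indicator_def)
  qed
  also have "\<dots> = (LBINT x. indicator {s..<s + L} x * g x)"
    by (rule integral_completion[OF meas])
  also have "\<dots> = h * (LBINT X. indicator {s..<s + L} (a0 + h * X) * g (a0 + h * X))"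
    using h by (subst lborel_integral_real_affine[of h _ a0]) simp_all
  also have "(\<lambda>X. indicator {s..<s + L} (a0 + h * X) * g (a0 + h * X))
      = (\<lambda>X. indicator {(s - a0) / h..<(s - a0) / h + real N} X * G X)"
  proof
    fix X
    have "a0 + h * X \<in> {s..<s + L} \<longleftrightarrow> X \<in> {(s - a0) / h..<(s - a0) / h + real N}"
      using h unfolding L by (auto simp: field_simps)
    then show "indicator {s..<s + L} (a0 + h * X) * g (a0 + h * X)
      = indicator {(s - a0) / h..<(s - a0) / h + real N} X * G X"
      using h by (auto simp: indicator_def g_def)
  qed
  finally show ?thesis
    unfolding L2norm_def range_integral_def by (intro real_sqrt_le_mono)
qed

lemma subset_period_of_compactly_contained:
  assumes "compactly_contained (A + (*) 2 ` supp K) B" "B \<subseteq> {a0..b0}" "K x \<noteq> 0"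
  shows "A \<subseteq> {a0 - 2 * x..<b0 - 2 * x}"
proof
  fix y assume y: "y \<in> A"
  have "x \<in> supp K"
    using assms(3) closure_subset[of "{x. K x \<noteq> 0}"] by (auto simp: supp_def)
  then have "y + 2 * x \<in> A + (*) 2 ` supp K"
    using y by (intro set_plus_intro) auto
  then have "y + 2 * x \<in> interior B"
    using assms(1) closure_subset unfolding compactly_contained_def by blast
  also have "interior B \<subseteq> interior {a0..b0}"
    by (rule interior_mono[OF assms(2)])
  finally show "y \<in> {a0 - 2 * x..<b0 - 2 * x}"
    by auto
qed

theorem theorem4p1:
  fixes a0 b0 a T \<epsilon> :: real and k :: nat
    and u0 :: "real \<Rightarrow> real" and u :: "real \<Rightarrow> real \<Rightarrow> real"
    and \<Omega>0 \<Omega>1 :: "real set"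
  assumes "a0 < b0" and "a > 0" and "T > 0" and "\<epsilon> > 0"
    and "smooth u0" and "periodic (b0 - a0) u0"
    and "advection_solution a0 b0 a T u0 u"
    and "\<Omega>0 \<in> sets lebesgue" and "\<Omega>1 \<subseteq> {a0..b0}"
  shows "\<exists>C. \<forall>N\<ge>1. \<forall>h uh.
           h = mesh_size a0 b0 N \<longrightarrow>
           dg_solution a0 b0 N k a T u0 uh \<longrightarrow>
           compactly_contained (\<Omega>0 + (*) 2 ` supp (scaled h (original_filter k))) \<Omega>1 \<longrightarrow>
           L2norm \<Omega>0 (\<lambda>x. u x T - conv (scaled h (compact_filter k \<epsilon>)) (\<lambda>\<xi>. uh \<xi> T) x)
             \<le> C * h ^ (2 * k + 1)"
proof -
  define L where "L = b0 - a0"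
  have L: "L > 0" using \<open>a0 < b0\<close> by (simp add: L_def)
  define D where "D i = (deriv ^^ i) u0" for i
  have D: "deriv_chain n D" for n
    unfolding D_def[abs_def] by (rule smooth_deriv_chain[OF \<open>smooth u0\<close>])
  have perD: "periodic L (D i)" for i
    unfolding D_def L_def by (rule periodic_derivs[OF \<open>smooth u0\<close> \<open>periodic (b0 - a0) u0\<close>])
  have cD: "continuous_on UNIV (D i)" for i
    by (rule deriv_chain_continuous[OF D order.refl])
  obtain M1 where M1: "M1 > 0" "\<And>x. \<bar>D (2*k+1) x\<bar> \<le> M1"
    using periodic_continuous_bounded[OF L cD perD] by blast
  obtain M2 where M2: "M2 > 0" "\<And>x. \<bar>D (2*k+2) x\<bar> \<le> M2"
    using periodic_continuous_bounded[OF L cD perD] by blast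
  define z where "z \<gamma> = \<epsilon> * shift k \<gamma>" for \<gamma>
  have z: "inj_on z {..2*k}"
    unfolding z_def[abs_def] using \<open>\<epsilon> > 0\<close> by (intro inj_shift) simp
  define w where "w = filter_coeffs k z"
  have filter: "compact_filter k \<epsilon> = spline_comb k z w"
    by (simp add: compact_filter_def w_def z_def[abs_def])
  obtain C1 where C1: "C1 \<ge> 0" "\<And>F M x. deriv_chain (2*k+1) F \<Longrightarrow> (\<And>y. \<bar>F (2*k+1) y\<bar> \<le> M) \<Longrightarrow>
       \<bar>conv (spline_comb k z (filter_coeffs k z)) (F 0) x - F 0 x\<bar> \<le> C1 * M"
    using filter_consistency[OF z] by blast
  obtain c where const: "projection_constant k c"
    using projection_constant_exists by blast
  then have c: "c > 0" by (simp add: projection_constant_def)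
  define \<kappa> where "\<kappa> = c * (1/2 + 2 * c\<^sup>2)"
  have \<kappa>: "\<kappa> \<ge> 0" using c by (simp add: \<kappa>_def)
  define B where "B = ((1 + c) * L + \<kappa> * a * T) * M2"
  define W where "W = (\<Sum>\<gamma>\<le>2*k. \<bar>w \<gamma>\<bar>\<^sup>2)"
  have W: "W \<ge> 0" by (simp add: W_def sum_nonneg)
  define C where "C = sqrt (L * (2 * (C1 * M1)\<^sup>2 + 2 * W * (real (2*k+1) * B\<^sup>2)))"
  show ?thesis
  proof (intro exI[of _ C] allI impI)
    fix N h uh
    assume "1 \<le> N" "h = mesh_size a0 b0 N" "dg_solution a0 b0 N k a T u0 uh"
      and cc: "compactly_contained (\<Omega>0 + (*) 2 ` supp (scaled h (original_filter k))) \<Omega>1"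
    then interpret dg_on_mesh a0 b0 a T N k u0 uh h
      using assms cD[of 0] by unfold_locales (simp_all add: D_def)
    define H where "H = h ^ (2*k+1)"
    have H: "H > 0" using h by (simp add: H_def)
    have LN: "L = h * real N" using hN by (simp add: L_def)
    have hL: "h \<le> L"
      using h N unfolding LN by simp
    define F where "F i X = h ^ i * D i (a0 + h * X)" for i X
    have F: "deriv_chain n F" for n
      unfolding F_def[abs_def] by (rule deriv_chain_affine[OF D])
    have F0: "F 0 X = u0 (a0 + h * X)" for X
      by (simp add: F_def D_def)
    have perF: "periodic (real N) (F i)" for i
    proof -
      have "a0 + h * (X + real N) = a0 + h * X + L" for X
        by (simp add: LN algebra_simps)
      then show ?thesis
        using perD[of i] by (simp only: periodic_def F_def simp_thms)
    qed
    have bF1: "\<bar>F (2*k+1) X\<bar> \<le> H * M1" for X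
      using M1(2) h by (simp add: F_def H_def abs_mult)
    have bF2: "\<bar>F (2*k+2) X\<bar> \<le> h ^ (2*k+2) * M2" for X
      using M2(2) h by (simp add: F_def abs_mult)
    have init: "initial_projection k local_poly (F 0)"
      using local_initial_projection by (simp add: F0[abs_def])
    define v where "v x = spline_mean (k + 1) (\<lambda>y. F 0 (x - y - a / h * T) - piecewise_poly (\<lambda>j. local_poly j T) (x - y))" for x
    have m: "h ^ (2*k+2) * M2 > 0" using h M2 by simp
    note est = filtered_error_estimate[OF unit_mesh_scheme F perF bF2 m init const, folded v_def \<kappa>_def]
    have cv: "continuous_on UNIV v" and perv: "periodic (real N) v"
      using est(1,2) by (simp_all add: v_def[abs_def])
    define V where "V = range_integral (\<lambda>x. (v x)\<^sup>2) 0 (real N)"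
    have V: "h * V \<le> L * (B * H)\<^sup>2"
    proof -
      have "(1 + c + \<kappa> * (a / h) * T) * (h ^ (2*k+2) * M2) = ((1 + c) * h + \<kappa> * a * T) * M2 * H"
        using h by (simp add: H_def field_simps)
      also have "\<dots> \<le> B * H"
        unfolding B_def using c hL M2(1) H a T by (intro mult_right_mono add_mono mult_left_mono) auto
      finally have 1: "(1 + c + \<kappa> * (a / h) * T) * (h ^ (2*k+2) * M2) \<le> B * H" .
      have "h * V \<le> h * (((1 + c + \<kappa> * (a / h) * T) * (h ^ (2*k+2) * M2)) * sqrt (real N))\<^sup>2"
        using est(3) h unfolding V_def by (intro mult_left_mono) (simp_all add: mult.assoc v_def)
      also have "\<dots> = L * ((1 + c + \<kappa> * (a / h) * T) * (h ^ (2*k+2) * M2))\<^sup>2"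
        by (simp add: power_mult_distrib LN mult_ac)
      also have "\<dots> \<le> L * (B * H)\<^sup>2"
        using L c \<kappa> a h T M2(1) by (intro mult_left_mono power_mono 1) simp_all
      finally show ?thesis .
    qed
    define r where "r x = u x T - conv (scaled h (compact_filter k \<epsilon>)) (\<lambda>\<xi>. uh \<xi> T) x" for x
    define G where "G X = 2 * (C1 * (H * M1))\<^sup>2 + 2 * W * (\<Sum>\<gamma>\<le>2*k. (v (X - z \<gamma>))\<^sup>2)" for X
    have cG: "continuous_on UNIV G"
      unfolding G_def[abs_def] by (intro continuous_intros continuous_on_compose2[OF cv]) auto
    have rG: "(r (a0 + h * X))\<^sup>2 \<le> G X" for X
    proof -
      let ?S = "\<Sum>\<gamma>\<le>2*k. \<bar>w \<gamma>\<bar> * \<bar>v (X - z \<gamma>)\<bar>"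
      have "r (a0 + h * X) = u0 (a0 + h * X - a * T) - conv (scaled h (spline_comb k z w)) (\<lambda>\<xi>. uh \<xi> T) (a0 + h * X)"
        unfolding r_def filter advection_solution_translates[OF assms(7) \<open>T > 0\<close>] ..
      also have "\<bar>\<dots>\<bar> \<le> C1 * (H * M1) + ?S"
        unfolding w_def v_def
        by (rule filtered_error_pointwise[OF z C1(1), where F=F and M="H * M1"]) (fact C1(2) F F0 bF1)+
      finally have "\<bar>r (a0 + h * X)\<bar>\<^sup>2 \<le> (C1 * (H * M1) + ?S)\<^sup>2"
        by (rule power_mono) simp
      also have "\<dots> \<le> 2 * (C1 * (H * M1))\<^sup>2 + 2 * ?S\<^sup>2"
        using sum_squares_bound[of "C1 * (H * M1)" ?S] by (simp add: power2_sum)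
      also have "?S\<^sup>2 \<le> W * (\<Sum>\<gamma>\<le>2*k. (v (X - z \<gamma>))\<^sup>2)"
        using Cauchy_Schwarz_ineq_sum[of "\<lambda>\<gamma>. \<bar>w \<gamma>\<bar>" "\<lambda>\<gamma>. \<bar>v (X - z \<gamma>)\<bar>" "{..2*k}"] by (simp add: W_def)
      finally show ?thesis by (simp add: G_def)
    qed
    obtain p where "original_filter k p \<noteq> 0"
      using filter_nonzero[of "shift k" k] inj_shift[of 1 k] unfolding original_filter_def by auto
    then have "scaled h (original_filter k) (h * p) \<noteq> 0"
      using h by (simp add: scaled_def)
    \<comment> \<open>Any point of the support of the original filter places \<open>\<Omega>\<^sub>0\<close> inside a translate of \<open>[a\<^sub>0, b\<^sub>0]\<close>.\<close>
    from subset_period_of_compactly_contained[OF cc \<open>\<Omega>1 \<subseteq> {a0..b0}\<close> this]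
    have sub: "\<Omega>0 \<subseteq> {a0 - 2 * (h * p)..<a0 - 2 * (h * p) + L}"
      by (simp add: L_def)
    have "L2norm \<Omega>0 r \<le> sqrt (h * range_integral G ((a0 - 2 * (h * p) - a0) / h) ((a0 - 2 * (h * p) - a0) / h + real N))"
      by (rule L2norm_le_affine_period[OF h LN L sub cG rG])
    also have "\<dots> = sqrt (h * (2 * (C1 * (H * M1))\<^sup>2 * real N + 2 * W * (real (2*k+1) * V)))"
      unfolding G_def[abs_def] V_def
      using N cv perv by (subst range_integral_translates)
        (auto intro!: bounded_periodic_continuous continuous_intros simp: periodic_def)
    also have "h * (2 * (C1 * (H * M1))\<^sup>2 * real N + 2 * W * (real (2*k+1) * V))
        = L * (2 * (C1 * (H * M1))\<^sup>2) + 2 * W * real (2*k+1) * (h * V)"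
      by (simp add: LN algebra_simps)
    also have "sqrt \<dots> \<le> sqrt (L * (2 * (C1 * (H * M1))\<^sup>2) + 2 * W * real (2*k+1) * (L * (B * H)\<^sup>2))"
      using W V by (intro real_sqrt_le_mono add_left_mono mult_left_mono) simp_all
    also have "L * (2 * (C1 * (H * M1))\<^sup>2) + 2 * W * real (2*k+1) * (L * (B * H)\<^sup>2)
        = (L * (2 * (C1 * M1)\<^sup>2 + 2 * W * (real (2*k+1) * B\<^sup>2))) * H\<^sup>2"
      by (simp add: power_mult_distrib algebra_simps)
    also have "sqrt \<dots> = C * H"
      using H by (simp add: real_sqrt_mult C_def)
    finally show "L2norm \<Omega>0 (\<lambda>x. u x T - conv (scaled h (compact_filter k \<epsilon>)) (\<lambda>\<xi>. uh \<xi> T) x) \<le> C * h ^ (2 * k + 1)"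
      by (simp add: r_def[abs_def] H_def)
  qed
qed

end
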